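(* Let $\Omega\subset\mathbb R^n$ be a domain, and let $u$ be a nonconstant measurable function on $\mathbb R^n$ such that $$u\in H^s_{\rm loc}(\Omega),\qquad \int_{\mathbb R^n}\frac{|u(x)|}{1+|x|^{n+2s}}\,dx<\infty,\qquad (-\Delta^N_\Omega)^s_{\rm Sr}u\ge0\ \text{ in }\Omega .$$ Then, up to the choice of a representative of $u$ (i.e. after modifying $u$ on a subset of $\Omega$ of Lebesgue measure zero), $u$ is lower semicontinuous on $\Omega$, locally bounded from below on $\Omega$, and $u(x)>\inf_{\mathbb R^n}u$ for every $x\in\Omega$.
   Context: Let $n\ge1$, $s\in(0,1)$, $C_{n,s}=\frac{s2^{2s}\Gamma(\frac n2+s)}{\pi^{n/2}\Gamma(1-s)}$, and $\Omega^{\mathsf c}=\mathbb R^n\setminus\Omega$. $H^s(\mathbb R^n)$ is the space of $v\in L^2(\mathbb R^n)$ with $\iint_{\mathbb R^n\times\mathbb R^n}\frac{(v(x)-v(y))^2}{|x-y|^{n+2s}}dxdy<\infty$. One writes $u\in H^s_{\rm loc}(\Omega)$ if for every $G\Subset\Omega$, $u$ coincides on $G$ with some $v\in H^s(\mathbb R^n)$. The Semirestricted Neumann Laplacian is, for regular $u$, $(-\Delta^N_\Omega)^s_{\rm Sr}u=\chi_\Omega\cdot(-\Delta)^su+\chi_{\Omega^{\mathsf c}}\cdot(-\Delta^N_\Omega)^s_{\rm R}u$, where $(-\Delta)^su(x)=C_{n,s}\,\mathrm{P.V.}\int_{\mathbb R^n}\frac{u(x)-u(y)}{|x-y|^{n+2s}}dy$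 and $(-\Delta^N_\Omega)^s_{\rm R}u(x)=C_{n,s}\,\mathrm{P.V.}\int_{\Omega}\frac{u(x)-u(y)}{|x-y|^{n+2s}}dy$. For $u$ as in the statement it is understood as the distribution in $\Omega$ $$\langle(-\Delta^N_\Omega)^s_{\rm Sr}u,\varphi\rangle=\frac{C_{n,s}}2\iint_{\mathbb R^{2n}\setminus(\Omega^{\mathsf c})^2}\frac{(u(x)-u(y))(\varphi(x)-\varphi(y))}{|x-y|^{n+2s}}\,dxdy,\qquad\varphi\in C_0^\infty(\Omega)$$ (absolutely convergent), where $(\Omega^{\mathsf c})^2=\Omega^{\mathsf c}\times\Omega^{\mathsf c}$. The inequality $(-\Delta^N_\Omega)^s_{\rm Sr}u\ge0$ in $\Omega$ means that this quantity is $\ge0$ for every $\varphi\in C_0^\infty(\Omega)$ with $\varphi\ge0$. Conventions: $\inf_G u$ denotes the essential infimum of $u$ over $G$ (possibly $-\infty$); "nonconstant" means not almost everywhere equal to a constant; the lower semicontinuous representative takes values in $(-\infty,+\infty]$. *)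

theory Defs
  imports "HOL-Analysis.Analysis"
begin

text \<open>
  Throughout, the space \<open>\<real>\<^sup>n\<close> is an arbitrary \<^class>\<open>euclidean_space\<close> \<open>'a\<close>, with \<open>n = DIM('a) \<ge> 1\<close>;
  measurability, integrals and null sets refer to Lebesgue measure on \<open>'a\<close> and on \<open>'a \<times> 'a\<close>.
\<close>

definition frac_const :: "nat \<Rightarrow> real \<Rightarrow> real" where
  "frac_const n s = s * 2 powr (2 * s) * Gamma (real n / 2 + s) / (pi powr (real n / 2) * Gamma (1 - s))"

text \<open>
  On the diagonal, a null set in \<open>'a \<times> 'a\<close>, the quotients below take the value \<open>0 / 0 = 0\<close>.
\<close>

definition frac_sobolev :: "real \<Rightarrow> ('a::euclidean_space \<Rightarrow> real) set" where
  "frac_sobolev s = {v. v \<in> borel_measurable lebesgue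
     \<and> integrable lebesgue (\<lambda>x. (v x)\<^sup>2)
     \<and> integrable lebesgue
         (\<lambda>(x :: 'a, y :: 'a). (v x - v y)\<^sup>2 / norm (x - y) powr (real DIM('a) + 2 * s))}"

definition frac_sobolev_loc :: "real \<Rightarrow> 'a::euclidean_space set \<Rightarrow> ('a \<Rightarrow> real) set" where
  "frac_sobolev_loc s \<Omega> = {u. \<forall>G. compact (closure G) \<and> closure G \<subseteq> \<Omega> \<longrightarrow>
     (\<exists>v \<in> frac_sobolev s. AE x in lebesgue. x \<in> G \<longrightarrow> u x = v x)}"

text \<open>
  A map is \<open>C\<^sup>k\<close> iff it is continuous (\<open>k = 0\<close>), or it is differentiable with all directional
  derivatives of class \<open>C\<^sup>k\<^sup>-\<^sup>1\<close> (\<open>k > 0\<close>).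
\<close>

primrec C_k :: "nat \<Rightarrow> ('a::euclidean_space \<Rightarrow> real) \<Rightarrow> bool" where
  "C_k 0 f \<longleftrightarrow> continuous_on UNIV f"
| "C_k (Suc k) f \<longleftrightarrow> (\<forall>x. f differentiable (at x)) \<and> (\<forall>v. C_k k (\<lambda>x. frechet_derivative f (at x) v))"

text \<open>Functions in \<open>C\<^sub>0\<^sup>\<infinity>(\<Omega>)\<close> are regarded as defined on the whole space, extended by zero.\<close>

definition test_functions :: "'a::euclidean_space set \<Rightarrow> ('a \<Rightarrow> real) set" where
  "test_functions \<Omega> = {\<phi>. (\<forall>k. C_k k \<phi>)
     \<and> compact (closure {x. \<phi> x \<noteq> 0}) \<and> closure {x. \<phi> x \<noteq> 0} \<subseteq> \<Omega>}"

text \<open>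
  The semirestricted Neumann Laplacian of \<open>u\<close> as a distribution in \<open>\<Omega>\<close>, evaluated at \<open>\<phi>\<close>. For
  \<open>u\<close> in the local fractional Sobolev space of \<open>\<Omega>\<close> with the usual weighted integrability at
  infinity, the double integral converges absolutely.
\<close>

definition sr_laplacian ::
    "real \<Rightarrow> 'a::euclidean_space set \<Rightarrow> ('a \<Rightarrow> real) \<Rightarrow> ('a \<Rightarrow> real) \<Rightarrow> real" where
  "sr_laplacian s \<Omega> u \<phi> = frac_const DIM('a) s / 2 *
     set_lebesgue_integral lebesgue (UNIV - (- \<Omega>) \<times> (- \<Omega>))
       (\<lambda>(x, y). (u x - u y) * (\<phi> x - \<phi> y) / norm (x - y) powr (real DIM('a) + 2 * s))"

definition sr_laplacian_nonneg :: "real \<Rightarrow> 'a::euclidean_space set \<Rightarrow> ('a \<Rightarrow> real) \<Rightarrow> bool" where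
  "sr_laplacian_nonneg s \<Omega> u \<longleftrightarrow>
     (\<forall>\<phi> \<in> test_functions \<Omega>. (\<forall>x. 0 \<le> \<phi> x) \<longrightarrow> 0 \<le> sr_laplacian s \<Omega> u \<phi>)"

definition ess_inf :: "'a measure \<Rightarrow> ('a \<Rightarrow> real) \<Rightarrow> ereal" where
  "ess_inf M f = Sup {c. AE x in M. c \<le> ereal (f x)}"

definition lsc_on :: "'a::topological_space set \<Rightarrow> ('a \<Rightarrow> ereal) \<Rightarrow> bool" where
  "lsc_on S f \<longleftrightarrow> (\<forall>x\<in>S. f x \<le> Liminf (at x within S) f)"

definition locally_bdd_below_on :: "'a::topological_space set \<Rightarrow> ('a \<Rightarrow> ereal) \<Rightarrow> bool" where
  "locally_bdd_below_on S f \<longleftrightarrow>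
     (\<forall>K. compact K \<and> K \<subseteq> S \<longrightarrow> (\<exists>m::real. \<forall>x\<in>K. ereal m \<le> f x))"

end

theory Submission
  imports Defs
begin

text \<open>
  Since test functions vanish off \<open>\<Omega>\<close>, the hypothesis says that \<open>u\<close> is a distributional supersolution of
  the full fractional Laplacian in \<open>\<Omega>\<close>, so its mollifications \<open>w\<close> are continuous and satisfy the
  pointwise inequality \<open>\<integral> (w (x + z) + w (x - z) - 2 w x) / |z|\<^sup>n\<^sup>+\<^sup>2\<^sup>s dz \<le> 0\<close>. If a paraboloid touches
  \<open>w\<close> from below at \<open>x\<close>, the singular kernel may be replaced by the bounded kernel
  \<open>max \<theta> |z|\<close> to the power \<open>-(n + 2s)\<close> at the expense of the curvature of the paraboloid, so that
  \<open>w x\<close> controls a weighted integral of \<open>w\<close>. Choosing \<open>x\<close> as a minimum of \<open>w\<close> times a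
  power of the distance to the boundary of a ball bounds \<open>w\<close> from below by the weighted integral of its
  negative part; for nonnegative \<open>w\<close> the same inequality bounds \<open>w\<close> from below by a multiple of its
  own weighted integral. The constants do not depend on the mollification, so both bounds pass to \<open>u\<close>.
  The second one gives \<open>u > inf u\<close>. Applied to \<open>u - l\<close> on small balls around typical points of the set
  where \<open>u \<ge> l\<close>, the first one shows that the limit of the essential infima over shrinking balls,
  which is lower semicontinuous, equals \<open>u\<close> almost everywhere.
\<close>

subsection \<open>A smooth bump function\<close>

text \<open>Mollifying serves two ends. A function in \<open>frac_sobolev_loc\<close> has no
  pointwise values and need not attain minima, whereas its mollification is continuous and attains
  them on closed balls. Moreover, the translates of the mollifier are themselves test functions, the
  only ones used: testing with the one centred at x evaluates the pointwise inequality for w at x.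
  The scales are governed by the mass of the truncated kernel, a multiple of R^(-2s). Hence R^(2s)
  times a weighted integral is an average invariant under dilation, and a constant in front of it
  that is independent of R survives letting R tend to 0. Subtracting a constant does not affect the
  inequality, so the lower bound is available at every level, and the nonnegative case applies to u
  - inf u. Since the truncated kernel is positive on the whole space, any deviation of u from a
  constant, wherever it sits, raises u near each point of \<Omega> directly.\<close>

definition flat :: "nat \<Rightarrow> real \<Rightarrow> real" where
  "flat k t = (if 0 < t then exp (- (1 / t)) / t ^ k else 0)"

lemma flat_nonneg: "0 \<le> flat k t"
  by (simp add: flat_def)

text \<open>For t > 0, exp (1/t) is at least its single Taylor term (1/t)^(k+2) / (k+2)!. The square
  makes the difference quotient of \<open>flat k\<close> at 0 vanish; the explicit factor returns in
  a Lipschitz constant.\<close>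

lemma flat_le_square: "\<bar>flat k t\<bar> \<le> fact (k + 2) * t\<^sup>2"
proof (cases "0 < t")
  case True
  define m where "m = k + 2"
  have "(\<Sum>i\<in>{m}. (1 / t) ^ i /\<^sub>R fact i) \<le> exp (1 / t)"
    unfolding exp_def using True by (intro sum_le_suminf summable_exp_generic) auto
  then have "1 \<le> fact m * t ^ m * exp (1 / t)"
    using True by (simp add: field_simps)
  then have "exp (- (1 / t)) \<le> fact (k + 2) * t ^ (k + 2)"
    unfolding m_def by (simp add: exp_minus field_simps del: fact_Suc power_Suc)
  then have "exp (- (1 / t)) / t ^ k \<le> fact (k + 2) * t ^ (k + 2) / t ^ k"
    using True by (intro divide_right_mono) auto
  also have "\<dots> = fact (k + 2) * t\<^sup>2"
    using True by (simp add: power_add power2_eq_square)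
  finally show ?thesis
    using True by (simp add: flat_def)
qed (simp add: flat_def)

text \<open>\<open>flat 0\<close> is the standard smooth function exp (-1/t) continued by zero. The
  extra powers of t in \<open>flat k\<close> make the family closed under differentiation up to
  linear combinations, so that smoothness of all orders follows from this one formula.\<close>

lemma DERIV_flat: "(flat k has_real_derivative flat (k + 2) t - real k * flat (k + 1) t) (at t)"
proof -
  consider "0 < t" | "t < 0" | "t = 0" by linarith
  then show ?thesis
  proof cases
    case 1
    have "((\<lambda>t. exp (- (1 / t)) / t ^ k) has_real_derivative flat (k + 2) t - real k * flat (k + 1) t) (at t)"
      using 1 by (auto intro!: derivative_eq_intros simp: flat_def field_simps power_add power2_eq_square)
        (cases k; simp add: field_simps)
    moreover have "eventually (\<lambda>x. flat k x = exp (- (1 / x)) / x ^ k) (nhds t)"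
      using eventually_nhds_in_open[of "{0<..}" t] 1 by (auto simp: flat_def elim!: eventually_mono)
    ultimately show ?thesis by (subst DERIV_cong_ev[OF refl _ refl])
  next
    case 2
    have "eventually (\<lambda>x. flat k x = 0) (nhds t)"
      using eventually_nhds_in_open[of "{..<0}" t] 2 by (auto simp: flat_def elim!: eventually_mono)
    then show ?thesis using 2 by (subst DERIV_cong_ev[OF refl _ refl]) (auto simp: flat_def)
  next
    case 3
    have "((\<lambda>h. (flat k (0 + h) - flat k 0) / h) \<longlongrightarrow> 0) (at 0)"
    proof (rule Lim_null_comparison)
      show "eventually (\<lambda>h. norm ((flat k (0 + h) - flat k 0) / h) \<le> fact (k + 2) * \<bar>h\<bar>) (at 0)"
        unfolding eventually_at_filter
      proof (intro always_eventually allI impI)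
        fix h :: real assume "h \<noteq> 0"
        then show "norm ((flat k (0 + h) - flat k 0) / h) \<le> fact (k + 2) * \<bar>h\<bar>"
          using flat_le_square[of k h] by (simp add: flat_def[of k 0] abs_divide divide_le_eq power2_eq_square mult.assoc)
      qed
      show "((\<lambda>h::real. fact (k + 2) * \<bar>h\<bar>) \<longlongrightarrow> 0) (at 0)"
        by (auto intro!: tendsto_eq_intros)
    qed
    then show ?thesis using 3 by (simp add: DERIV_def flat_def)
  qed
qed

text \<open>A class of functions containing the bump and closed under directional derivatives.\<close>

inductive_set bump_algebra :: "real \<Rightarrow> 'a::euclidean_space \<Rightarrow> ('a \<Rightarrow> real) set" for c x0 where
  const: "(\<lambda>_. a) \<in> bump_algebra c x0"
| lin: "(\<lambda>x. (x - x0) \<bullet> v) \<in> bump_algebra c x0"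
| flat: "(\<lambda>x. flat k (1 - c * (norm (x - x0))\<^sup>2)) \<in> bump_algebra c x0"
| add: "f \<in> bump_algebra c x0 \<Longrightarrow> g \<in> bump_algebra c x0 \<Longrightarrow> (\<lambda>x. f x + g x) \<in> bump_algebra c x0"
| mult: "f \<in> bump_algebra c x0 \<Longrightarrow> g \<in> bump_algebra c x0 \<Longrightarrow> (\<lambda>x. f x * g x) \<in> bump_algebra c x0"

lemma bump_algebra_derivative:
  assumes "f \<in> bump_algebra c x0"
  shows "\<exists>D. (\<forall>x. (f has_derivative D x) (at x)) \<and> (\<forall>v. (\<lambda>x. D x v) \<in> bump_algebra c x0)"
  using assms
proof induction
  case (const a)
  show ?case by (rule exI[of _ "\<lambda>x v. 0"]) (auto intro: bump_algebra.const)
next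
  case (lin v)
  show ?case
    by (rule exI[of _ "\<lambda>x y. y \<bullet> v"]) (auto intro!: derivative_eq_intros bump_algebra.const)
next
  case (flat k)
  define D where "D x v = (flat (k + 2) (1 - c * (norm (x - x0))\<^sup>2) + (- real k) * flat (k + 1) (1 - c * (norm (x - x0))\<^sup>2))
      * ((- 2 * c) * ((x - x0) \<bullet> v))" for x v
  have "((\<lambda>x. flat k (1 - c * (norm (x - x0))\<^sup>2)) has_derivative D x) (at x)" for x
  proof -
    have 1: "((\<lambda>x. 1 - c * ((x - x0) \<bullet> (x - x0))) has_derivative (\<lambda>v. (- 2 * c) * ((x - x0) \<bullet> v))) (at x)"
      by (auto intro!: derivative_eq_intros simp: inner_commute algebra_simps)
    have 2: "(flat k has_derivative (*) (flat (k + 2) t - real k * flat (k + 1) t)) (at t)" for t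
      using DERIV_flat[of k t] by (simp add: has_field_derivative_def)
    show ?thesis
      using has_derivative_compose[OF 1 2] by (simp add: D_def[abs_def] power2_norm_eq_inner)
  qed
  moreover have "(\<lambda>x. D x v) \<in> bump_algebra c x0" for v
    unfolding D_def by (intro bump_algebra.intros)
  ultimately show ?case by blast
next
  case (add f g)
  then obtain D E where "\<And>x. (f has_derivative D x) (at x)" "\<And>v. (\<lambda>x. D x v) \<in> bump_algebra c x0"
    "\<And>x. (g has_derivative E x) (at x)" "\<And>v. (\<lambda>x. E x v) \<in> bump_algebra c x0" by blast
  then show ?case
    by (intro exI[of _ "\<lambda>x v. D x v + E x v"]) (auto intro!: has_derivative_add bump_algebra.add)
next
  case (mult f g)
  then obtain D E where *: "\<And>x. (f has_derivative D x) (at x)" "\<And>v. (\<lambda>x. D x v) \<in> bump_algebra c x0"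
    "\<And>x. (g has_derivative E x) (at x)" "\<And>v. (\<lambda>x. E x v) \<in> bump_algebra c x0" by blast
  then show ?case
    by (intro exI[of _ "\<lambda>x v. f x * E x v + D x v * g x"])
       (auto intro!: has_derivative_mult bump_algebra.add bump_algebra.mult mult.hyps)
qed

lemma bump_algebra_C_k: "f \<in> bump_algebra c x0 \<Longrightarrow> C_k k f"
proof (induction k arbitrary: f)
  case 0
  then show ?case
    using bump_algebra_derivative[OF 0] by (auto simp: continuous_on_eq_continuous_at intro: has_derivative_continuous)
next
  case (Suc k)
  obtain D where D: "\<And>x. (f has_derivative D x) (at x)" "\<And>v. (\<lambda>x. D x v) \<in> bump_algebra c x0"
    using bump_algebra_derivative[OF Suc.prems] by blast
  have "frechet_derivative f (at x) = D x" for x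
    using frechet_derivative_at[OF D(1)] by simp
  then show ?case using D Suc.IH by (auto simp: differentiable_def)
qed

subsection \<open>Truncated fractional kernels\<close>

lemma lborel_distr_isometry:
  fixes t :: "'a::euclidean_space"
  assumes "\<bar>c\<bar> = 1"
  shows "distr lborel borel (\<lambda>x. t + c *\<^sub>R x) = lborel"
proof -
  have "c \<noteq> 0" using assms by auto
  then show ?thesis
    using lborel_affine[of c t] assms by (simp add: density_1)
qed

lemma nn_integral_affine:
  fixes f :: "'a::euclidean_space \<Rightarrow> ennreal"
  assumes [measurable]: "f \<in> borel_measurable borel" and c: "c \<noteq> 0"
  shows "(\<integral>\<^sup>+x. f x \<partial>lborel) = ennreal (\<bar>c\<bar> ^ DIM('a)) * (\<integral>\<^sup>+x. f (t + c *\<^sub>R x) \<partial>lborel)"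
  by (subst lborel_affine[OF c, of t])
     (simp add: nn_integral_density nn_integral_distr nn_integral_cmult)

lemma nn_integral_shift:
  fixes f :: "'a::euclidean_space \<Rightarrow> ennreal"
  assumes "f \<in> borel_measurable borel"
  shows "(\<integral>\<^sup>+x. f (t + x) \<partial>lborel) = (\<integral>\<^sup>+x. f x \<partial>lborel)"
    and "(\<integral>\<^sup>+x. f (x + t) \<partial>lborel) = (\<integral>\<^sup>+x. f x \<partial>lborel)"
    and "(\<integral>\<^sup>+x. f (x - t) \<partial>lborel) = (\<integral>\<^sup>+x. f x \<partial>lborel)"
    and "(\<integral>\<^sup>+x. f (t - x) \<partial>lborel) = (\<integral>\<^sup>+x. f x \<partial>lborel)"
  using nn_integral_affine[OF assms, of 1 t] nn_integral_affine[OF assms, of 1 "-t"]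
    nn_integral_affine[OF assms, of "-1" t] by (simp_all add: add.commute)

lemma integral_shift:
  fixes f :: "'a::euclidean_space \<Rightarrow> real"
  assumes [measurable]: "f \<in> borel_measurable borel"
  shows "(\<integral>x. f (t + x) \<partial>lborel) = (\<integral>x. f x \<partial>lborel)"
    and "(\<integral>x. f (x + t) \<partial>lborel) = (\<integral>x. f x \<partial>lborel)"
    and "(\<integral>x. f (x - t) \<partial>lborel) = (\<integral>x. f x \<partial>lborel)"
    and "(\<integral>x. f (t - x) \<partial>lborel) = (\<integral>x. f x \<partial>lborel)"
proof -
  have *: "(\<integral>x. f (t + c *\<^sub>R x) \<partial>lborel) = (\<integral>x. f x \<partial>lborel)" if "\<bar>c\<bar> = 1" for c t
    by (subst (2) lborel_distr_isometry[OF that, of t, symmetric]) (simp add: integral_distr)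
  show "(\<integral>x. f (t + x) \<partial>lborel) = (\<integral>x. f x \<partial>lborel)"
    "(\<integral>x. f (x + t) \<partial>lborel) = (\<integral>x. f x \<partial>lborel)"
    "(\<integral>x. f (x - t) \<partial>lborel) = (\<integral>x. f x \<partial>lborel)"
    "(\<integral>x. f (t - x) \<partial>lborel) = (\<integral>x. f x \<partial>lborel)"
    using *[of 1 t] *[of 1 "-t"] *[of "-1" t] by (simp_all add: add.commute)
qed

lemma integrable_shift:
  fixes f :: "'a::euclidean_space \<Rightarrow> real"
  assumes "integrable lborel f"
  shows "integrable lborel (\<lambda>x. f (t + x))" "integrable lborel (\<lambda>x. f (x + t))"
    "integrable lborel (\<lambda>x. f (x - t))" "integrable lborel (\<lambda>x. f (t - x))"
proof -
  have *: "integrable lborel (\<lambda>x. f (t + c *\<^sub>R x))" if "\<bar>c\<bar> = 1" for c t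
    using assms by (subst (asm) lborel_distr_isometry[OF that, of t, symmetric])
      (simp add: integrable_distr_eq[of "\<lambda>x. t + c *\<^sub>R x" lborel borel f] borel_measurable_integrable[OF assms, simplified])
  show "integrable lborel (\<lambda>x. f (t + x))" "integrable lborel (\<lambda>x. f (x + t))"
    "integrable lborel (\<lambda>x. f (x - t))" "integrable lborel (\<lambda>x. f (t - x))"
    using *[of 1 t] *[of 1 "-t"] *[of "-1" t] by (simp_all add: add.commute)
qed

section \<open>Integrability by dyadic shells\<close>

lemma ex_dyadic:
  fixes x :: real assumes "1 \<le> x"
  obtains k :: nat where "2 ^ k \<le> x" "x < 2 ^ Suc k"
proof -
  define k where "k = nat \<lfloor>log 2 x\<rfloor>"
  have "0 \<le> log 2 x" using assms by simp
  then have "real k \<le> log 2 x" "log 2 x < real (Suc k)" unfolding k_def by linarith+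
  then have "2 powr real k \<le> x" "x < 2 powr real (Suc k)"
    using assms by (simp_all add: le_log_iff log_less_iff del: of_nat_Suc)
  then show ?thesis using that by (simp add: powr_realpow del: of_nat_Suc power_Suc)
qed

text \<open>A series of \<open>C * q ^ k\<close> times indicators of balls of radius 2 r^k dominates
  \<open>f\<close>. These balls have volume proportional to r^(kn), so the integrated series is
  geometric with ratio r^n q. With r = 2 this handles decay at infinity, with r = 1/2 a singularity
  at the origin.\<close>

lemma nn_integral_dyadic_finite:
  fixes f :: "'a::euclidean_space \<Rightarrow> real"
  assumes "0 < r" "0 \<le> q" "0 \<le> C" and rq: "r ^ DIM('a) * q < 1"
    and f: "\<And>z. f z \<le> 0 \<or> (\<exists>k. norm z < 2 * r ^ k \<and> f z \<le> C * q ^ k)"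
  shows "(\<integral>\<^sup>+z. f z \<partial>lborel) < \<infinity>"
proof -
  define V where "V = unit_ball_vol (real DIM('a)) * 2 ^ DIM('a)"
  have [measurable]: "ball (0::'a) e \<in> sets borel" for e by simp
  let ?g = "\<lambda>k z. ennreal (C * q ^ k) * indicator (ball 0 (2 * r ^ k)) (z::'a)"
  have "ennreal (f z) \<le> (\<Sum>k. ?g k z)" for z
  proof -
    consider "f z \<le> 0" | k where "norm z < 2 * r ^ k" "f z \<le> C * q ^ k" using f by blast
    then show ?thesis
    proof cases
      case 2
      then have "ennreal (f z) \<le> ?g k z" by (auto simp: ennreal_leI)
      also have "\<dots> \<le> (\<Sum>k. ?g k z)"
        using sum_le_suminf[of "\<lambda>k. ?g k z" "{k}"]
        by (simp only: sum.insert sum.empty finite.emptyI empty_iff not_False_eq_True add_0_right) simp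
      finally show ?thesis .
    qed (simp add: ennreal_neg)
  qed
  then have "(\<integral>\<^sup>+z. f z \<partial>lborel) \<le> (\<integral>\<^sup>+z. (\<Sum>k. ?g k z) \<partial>lborel)"
    by (intro nn_integral_mono) auto
  also have "\<dots> = (\<Sum>k. \<integral>\<^sup>+z. ?g k z \<partial>lborel)"
    by (rule nn_integral_suminf) measurable
  also have "\<dots> = (\<Sum>k. ennreal (C * V * (r ^ DIM('a) * q) ^ k))"
  proof (intro suminf_cong)
    fix k
    have "(\<integral>\<^sup>+z. ?g k z \<partial>lborel) = ennreal (C * q ^ k) * emeasure lborel (ball (0::'a) (2 * r ^ k))"
      by (rule nn_integral_cmult_indicator) simp
    also have "\<dots> = ennreal (C * V * (r ^ DIM('a) * q) ^ k)"
      using assms by (simp add: emeasure_ball V_def ennreal_mult'[symmetric] power_mult_distrib power_mult[symmetric] mult_ac)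
    finally show "(\<integral>\<^sup>+z. ?g k z \<partial>lborel) = ennreal (C * V * (r ^ DIM('a) * q) ^ k)" .
  qed
  also have "\<dots> < \<infinity>"
    using assms by (subst suminf_ennreal2)
      (auto simp: V_def intro!: summable_mult summable_geometric)
  finally show ?thesis .
qed

text \<open>The singular kernel |z|^-(n+2s), frozen inside the ball of radius \<open>R\<close> at
  its value on the sphere. \<open>kern s 1\<close> is comparable to the weight 1 / (1 + |x|^(n+2s))
  of the integrability hypothesis and serves as the reference weight throughout.\<close>

definition kern :: "real \<Rightarrow> real \<Rightarrow> 'a::euclidean_space \<Rightarrow> real" where
  "kern s R z = max R (norm z) powr - (real DIM('a) + 2 * s)"

lemma kern_nonneg [simp]: "0 \<le> kern s R z"
  by (simp add: kern_def)

lemma kern_pos: "0 < R \<Longrightarrow> 0 < kern s R z"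
  by (auto simp: kern_def max_def)

lemma kern_minus [simp]: "kern s R (- z) = kern s R z"
  by (simp add: kern_def)

lemma measurable_kern [measurable]: "kern s R \<in> borel_measurable borel"
  unfolding kern_def[abs_def] by measurable

text \<open>The kernel is a negative power of the truncated distance \<open>max R (norm z)\<close>,
  so every change of centre or radius reduces to a linear comparison of two such distances. The
  points \<open>z\<close> and \<open>z'\<close> are unrelated in order to cover shifts.\<close>

lemma kern_compare:
  fixes z z' :: "'a::euclidean_space"
  assumes "0 < s" "0 < R" "0 < R'" "0 < c" "max R' (norm z') \<le> c * max R (norm z)"
  shows "kern s R z \<le> c powr (real DIM('a) + 2 * s) * kern s R' z'"
proof -
  let ?p = "real DIM('a) + 2 * s"
  have "(c * max R (norm z)) powr - ?p \<le> max R' (norm z') powr - ?p"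
    using assms by (intro powr_mono2') auto
  then have "c powr ?p * (c * max R (norm z)) powr - ?p \<le> c powr ?p * max R' (norm z') powr - ?p"
    by (rule mult_left_mono) simp
  moreover have "c powr ?p * (c * max R (norm z)) powr - ?p = max R (norm z) powr - ?p"
    using assms unfolding powr_mult by (simp add: powr_add[symmetric] mult.assoc[symmetric])
  ultimately show ?thesis
    unfolding kern_def by simp
qed

lemma kern_scale:
  fixes z :: "'a::euclidean_space"
  assumes "0 < R"
  shows "kern s R (R *\<^sub>R z) = R powr - (real DIM('a) + 2 * s) * kern s 1 z"
proof -
  have "max R (norm (R *\<^sub>R z)) = R * max 1 (norm z)"
    using assms by (simp add: max_mult_distrib_left)
  then show ?thesis
    using assms by (simp add: kern_def powr_mult)
qed

lemma nn_integral_kern_1_finite: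
  assumes "0 < s"
  shows "(\<integral>\<^sup>+z. kern s 1 (z::'a::euclidean_space) \<partial>lborel) < \<infinity>"
proof (rule nn_integral_dyadic_finite[where r = 2 and q = "2 powr - (real DIM('a) + 2 * s)" and C = 1])
  \<comment> \<open>Volume growth 2^n against decay 2^-(n+2s): the ratio is 2^(-2s), below 1 because
    s is positive.\<close>
  have "(2::real) ^ DIM('a) * 2 powr - (real DIM('a) + 2 * s) = 2 powr (- 2 * s)"
    by (simp add: powr_realpow[symmetric] powr_add[symmetric] del: powr_realpow)
  also have "\<dots> < 1" using assms by (simp add: powr_less_one)
  finally show "(2::real) ^ DIM('a) * 2 powr - (real DIM('a) + 2 * s) < 1" .
next
  fix z :: 'a
  let ?p = "real DIM('a) + 2 * s"
  show "kern s 1 z \<le> 0 \<or> (\<exists>k. norm z < 2 * 2 ^ k \<and> kern s 1 z \<le> 1 * (2 powr - ?p) ^ k)"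
  proof (cases "norm z < 1")
    case True
    then show ?thesis by (intro disjI2 exI[of _ 0]) (auto simp: kern_def)
  next
    case False
    then obtain k :: nat where k: "2 ^ k \<le> norm z" "norm z < 2 ^ Suc k" using ex_dyadic[of "norm z"] by auto
    have "kern s 1 z = norm z powr - ?p" using False by (simp add: kern_def max_def)
    also have "\<dots> \<le> (2 ^ k) powr - ?p" using k assms by (intro powr_mono2') auto
    also have "\<dots> = (2 powr - ?p) ^ k" by (simp add: powr_realpow[symmetric] powr_powr mult.commute)
    finally show ?thesis using k by (intro disjI2 exI[of _ k]) auto
  qed
qed auto

text \<open>This scaling law is the reason for the normalisation \<open>R powr (2 * s)\<close> in
  front of all weighted integrals: with it the kernel has the same mass at every radius.\<close>

lemma nn_integral_kern:
  assumes "0 < R" "0 < s"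
  shows "(\<integral>\<^sup>+z. kern s R (z::'a::euclidean_space) \<partial>lborel) = ennreal (R powr (- 2 * s)) * (\<integral>\<^sup>+z. kern s 1 (z::'a) \<partial>lborel)"
proof -
  have "(\<integral>\<^sup>+z. kern s R (z::'a) \<partial>lborel) = ennreal (\<bar>R\<bar> ^ DIM('a)) * (\<integral>\<^sup>+z. kern s R (0 + R *\<^sub>R z::'a) \<partial>lborel)"
    using assms by (intro nn_integral_affine) auto
  also have "\<dots> = ennreal (R powr real DIM('a)) * (ennreal (R powr - (real DIM('a) + 2 * s)) * (\<integral>\<^sup>+z. kern s 1 (z::'a) \<partial>lborel))"
    using assms by (simp add: kern_scale ennreal_mult nn_integral_cmult powr_realpow)
  also have "\<dots> = ennreal (R powr (- 2 * s)) * (\<integral>\<^sup>+z. kern s 1 (z::'a) \<partial>lborel)"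
    by (simp add: mult.assoc[symmetric] ennreal_mult'[symmetric] powr_add[symmetric])
  finally show ?thesis .
qed

lemma integrable_kern:
  assumes "0 < R" "0 < s"
  shows "integrable lborel (kern s R :: 'a::euclidean_space \<Rightarrow> real)"
  using nn_integral_kern_1_finite[OF assms(2), where 'a = 'a]
  by (intro integrableI_nonneg) (auto simp: nn_integral_kern[OF assms] ennreal_mult_less_top)

lemma integral_kern:
  assumes "0 < R" "0 < s"
  shows "(\<integral>z. kern s R (z::'a::euclidean_space) \<partial>lborel) = R powr (- 2 * s) * (\<integral>z. kern s 1 (z::'a) \<partial>lborel)"
  by (simp add: integral_eq_nn_integral nn_integral_kern[OF assms] enn2real_mult)

lemma integral_kern_1_pos:
  assumes "0 < s"
  shows "0 < (\<integral>z. kern s 1 (z::'a::euclidean_space) \<partial>lborel)"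
proof -
  have "integrable lborel (indicator (ball (0::'a) 1) :: 'a \<Rightarrow> real)"
    by (intro integrable_real_indicator) (auto simp: emeasure_ball)
  moreover have "measure lborel (ball (0::'a) 1) = (\<integral>z. indicator (ball (0::'a) 1) z \<partial>lborel)" by simp
  moreover have "(\<integral>z. indicator (ball (0::'a) 1) z \<partial>lborel) \<le> (\<integral>z. kern s 1 (z::'a) \<partial>lborel)"
    using calculation(1) integrable_kern[OF zero_less_one assms] by (rule integral_mono) (auto simp: indicator_def kern_def)
  ultimately show ?thesis
    using content_ball[of 1 "0::'a"] unit_ball_vol_pos[of "DIM('a)"] by (simp add: less_le_trans[of 0 "unit_ball_vol (real DIM('a))"])
qed

text \<open>At \<open>z = 0\<close> the quotient is \<open>0 / 0 = 0\<close>, also when \<open>n + 2s \<le> 2\<close>.\<close>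

definition near_kern :: "real \<Rightarrow> real \<Rightarrow> 'a::euclidean_space \<Rightarrow> real" where
  "near_kern s a z = (if norm z < a then (norm z)\<^sup>2 / norm z powr (real DIM('a) + 2 * s) else 0)"

lemma near_kern_nonneg [simp]: "0 \<le> near_kern s a z"
  by (simp add: near_kern_def)

lemma measurable_near_kern [measurable]: "near_kern s a \<in> borel_measurable borel"
  unfolding near_kern_def[abs_def] by measurable

text \<open>Near the origin the exponents add up to n + 2 - (n + 2s) = 2 - 2s, which is positive
  because s < 1. This finite second moment is what the curvature of a touching paraboloid
  costs.\<close>

lemma nn_integral_near_kern_1_finite:
  assumes "0 < s" "s < 1"
  shows "(\<integral>\<^sup>+z. near_kern s 1 (z::'a::euclidean_space) \<partial>lborel) < \<infinity>"
proof (rule nn_integral_dyadic_finite[where r = "1/2" and q = "2 powr (real DIM('a) + 2 * s - 2)"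
      and C = "2 powr (real DIM('a) + 2 * s)"])
  have "(1/2::real) ^ DIM('a) * 2 powr (real DIM('a) + 2 * s - 2) = 2 powr (- real DIM('a)) * 2 powr (real DIM('a) + 2 * s - 2)"
    by (simp add: powr_minus powr_realpow power_one_over field_simps)
  also have "\<dots> = 2 powr (2 * s - 2)"
    by (simp add: powr_add[symmetric])
  also have "\<dots> < 1" using assms by (simp add: powr_less_one)
  finally show "(1/2::real) ^ DIM('a) * 2 powr (real DIM('a) + 2 * s - 2) < 1" .
next
  fix z :: 'a
  let ?p = "real DIM('a) + 2 * s"
  show "near_kern s 1 z \<le> 0 \<or> (\<exists>k. norm z < 2 * (1/2) ^ k \<and> near_kern s 1 z \<le> 2 powr ?p * (2 powr (?p - 2)) ^ k)"
  proof (cases "norm z < 1 \<and> z \<noteq> 0")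
    case False
    then show ?thesis by (auto simp: near_kern_def)
  next
    case True
    then obtain k :: nat where k: "2 ^ k \<le> 1 / norm z" "1 / norm z < 2 ^ Suc k"
      using ex_dyadic[of "1 / norm z"] by auto
    then have k': "norm z \<le> (1/2) ^ k" "(1/2) ^ Suc k \<le> norm z" 
      using True by (auto simp: field_simps power_one_over)
    have "near_kern s 1 z = (norm z)\<^sup>2 * norm z powr - ?p" 
      using True unfolding near_kern_def powr_minus divide_inverse by simp
    \<comment> \<open>On the shell between (1/2)^(k+1) and (1/2)^k the square is bounded at the
      outer radius and the negative power at the inner one; this mismatch of one step is the factor
      2^(n+2s) taken for \<open>C\<close>.\<close>
    also have "\<dots> \<le> ((1/2) ^ k)\<^sup>2 * ((1/2) ^ Suc k) powr - ?p"
    proof (rule mult_mono)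
      show "norm z powr - ?p \<le> ((1/2) ^ Suc k) powr - ?p"
        using k'(2) assms by (intro powr_mono2') (auto simp del: power_Suc)
    qed (use k'(1) in \<open>auto intro: power_mono\<close>)
    also have "\<dots> = (2 powr (- real k)) powr 2 * (2 powr (- real (Suc k))) powr - ?p"
      by (simp add: powr_minus powr_realpow power_one_over field_simps del: of_nat_Suc)
    also have "\<dots> = 2 powr (?p + (?p - 2) * real k)"
      unfolding powr_powr powr_add[symmetric] by (simp add: algebra_simps)
    also have "\<dots> = 2 powr ?p * (2 powr (?p - 2)) ^ k"
      by (simp add: powr_add powr_powr[symmetric] powr_realpow)
    finally have *: "near_kern s 1 z \<le> 2 powr ?p * (2 powr (?p - 2)) ^ k" .
    have "norm z < 2 * (1/2) ^ k" using k'(1) by (rule le_less_trans) simp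
    then show ?thesis using * by blast
  qed
qed auto

lemma nn_integral_near_kern:
  assumes "0 < a" "0 < s" "s < 1"
  shows "(\<integral>\<^sup>+z. near_kern s a (z::'a::euclidean_space) \<partial>lborel) = ennreal (a powr (2 - 2 * s)) * (\<integral>\<^sup>+z. near_kern s 1 (z::'a) \<partial>lborel)"
proof -
  have sc: "near_kern s a (a *\<^sub>R z) = a powr (2 - (real DIM('a) + 2 * s)) * near_kern s 1 z" for z :: 'a
  proof (cases "norm z < 1")
    case True
    have "norm (a *\<^sub>R z) < a \<longleftrightarrow> a * norm z < a * 1" using assms by simp
    then have "norm (a *\<^sub>R z) < a" using True assms by (simp only: mult_less_cancel_left_pos)
    then have "near_kern s a (a *\<^sub>R z) = (a * norm z)\<^sup>2 / (a * norm z) powr (real DIM('a) + 2 * s)"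
      using assms by (simp add: near_kern_def)
    also have "\<dots> = (a\<^sup>2 / a powr (real DIM('a) + 2 * s)) * ((norm z)\<^sup>2 / norm z powr (real DIM('a) + 2 * s))"
      by (simp only: powr_mult power_mult_distrib times_divide_times_eq)
    also have "a\<^sup>2 / a powr (real DIM('a) + 2 * s) = a powr (2 - (real DIM('a) + 2 * s))"
      using assms by (simp add: powr_diff)
    finally show ?thesis using True by (simp add: near_kern_def)
  next
    case False
    have "norm (a *\<^sub>R z) < a \<longleftrightarrow> a * norm z < a * 1" using assms by simp
    then have "\<not> norm (a *\<^sub>R z) < a" using False assms by (simp only: mult_less_cancel_left_pos) simp
    with False show ?thesis by (simp add: near_kern_def)
  qed
  have "(\<integral>\<^sup>+z. near_kern s a (z::'a) \<partial>lborel) = ennreal (\<bar>a\<bar> ^ DIM('a)) * (\<integral>\<^sup>+z. near_kern s a (0 + a *\<^sub>R z::'a) \<partial>lborel)"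
    using assms by (intro nn_integral_affine) auto
  also have "\<dots> = ennreal (a powr real DIM('a)) * (ennreal (a powr (2 - (real DIM('a) + 2 * s))) * (\<integral>\<^sup>+z. near_kern s 1 (z::'a) \<partial>lborel))"
    using assms by (simp add: sc ennreal_mult nn_integral_cmult powr_realpow)
  also have "\<dots> = ennreal (a powr (2 - 2 * s)) * (\<integral>\<^sup>+z. near_kern s 1 (z::'a) \<partial>lborel)"
    by (simp add: mult.assoc[symmetric] ennreal_mult'[symmetric] powr_add[symmetric])
  finally show ?thesis .
qed

lemma integrable_near_kern:
  assumes "0 < a" "0 < s" "s < 1"
  shows "integrable lborel (near_kern s a :: 'a::euclidean_space \<Rightarrow> real)"
  using nn_integral_near_kern_1_finite[OF assms(2,3), where 'a = 'a]
  by (intro integrableI_nonneg) (auto simp: nn_integral_near_kern[OF assms] ennreal_mult_less_top)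

lemma integral_near_kern:
  assumes "0 < a" "0 < s" "s < 1"
  shows "(\<integral>z. near_kern s a (z::'a::euclidean_space) \<partial>lborel) = a powr (2 - 2 * s) * (\<integral>z. near_kern s 1 (z::'a) \<partial>lborel)"
  by (simp add: integral_eq_nn_integral nn_integral_near_kern[OF assms] enn2real_mult)

subsection \<open>Pointwise estimates at touching points\<close>

text \<open>Integrability against \<open>kern s 1\<close> about the origin thereby gives
  integrability about every centre and at every radius. The constant blows up as \<open>R\<close>
  tends to 0 and is used only for finiteness and domination, never in a quantitative
  estimate.\<close>

lemma kern_shift_compare:
  fixes x y :: "'a::euclidean_space"
  assumes "0 < s" "0 < R"
  shows "kern s R (y - x) \<le> ((1 + norm x) / R + 1) powr (real DIM('a) + 2 * s) * kern s 1 y"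
proof (rule kern_compare)
  let ?m = "max R (norm (y - x))"
  have "norm y \<le> norm x + norm (y - x)"
    using norm_triangle_sub[of y x] by simp
  also have "\<dots> \<le> norm x / R * R + ?m" using assms by simp
  also have "\<dots> \<le> norm x / R * ?m + ?m"
    using assms by (intro add_right_mono mult_left_mono) auto
  finally have 1: "norm y \<le> norm x / R * ?m + ?m" .
  have "1 = 1 / R * R" using assms by simp
  also have "\<dots> \<le> 1 / R * ?m" using assms by (intro mult_left_mono) auto
  finally have 2: "1 \<le> 1 / R * ?m" .
  have 3: "0 \<le> norm x / R * ?m" "0 \<le> ?m" using assms by (auto simp: le_max_iff_disj)
  have "((1 + norm x) / R + 1) * ?m = 1 / R * ?m + norm x / R * ?m + ?m"
    by (simp add: algebra_simps add_divide_distrib)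
  then show "max 1 (norm y) \<le> ((1 + norm x) / R + 1) * ?m" using 1 2 3 by linarith
qed (use assms in \<open>auto intro!: add_nonneg_pos divide_nonneg_pos\<close>)

lemma integrable_weighted:
  fixes w :: "'a::euclidean_space \<Rightarrow> real"
  assumes "0 < s" "0 < R" and [measurable]: "w \<in> borel_measurable borel"
    and "integrable lborel (\<lambda>y. w y * kern s 1 y)"
  shows "integrable lborel (\<lambda>y. w y * kern s R (y - x))"
proof (rule Bochner_Integration.integrable_bound)
  let ?c = "((1 + norm x) / R + 1) powr (real DIM('a) + 2 * s)"
  show "integrable lborel (\<lambda>y. ?c * (w y * kern s 1 y))" using assms by simp
  have "norm (w y * kern s R (y - x)) \<le> norm (?c * (w y * kern s 1 y))" for y
    using mult_left_mono[OF kern_shift_compare[OF assms(1,2), of y x], of "\<bar>w y\<bar>"]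
    by (simp add: abs_mult mult_ac)
  then show "AE y in lborel. norm (w y * kern s R (y - x)) \<le> norm (?c * (w y * kern s 1 y))" by simp
qed measurable

lemma integrable_weighted_shift:
  fixes w :: "'a::euclidean_space \<Rightarrow> real"
  assumes "0 < s" "0 < R" "w \<in> borel_measurable borel"
    and "integrable lborel (\<lambda>y. w y * kern s 1 y)"
  shows "integrable lborel (\<lambda>z. w (x + z) * kern s R z)"
  using integrable_shift(1)[OF integrable_weighted[OF assms, of x], of x] by simp

definition second_diff :: "('a::euclidean_space \<Rightarrow> real) \<Rightarrow> 'a \<Rightarrow> 'a \<Rightarrow> real" where
  "second_diff w x z = w (x + z) + w (x - z) - 2 * w x"

text \<open>Up to a negative constant factor, the integral is the fractional Laplacian of
  \<open>w\<close> at \<open>x\<close>; symmetrising in z turns the principal value into an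
  absolutely convergent integral. Integrability is demanded explicitly, because the Bochner integral
  of a nonintegrable function is 0 and would satisfy the inequality vacuously.\<close>

definition superharmonic_at :: "real \<Rightarrow> ('a::euclidean_space \<Rightarrow> real) \<Rightarrow> 'a \<Rightarrow> bool" where
  "superharmonic_at s w x \<longleftrightarrow>
     integrable lborel (\<lambda>z. second_diff w x z / norm z powr (real DIM('a) + 2 * s)) \<and>
     (\<integral>z. second_diff w x z / norm z powr (real DIM('a) + 2 * s) \<partial>lborel) \<le> 0"

text \<open>
  On the ball of radius \<open>a\<close>, the second difference plus \<open>2 A |z|\<^sup>2\<close> is nonnegative and the truncated kernel
  lies below the singular one; outside the ball the two kernels agree.
\<close>

lemma superharmonic_at_touching:
  fixes w :: "'a::euclidean_space \<Rightarrow> real"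
  assumes s: "0 < s" "s < 1" and a: "0 < \<theta>" "\<theta> \<le> a" and A: "0 \<le> A"
    and w: "w \<in> borel_measurable borel" "integrable lborel (\<lambda>y. w y * kern s 1 y)"
    and super: "superharmonic_at s w x"
    and touch: "\<And>z. norm z < a \<Longrightarrow> - 2 * A * (norm z)\<^sup>2 \<le> second_diff w x z"
  shows "(\<integral>z. w (x + z) * kern s \<theta> z \<partial>lborel)
    \<le> w x * (\<theta> powr (- 2 * s) * (\<integral>z. kern s 1 (z::'a) \<partial>lborel))
      + A * (a powr (2 - 2 * s) * (\<integral>z. near_kern s 1 (z::'a) \<partial>lborel))"
proof -
  let ?p = "real DIM('a) + 2 * s"
  let ?S = "second_diff w x"
  have i1: "integrable lborel (\<lambda>z. w (x + z) * kern s \<theta> z)"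
    using integrable_weighted_shift[OF s(1) a(1) w] .
  have i2: "integrable lborel (\<lambda>z. w (x - z) * kern s \<theta> z)"
    using integrable_shift(4)[OF i1, of 0] by simp
  have eq: "(\<integral>z. w (x - z) * kern s \<theta> z \<partial>lborel) = (\<integral>z. w (x + z) * kern s \<theta> z \<partial>lborel)"
    using integral_shift(4)[of "\<lambda>z. w (x + z) * kern s \<theta> z" 0] w(1) by simp
  note k = integrable_kern[OF a(1) s(1), where 'a = 'a]
  note nk = integrable_near_kern[OF _ s, of a, where 'a = 'a]
  have iS: "integrable lborel (\<lambda>z. ?S z * kern s \<theta> z)"
    unfolding second_diff_def left_diff_distrib distrib_right using i1 i2 k by auto
  have pw: "?S z * kern s \<theta> z \<le> ?S z / norm z powr ?p + 2 * A * near_kern s a z" for z :: 'a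
  proof -
    consider "z = 0" | "z \<noteq> 0" "norm z < a" | "a \<le> norm z" by fastforce
    then show ?thesis
    proof cases
      case 1
      then show ?thesis using A by (simp add: second_diff_def)
    next
      case 2
      have "kern s \<theta> z \<le> norm z powr - ?p"
        unfolding kern_def using 2 s by (intro powr_mono2') auto
      then have "(?S z + 2 * A * (norm z)\<^sup>2) * kern s \<theta> z \<le> (?S z + 2 * A * (norm z)\<^sup>2) * norm z powr - ?p"
        using touch[OF 2(2)] by (intro mult_left_mono) auto
      moreover have "0 \<le> 2 * A * (norm z)\<^sup>2 * kern s \<theta> z" using A by simp
      ultimately show ?thesis
        using 2 unfolding near_kern_def powr_minus divide_inverse by (simp add: algebra_simps)
    next
      case 3
      then have "max \<theta> (norm z) = norm z" using a by auto
      then show ?thesis using 3 unfolding kern_def near_kern_def powr_minus divide_inverse by simp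
    qed
  qed
  have iT: "integrable lborel (\<lambda>z. ?S z / norm z powr ?p)" and T: "(\<integral>z. ?S z / norm z powr ?p \<partial>lborel) \<le> 0"
    using super by (auto simp: superharmonic_at_def)
  have "(\<integral>z. ?S z * kern s \<theta> z \<partial>lborel) \<le> (\<integral>z. ?S z / norm z powr ?p + 2 * A * near_kern s a z \<partial>lborel)"
    using iS iT nk a pw by (intro integral_mono) auto
  also have "\<dots> \<le> 2 * A * (\<integral>z. near_kern s a (z::'a) \<partial>lborel)"
    using iT nk a T by (subst Bochner_Integration.integral_add) auto
  also have "(\<integral>z. ?S z * kern s \<theta> z \<partial>lborel) = 2 * (\<integral>z. w (x + z) * kern s \<theta> z \<partial>lborel) - 2 * w x * (\<integral>z. kern s \<theta> (z::'a) \<partial>lborel)"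
    unfolding second_diff_def left_diff_distrib distrib_right using i1 i2 k eq by simp
  finally show ?thesis
    using integral_kern[OF a(1) s(1), where 'a = 'a] integral_near_kern[OF _ s, of a, where 'a = 'a] a by simp
qed

text \<open>The point \<open>x\<close> minimises \<open>w y + A |y - x1|\<^sup>2\<close>.\<close>

lemma superharmonic_at_near_min:
  fixes w :: "'a::euclidean_space \<Rightarrow> real"
  assumes s: "0 < s" "s < 1" and d: "0 < d"
    and w: "w \<in> borel_measurable borel" "integrable lborel (\<lambda>y. w y * kern s 1 y)"
    and cont: "continuous_on (cball x1 (d / 2)) w"
    and super: "\<And>x. x \<in> ball x1 (d / 4) \<Longrightarrow> superharmonic_at s w x"
    and B: "\<And>y. y \<in> cball x1 (d / 2) \<Longrightarrow> - B \<le> w y"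
    and A: "B + w x1 < A * d\<^sup>2 / 16"
  shows "\<exists>x\<in>ball x1 (d / 4). w x \<le> w x1 \<and> (\<forall>\<theta>. 0 < \<theta> \<and> \<theta> \<le> d / 4 \<longrightarrow>
    (\<integral>z. w (x + z) * kern s \<theta> z \<partial>lborel)
    \<le> w x * (\<theta> powr (- 2 * s) * (\<integral>z. kern s 1 (z::'a) \<partial>lborel))
      + A * ((d / 4) powr (2 - 2 * s) * (\<integral>z. near_kern s 1 (z::'a) \<partial>lborel)))"
proof -
  have "- B \<le> w x1" using B[of x1] d by simp
  then have Apos: "0 < A" using A d by (smt (verit) divide_nonpos_pos mult_nonpos_nonneg zero_le_power2)
  have ne: "cball x1 (d / 2) \<noteq> {}" using d by auto
  have "continuous_on (cball x1 (d / 2)) (\<lambda>y. w y + A * (norm (y - x1))\<^sup>2)"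
    using cont by (intro continuous_intros)
  from continuous_attains_inf[OF compact_cball ne this] obtain x where x: "x \<in> cball x1 (d / 2)"
    and min: "\<And>y. y \<in> cball x1 (d / 2) \<Longrightarrow> w x + A * (norm (x - x1))\<^sup>2 \<le> w y + A * (norm (y - x1))\<^sup>2"
    using continuous_attains_inf by blast
  have min1: "w x + A * (norm (x - x1))\<^sup>2 \<le> w x1" using min[of x1] d by simp
  \<comment> \<open>\<open>A\<close> is so large that at distance d/4 or more from \<open>x1\<close>
    the paraboloid exceeds \<open>B + w x1\<close>, so the minimiser is closer than that. Hence the
    ball of radius d/4 about \<open>x\<close> stays inside the ball over which the minimum is
    taken.\<close>
  have near: "norm (x - x1) < d / 4"
  proof (rule ccontr)
    assume "\<not> ?thesis"
    then have "(d / 4)\<^sup>2 \<le> (norm (x - x1))\<^sup>2" using d by (intro power_mono) auto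
    then have "A * (d / 4)\<^sup>2 \<le> A * (norm (x - x1))\<^sup>2" using Apos by (intro mult_left_mono) auto
    then show False using min1 B[OF x] A by (simp add: power_divide)
  qed
  have x_ball: "x \<in> ball x1 (d / 4)" using near by (simp add: dist_norm norm_minus_commute)
  have "- 2 * A * (norm z)\<^sup>2 \<le> second_diff w x z" if "norm z < d / 4" for z
  proof -
    have "x + z \<in> cball x1 (d / 2)" "x - z \<in> cball x1 (d / 2)"
      using near that dist_triangle[of x1 "x + z" x] dist_triangle[of x1 "x - z" x] x_ball
      by (auto simp: dist_norm)
    then have "w x + A * (norm (x - x1))\<^sup>2 \<le> w (x + z) + A * (norm (x + z - x1))\<^sup>2"
      "w x + A * (norm (x - x1))\<^sup>2 \<le> w (x - z) + A * (norm (x - z - x1))\<^sup>2" by (auto intro: min)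
    \<comment> \<open>The parallelogram law: in the sum of the two minimality inequalities the terms
      with \<open>x - x1\<close> cancel, and only the curvature term in z remains.\<close>
    moreover have "(norm (x + z - x1))\<^sup>2 + (norm (x - z - x1))\<^sup>2 = 2 * (norm (x - x1))\<^sup>2 + 2 * (norm z)\<^sup>2"
      by (simp add: power2_norm_eq_inner algebra_simps inner_commute)
    then have "A * (norm (x + z - x1))\<^sup>2 + A * (norm (x - z - x1))\<^sup>2 = 2 * A * (norm (x - x1))\<^sup>2 + 2 * A * (norm z)\<^sup>2"
      by (metis (no_types, opaque_lifting) distrib_left mult.assoc mult.left_commute)
    ultimately show ?thesis by (simp add: second_diff_def)
  qed
  moreover have "w x \<le> w x1" using min1 Apos by (smt (verit) mult_nonneg_nonneg zero_le_power2)
  ultimately show ?thesis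
    using superharmonic_at_touching[OF s _ _ less_imp_le[OF Apos] w super[OF x_ball]] x_ball by blast
qed

text \<open>
  With \<open>x1\<close> a minimum of \<open>w x (R - |x - x0|)\<^sup>n\<close>, \<open>h = - w x1\<close> and \<open>d\<close> its distance to the sphere, \<open>w \<ge> - 2\<^sup>n h\<close> on
  the ball of radius \<open>d / 2\<close>. Truncating the kernel at \<open>\<theta> = t d\<close> with \<open>t\<close> small makes its mass dominate the
  curvature term, and the powers of \<open>d\<close> cancel exactly for the exponent \<open>n\<close>.
\<close>

lemma superharmonic_lower_bound:
  assumes s: "0 < s" "s < 1"
  shows "\<exists>C>0. \<forall>(w :: 'a::euclidean_space \<Rightarrow> real) x0 R x.
    0 < R \<longrightarrow> continuous_on UNIV w \<longrightarrow> integrable lborel (\<lambda>y. w y * kern s 1 y) \<longrightarrow>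
    (\<forall>x\<in>ball x0 R. superharmonic_at s w x) \<longrightarrow> x \<in> ball x0 (R / 2) \<longrightarrow>
    - w x \<le> C * R powr (2 * s) * (\<integral>y. max 0 (- w y) * kern s R (y - x0) \<partial>lborel)"
proof -
  let ?n = "DIM('a)"
  define p where "p = real ?n + 2 * s"
  define K where "K = (\<integral>z. kern s 1 (z::'a) \<partial>lborel)"
  define I where "I = (\<integral>z. near_kern s 1 (z::'a) \<partial>lborel)"
  \<comment> \<open>The coefficient of the curvature term: 16 * 2^n comes from the opening
    \<open>A\<close> of the paraboloid chosen below, (1/4)^(2-2s) from the ball of radius d/4 on
    which it touches.\<close>
  define D where "D = 16 * 2 ^ ?n * ((1/4) powr (2 - 2 * s) * I)"
  have K: "0 < K" unfolding K_def using integral_kern_1_pos[OF s(1)] .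
  have "0 \<le> I" unfolding I_def by simp
  then have D: "0 \<le> D" unfolding D_def by simp
  \<comment> \<open>The first entry keeps the radius t d within d/4. The second makes the mass term
    \<open>K * t powr (- 2 * s)\<close> exceed \<open>D\<close> by at least 1, and this surplus is
    what remains after absorbing the curvature.\<close>
  define t where "t = min (1/4) ((K / (1 + D)) powr (1 / (2 * s)))"
  have t: "0 < t" "t \<le> 1/4" using K D by (auto simp: t_def)
  have "t powr (2 * s) \<le> ((K / (1 + D)) powr (1 / (2 * s))) powr (2 * s)"
    using t s by (intro powr_mono2) (auto simp: t_def)
  also have "\<dots> = K / (1 + D)" using s K D by (simp add: powr_powr)
  finally have tK: "1 + D \<le> K * t powr (- 2 * s)"
    using t D by (simp add: powr_minus field_simps)
  \<comment> \<open>The power of 2/t is the price of moving the kernel from centre \<open>x2\<close>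
    and radius \<theta> = t d to centre \<open>x0\<close> and radius \<open>R\<close>; the factor
    2^n comes from the weight (R/2)^n at \<open>x\<close>.\<close>
  define C where "C = (2 / t) powr p * 2 ^ ?n"
  show ?thesis
  proof (rule exI[of _ C], intro conjI allI impI)
    show "0 < C" using t by (simp add: C_def)
    fix w :: "'a \<Rightarrow> real" and x0 x and R :: real
    assume R: "0 < R" and cont: "continuous_on UNIV w" and int: "integrable lborel (\<lambda>y. w y * kern s 1 y)"
      and super: "\<forall>x\<in>ball x0 R. superharmonic_at s w x" and x: "x \<in> ball x0 (R / 2)"
    define T where "T = (\<integral>y. max 0 (- w y) * kern s R (y - x0) \<partial>lborel)"
    have T: "0 \<le> T" unfolding T_def by simp
    have w: "w \<in> borel_measurable borel" using cont by (rule borel_measurable_continuous_onI)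
    have wm: "(\<lambda>y. max 0 (- w y)) \<in> borel_measurable borel" using w by measurable
    have "integrable lborel (\<lambda>y. max 0 (- w y) * kern s 1 y)"
      by (rule Bochner_Integration.integrable_bound[OF int]) (use wm in \<open>auto simp: abs_mult intro!: mult_right_mono\<close>)
    note intm = integrable_weighted[OF s(1) _ wm this]
    show "- w x \<le> C * R powr (2 * s) * T"
    proof (cases "0 \<le> w x")
      case True
      then show ?thesis using T \<open>0 < C\<close> by (smt (verit) mult_nonneg_nonneg powr_ge_zero)
    next
      case False
      let ?f = "\<lambda>x. w x * (R - dist x0 x) ^ ?n"
      have ne: "cball x0 R \<noteq> {}" using R by auto
      have "continuous_on (cball x0 R) ?f"
        using continuous_on_subset[OF cont] by (intro continuous_intros) auto
      from continuous_attains_inf[OF compact_cball ne this] obtain x1 where x1: "x1 \<in> cball x0 R" and min: "\<And>y. y \<in> cball x0 R \<Longrightarrow> ?f x1 \<le> ?f y"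
        by blast
      define d where "d = R - dist x0 x1"
      define h where "h = - w x1"
      have xR: "R / 2 \<le> R - dist x0 x" using x by simp
      have "(R / 2) ^ ?n \<le> (R - dist x0 x) ^ ?n" using xR R by (intro power_mono) auto
      then have "?f x \<le> w x * (R / 2) ^ ?n" using False by (intro mult_left_mono_neg) auto
      moreover have "?f x1 \<le> ?f x" using x R by (intro min) auto
      ultimately have f1: "- h * d ^ ?n \<le> w x * (R / 2) ^ ?n" by (simp add: h_def d_def)
      \<comment> \<open>A negative minimum cannot lie on the sphere, where the weight vanishes (n is
        at least 1); so d is positive and h as well.\<close>
      also have "\<dots> < 0" using False R by (simp add: mult_neg_pos)
      finally have "0 < h * d ^ ?n" by simp
      moreover have "0 \<le> d" using x1 by (simp add: d_def)
      ultimately have d: "0 < d"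
        by (cases "d = 0") (auto simp: power_0_left)
      with \<open>0 < h * d ^ ?n\<close> have h: "0 < h"
        by (simp add: zero_less_mult_iff)
      have dR: "d \<le> R" by (simp add: d_def)
      have low: "- (2 ^ ?n * h) \<le> w y" if "y \<in> cball x1 (d / 2)" for y
      proof -
        have "dist x0 y \<le> dist x0 x1 + dist x1 y" by (rule dist_triangle)
        then have y: "d / 2 \<le> R - dist x0 y" using that by (simp add: d_def)
        then have "y \<in> cball x0 R" using d by simp
        then have "- h * d ^ ?n \<le> w y * (R - dist x0 y) ^ ?n" using min[of y] by (simp add: h_def d_def)
        show ?thesis
        proof (cases "0 \<le> w y")
          case True
          have "0 \<le> 2 ^ ?n * h" using h by simp
          then show ?thesis using True by linarith
        next
          case False
          have "(d / 2) ^ ?n \<le> (R - dist x0 y) ^ ?n" using y d by (intro power_mono) auto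
          then have "w y * (R - dist x0 y) ^ ?n \<le> w y * (d / 2) ^ ?n" using False by (intro mult_left_mono_neg) auto
          then have "- h * d ^ ?n \<le> w y * (d / 2) ^ ?n" using \<open>- h * d ^ ?n \<le> w y * (R - dist x0 y) ^ ?n\<close> by linarith
          then have "- (2 ^ ?n * h) * d ^ ?n \<le> w y * d ^ ?n"
            by (simp add: power_divide field_simps)
          then show ?thesis by (rule mult_right_le_imp_le) (use d in simp)
        qed
      qed
      have sub: "ball x1 (d / 4) \<subseteq> ball x0 R"
      proof
        fix y assume "y \<in> ball x1 (d / 4)"
        then show "y \<in> ball x0 R" using dist_triangle[of x0 y x1] d by (simp add: d_def)
      qed
      \<comment> \<open>\<open>A * d\<^sup>2 / 16\<close> equals 2^n h, the bound from
        \<open>low\<close>; the required inequality is strict because \<open>w x1\<close> is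
        negative.\<close>
      define A where "A = 16 * 2 ^ ?n * h / d\<^sup>2"
      have A: "2 ^ ?n * h + w x1 < A * d\<^sup>2 / 16" using d h by (simp add: A_def h_def)
      have sup: "superharmonic_at s w y" if "y \<in> ball x1 (d / 4)" for y
        using super sub that by blast
      obtain x2 where x2: "x2 \<in> ball x1 (d / 4)" "w x2 \<le> w x1"
        and ev: "\<And>\<theta>. 0 < \<theta> \<Longrightarrow> \<theta> \<le> d / 4 \<Longrightarrow> (\<integral>z. w (x2 + z) * kern s \<theta> z \<partial>lborel)
            \<le> w x2 * (\<theta> powr (- 2 * s) * K) + A * ((d / 4) powr (2 - 2 * s) * I)"
        using superharmonic_at_near_min[OF s d w int continuous_on_subset[OF cont subset_UNIV] sup low A]
        unfolding K_def I_def by blast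
      define \<theta> where "\<theta> = t * d"
      have \<theta>: "0 < \<theta>" "\<theta> \<le> d / 4" using t d by (auto simp: \<theta>_def)
      have "A * ((d / 4) powr (2 - 2 * s) * I) = h * D * (d powr (2 - 2 * s) / d powr 2)"
        using d by (simp add: A_def D_def powr_divide mult_ac)
      also have "\<dots> = h * D * d powr (- 2 * s)" by (simp add: powr_diff[symmetric])
      finally have e1: "A * ((d / 4) powr (2 - 2 * s) * I) = h * D * d powr (- 2 * s)" .
      have "w x2 * (\<theta> powr (- 2 * s) * K) \<le> - h * (\<theta> powr (- 2 * s) * K)"
        using x2(2) K by (intro mult_right_mono) (auto simp: h_def)
      also have "\<dots> = - h * d powr (- 2 * s) * (K * t powr (- 2 * s))"
        unfolding \<theta>_def powr_mult by simp
      also have "\<dots> \<le> - h * d powr (- 2 * s) * (1 + D)"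
        using tK h by (intro mult_left_mono_neg) (auto simp: mult_nonneg_nonneg)
      finally have "(\<integral>z. w (x2 + z) * kern s \<theta> z \<partial>lborel) \<le> - h * d powr (- 2 * s)"
        using ev[OF \<theta>] e1 by (simp add: algebra_simps)
      then have "h * d powr (- 2 * s) \<le> (\<integral>z. - (w (x2 + z) * kern s \<theta> z) \<partial>lborel)" by simp
      also have "\<dots> \<le> (\<integral>z. max 0 (- w (x2 + z)) * kern s \<theta> (x2 + z - x2) \<partial>lborel)"
      proof (rule integral_mono)
        show "integrable lborel (\<lambda>z. - (w (x2 + z) * kern s \<theta> z))"
          using integrable_weighted_shift[OF s(1) \<theta>(1) w int] by simp
        show "integrable lborel (\<lambda>z. max 0 (- w (x2 + z)) * kern s \<theta> (x2 + z - x2))"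
          using integrable_shift(1)[OF intm[OF \<theta>(1), of x2], of x2] .
        fix z show "- (w (x2 + z) * kern s \<theta> z) \<le> max 0 (- w (x2 + z)) * kern s \<theta> (x2 + z - x2)"
          using mult_right_mono[of "- w (x2 + z)" "max 0 (- w (x2 + z))" "kern s \<theta> z"] by simp
      qed
      also have "\<dots> = (\<integral>y. max 0 (- w y) * kern s \<theta> (y - x2) \<partial>lborel)"
        using integral_shift(1)[of "\<lambda>y. max 0 (- w y) * kern s \<theta> (y - x2)" x2] w by simp
      also have "\<dots> \<le> (\<integral>y. (2 * R / \<theta>) powr p * (max 0 (- w y) * kern s R (y - x0)) \<partial>lborel)"
      proof (rule integral_mono)
        show "integrable lborel (\<lambda>y. max 0 (- w y) * kern s \<theta> (y - x2))" by (rule intm) fact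
        show "integrable lborel (\<lambda>y. (2 * R / \<theta>) powr p * (max 0 (- w y) * kern s R (y - x0)))" using intm[OF R] by simp
        fix y
        have "kern s \<theta> (y - x2) \<le> (2 * R / \<theta>) powr (real DIM('a) + 2 * s) * kern s R (y - x0)"
        proof (rule kern_compare)
          let ?m = "max \<theta> (norm (y - x2))"
          have "R = R / \<theta> * \<theta>" using \<theta> by simp
          also have "\<dots> \<le> R / \<theta> * ?m" using R \<theta> by (intro mult_left_mono) auto
          finally have 1: "R \<le> R / \<theta> * ?m" .
          have "\<theta> \<le> R" using \<theta> d dR by linarith
          then have "1 * ?m \<le> R / \<theta> * ?m" using \<theta> by (intro mult_right_mono) (auto simp: le_max_iff_disj)
          then have 2: "norm (y - x2) \<le> R / \<theta> * ?m" by simp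
          have "x2 \<in> ball x0 R" using x2 sub by blast
          then have "norm (y - x0) \<le> norm (y - x2) + R"
            using dist_triangle[of y x0 x2] by (simp add: dist_norm norm_minus_commute[of x0])
          moreover have "2 * R / \<theta> * ?m = R / \<theta> * ?m + R / \<theta> * ?m" by simp
          ultimately show "max R (norm (y - x0)) \<le> 2 * R / \<theta> * ?m" using 1 2 R by simp
        qed (use s R \<theta> in auto)
        then show "max 0 (- w y) * kern s \<theta> (y - x2) \<le> (2 * R / \<theta>) powr p * (max 0 (- w y) * kern s R (y - x0))"
          using mult_left_mono[of "kern s \<theta> (y - x2)" _ "max 0 (- w y)"] unfolding p_def by (simp add: mult.left_commute)
      qed
      also have "\<dots> = (2 * R / \<theta>) powr p * T" by (simp add: T_def)
      finally have "h * d powr (- 2 * s) \<le> (2 * R / \<theta>) powr p * T" .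
      \<comment> \<open>The factor d^p serves both sides: on the left it leaves h d^n, which
        \<open>f1\<close> relates to the value at \<open>x\<close>, and on the right it removes d
        from 2 R / \<theta>.\<close>
      then have "d powr p * (h * d powr (- 2 * s)) \<le> d powr p * ((2 * R / \<theta>) powr p * T)" by (intro mult_left_mono) auto
      also have "\<dots> = (2 / t * R) powr p * T"
      proof -
        have "d powr p * (2 * R / \<theta>) powr p = (d * (2 * R / \<theta>)) powr p" by (rule powr_mult[symmetric])
        also have "d * (2 * R / \<theta>) = 2 / t * R" using d t by (simp add: \<theta>_def field_simps)
        finally show ?thesis by (simp add: mult.assoc[symmetric])
      qed
      also have "d powr p * (h * d powr (- 2 * s)) = h * d ^ ?n"
      proof -
        have "d powr p * d powr (- 2 * s) = d powr (real ?n)" unfolding p_def powr_add[symmetric] by simp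
        then show ?thesis using d by (simp add: powr_realpow mult.left_commute)
      qed
      finally have "- w x * (R / 2) ^ ?n \<le> (2 / t * R) powr p * T" using f1 by simp
      then have "- w x \<le> (2 / t * R) powr p * T / (R / 2) ^ ?n" using R by (simp add: le_divide_eq)
      also have "\<dots> = (2 / t) powr p * 2 ^ ?n * (R powr p / R powr real ?n) * T"
        using R t unfolding powr_mult by (simp add: powr_realpow power_divide)
      also have "R powr p / R powr real ?n = R powr (2 * s)" by (simp add: p_def powr_diff[symmetric])
      finally show ?thesis by (simp add: C_def)
    qed
  qed
qed

text \<open>With 0 as a lower bound from the start, no weight vanishing at the boundary is needed. A
  paraboloid centred at the given point, with opening proportional to the value there up to a small
  error, has a nearby touching point of no larger value, and both terms of the touching estimate
  become multiples of the given value. The constant may depend on \<open>R\<close>, since the bound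
  is applied at a fixed radius.\<close>

lemma nonneg_superharmonic_lower_bound:
  assumes s: "0 < s" "s < 1" and R: "0 < R"
  shows "\<exists>c>0. \<forall>(w :: 'a::euclidean_space \<Rightarrow> real) x0 x.
    continuous_on UNIV w \<longrightarrow> (\<forall>x. 0 \<le> w x) \<longrightarrow> integrable lborel (\<lambda>y. w y * kern s 1 y) \<longrightarrow>
    (\<forall>x\<in>ball x0 R. superharmonic_at s w x) \<longrightarrow> x \<in> ball x0 (R / 2) \<longrightarrow>
    c * (\<integral>y. w y * kern s R (y - x0) \<partial>lborel) \<le> w x"
proof -
  let ?n = "DIM('a)"
  define p where "p = real ?n + 2 * s"
  define K where "K = (\<integral>z. kern s 1 (z::'a) \<partial>lborel)"
  define I where "I = (\<integral>z. near_kern s 1 (z::'a) \<partial>lborel)"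
  define \<theta> where "\<theta> = R / 4"
  \<comment> \<open>The factor of \<open>w x1 + e\<close> in the touching estimate at radius R/4,
    when the opening of the paraboloid is 16 (w x1 + e) / R^2.\<close>
  define D where "D = \<theta> powr (- 2 * s) * K + 16 / R\<^sup>2 * (\<theta> powr (2 - 2 * s) * I)"
  have K: "0 < K" unfolding K_def using integral_kern_1_pos[OF s(1)] .
  have I: "0 \<le> I" unfolding I_def by simp
  have \<theta>: "0 < \<theta>" using R by (simp add: \<theta>_def)
  have D: "0 < D" using K I \<theta> R unfolding D_def by (intro add_pos_nonneg) auto
  define c where "c = 1 / (2 powr p * D)"
  show ?thesis
  proof (rule exI[of _ c], intro conjI allI impI)
    show "0 < c" using D by (simp add: c_def)
    fix w :: "'a \<Rightarrow> real" and x0 x1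
    assume cont: "continuous_on UNIV w" and pos: "\<forall>x. 0 \<le> w x"
      and int: "integrable lborel (\<lambda>y. w y * kern s 1 y)"
      and super: "\<forall>x\<in>ball x0 R. superharmonic_at s w x" and x1: "x1 \<in> ball x0 (R / 2)"
    define T where "T = (\<integral>y. w y * kern s R (y - x0) \<partial>lborel)"
    have w: "w \<in> borel_measurable borel" using cont by (rule borel_measurable_continuous_onI)
    note intm = integrable_weighted[OF s(1) _ w int]
    have sub: "ball x1 (R / 4) \<subseteq> ball x0 R"
    proof
      fix y assume "y \<in> ball x1 (R / 4)"
      then have "dist x1 y < R / 4" by simp
      moreover have "dist x0 x1 < R / 2" using x1 by simp
      ultimately have "dist x0 y < R" using dist_triangle[of x0 y x1] R by linarith
      then show "y \<in> ball x0 R" by simp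
    qed
    \<comment> \<open>The extra e makes the inequality required of \<open>A\<close> strict, also
      when \<open>w x1\<close> is 0; it is removed at the end.\<close>
    have "T \<le> 2 powr p * D * (w x1 + e)" if e: "0 < e" for e
    proof -
      define A where "A = 16 * (w x1 + e) / R\<^sup>2"
      have A: "0 + w x1 < A * R\<^sup>2 / 16" using R e by (simp add: A_def)
      have sup: "superharmonic_at s w y" if "y \<in> ball x1 (R / 4)" for y
        using super sub that by blast
      have low: "- 0 \<le> w y" if "y \<in> cball x1 (R / 2)" for y
        using pos by simp
      obtain x2 where x2: "x2 \<in> ball x1 (R / 4)" "w x2 \<le> w x1"
        and ev: "\<And>\<theta>. 0 < \<theta> \<Longrightarrow> \<theta> \<le> R / 4 \<Longrightarrow> (\<integral>z. w (x2 + z) * kern s \<theta> z \<partial>lborel)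
            \<le> w x2 * (\<theta> powr (- 2 * s) * K) + A * ((R / 4) powr (2 - 2 * s) * I)"
        using superharmonic_at_near_min[OF s R w int continuous_on_subset[OF cont subset_UNIV] sup low A]
        unfolding K_def I_def by blast
      have "(\<integral>z. w (x2 + z) * kern s \<theta> z \<partial>lborel)
            \<le> w x2 * (\<theta> powr (- 2 * s) * K) + A * (\<theta> powr (2 - 2 * s) * I)"
        using ev[OF \<theta>] by (simp add: \<theta>_def)
      also have "\<dots> \<le> (w x1 + e) * (\<theta> powr (- 2 * s) * K) + A * (\<theta> powr (2 - 2 * s) * I)"
        using x2(2) e K by (intro add_right_mono mult_right_mono) auto
      also have "\<dots> = D * (w x1 + e)" by (simp add: D_def A_def algebra_simps)
      finally have 1: "(\<integral>z. w (x2 + z) * kern s \<theta> z \<partial>lborel) \<le> D * (w x1 + e)" .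
      have "T \<le> (\<integral>y. 2 powr p * (w y * kern s \<theta> (y - x2)) \<partial>lborel)"
        unfolding T_def
      proof (rule integral_mono)
        show "integrable lborel (\<lambda>y. 2 powr p * (w y * kern s \<theta> (y - x2)))" using intm[OF \<theta>] by simp
        show "integrable lborel (\<lambda>y. w y * kern s R (y - x0))" by (rule intm) fact
        fix y
        have "kern s R (y - x0) \<le> 2 powr (real DIM('a) + 2 * s) * kern s \<theta> (y - x2)"
        proof (rule kern_compare)
          have "x2 \<in> ball x0 R" using x2 sub by blast
          then have "norm (y - x2) \<le> norm (y - x0) + R"
            using dist_triangle[of y x2 x0] by (simp add: dist_norm)
          then show "max \<theta> (norm (y - x2)) \<le> 2 * max R (norm (y - x0))"
            using R by (simp add: \<theta>_def max_def)
        qed (use s R \<theta> in auto)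
        then show "w y * kern s R (y - x0) \<le> 2 powr p * (w y * kern s \<theta> (y - x2))"
          using mult_left_mono[of "kern s R (y - x0)" _ "w y"] pos unfolding p_def by (simp add: mult.left_commute)
      qed
      also have "\<dots> = 2 powr p * (\<integral>z. w (x2 + z) * kern s \<theta> z \<partial>lborel)"
        using integral_shift(1)[of "\<lambda>y. w y * kern s \<theta> (y - x2)" x2] w by simp
      also have "\<dots> \<le> 2 powr p * (D * (w x1 + e))" using 1 by (intro mult_left_mono) auto
      finally show ?thesis by (simp add: mult.assoc)
    qed
    then have "c * T \<le> w x1 + e" if "0 < e" for e
      using that D by (simp add: c_def divide_le_eq mult.commute)
    then show "c * T \<le> w x1" by (rule field_le_epsilon)
  qed
qed

subsection \<open>Mollification\<close>

definition bump_mass :: "'a::euclidean_space itself \<Rightarrow> real" where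
  "bump_mass _ = (\<integral>z. flat 0 (1 - (norm (z::'a))\<^sup>2) \<partial>lborel)"

text \<open>The factor 1 / \<rho>^2 is written out so that, after a translation, the numerator is
  literally a generator of \<open>bump_algebra\<close>; smoothness is then immediate.\<close>

definition mollifier :: "real \<Rightarrow> 'a::euclidean_space \<Rightarrow> real" where
  "mollifier \<rho> z = flat 0 (1 - (1 / \<rho>\<^sup>2) * (norm z)\<^sup>2) / (\<rho> ^ DIM('a) * bump_mass TYPE('a))"

lemma flat_0_le_1: "flat 0 t \<le> 1"
  by (simp add: flat_def)

lemma continuous_on_flat [continuous_intros]:
  "continuous_on S f \<Longrightarrow> continuous_on S (\<lambda>x. flat k (f x))"
  by (rule continuous_on_compose2[of UNIV "flat k"])
    (auto intro!: continuous_at_imp_continuous_on DERIV_isCont DERIV_flat)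

lemma measurable_flat [measurable]: "flat k \<in> borel_measurable borel"
  by (intro borel_measurable_continuous_onI continuous_intros)

lemma integrable_bump: "integrable lborel (\<lambda>z::'a::euclidean_space. flat 0 (1 - (norm z)\<^sup>2))"
proof (rule Bochner_Integration.integrable_bound)
  show "integrable lborel (indicator (cball (0::'a) 1) :: 'a \<Rightarrow> real)"
    by (intro integrable_real_indicator) (auto simp: emeasure_cball)
  show "AE z in lborel. norm (flat 0 (1 - (norm (z::'a))\<^sup>2)) \<le> norm (indicator (cball (0::'a) 1) z :: real)"
  proof (intro AE_I2)
    fix z :: 'a
    have "flat 0 (1 - (norm z)\<^sup>2) = 0" if "1 < norm z"
      using that by (simp add: flat_def abs_square_le_1 not_less)
    then show "norm (flat 0 (1 - (norm z)\<^sup>2)) \<le> norm (indicator (cball (0::'a) 1) z :: real)"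
      using flat_0_le_1[of "1 - (norm z)\<^sup>2"] flat_nonneg[of 0 "1 - (norm z)\<^sup>2"]
      by (auto simp: indicator_def)
  qed
qed measurable

lemma bump_mass_pos: "0 < bump_mass TYPE('a::euclidean_space)"
proof -
  have "0 \<le> bump_mass TYPE('a)" unfolding bump_mass_def by (simp add: flat_nonneg)
  moreover have "bump_mass TYPE('a) \<noteq> 0"
  proof
    assume "bump_mass TYPE('a) = 0"
    then have "AE z::'a in lborel. flat 0 (1 - (norm z)\<^sup>2) = 0"
      unfolding bump_mass_def using integrable_bump by (subst (asm) integral_nonneg_eq_0_iff_AE) (auto simp: flat_nonneg)
    then have "AE z::'a in lborel. z \<notin> ball 0 1"
      by eventually_elim (auto simp: flat_def abs_square_less_1)
    then have "emeasure lborel (ball (0::'a) 1) = 0"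
      by (subst (asm) AE_iff_measurable[of "ball (0::'a) 1"]) auto
    then show False by (simp add: emeasure_ball less_imp_neq[OF unit_ball_vol_pos, symmetric])
  qed
  ultimately show ?thesis by simp
qed

lemma mollifier_nonneg [simp]: "0 \<le> \<rho> \<Longrightarrow> 0 \<le> mollifier \<rho> (z::'a::euclidean_space)"
  using bump_mass_pos[where 'a = 'a] by (simp add: mollifier_def flat_nonneg)

lemma continuous_on_mollifier: "continuous_on S f \<Longrightarrow> continuous_on S (\<lambda>x. mollifier \<rho> (f x))"
  unfolding mollifier_def divide_inverse[of "flat _ _"] by (intro continuous_intros) auto

lemma measurable_mollifier [measurable]: "mollifier \<rho> \<in> borel_measurable borel"
  by (intro borel_measurable_continuous_onI continuous_on_mollifier continuous_intros)

lemma mollifier_eq_0_iff: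
  assumes "0 < \<rho>"
  shows "mollifier \<rho> (z::'a::euclidean_space) = 0 \<longleftrightarrow> \<rho> \<le> norm z"
proof -
  have "mollifier \<rho> z = 0 \<longleftrightarrow> \<not> (norm z)\<^sup>2 < \<rho>\<^sup>2"
    using assms bump_mass_pos[where 'a = 'a] by (simp add: mollifier_def flat_def)
  also have "\<dots> \<longleftrightarrow> \<rho> \<le> norm z"
    using assms power_mono_iff[of \<rho> "norm z" 2] by (simp add: not_less)
  finally show ?thesis .
qed

lemma nn_integral_mollifier:
  assumes "0 < \<rho>"
  shows "(\<integral>\<^sup>+z. mollifier \<rho> (z::'a::euclidean_space) \<partial>lborel) = 1"
proof -
  have "(\<integral>\<^sup>+z. mollifier \<rho> (z::'a) \<partial>lborel) = ennreal (\<bar>\<rho>\<bar> ^ DIM('a)) * (\<integral>\<^sup>+z. mollifier \<rho> (0 + \<rho> *\<^sub>R z::'a) \<partial>lborel)"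
    using assms by (intro nn_integral_affine) auto
  also have "\<dots> = ennreal (\<rho> ^ DIM('a)) * (\<integral>\<^sup>+z. ennreal (1 / (\<rho> ^ DIM('a) * bump_mass TYPE('a))) * ennreal (flat 0 (1 - (norm (z::'a))\<^sup>2)) \<partial>lborel)"
    using assms bump_mass_pos[where 'a = 'a]
    by (simp add: mollifier_def power_mult_distrib flat_nonneg ennreal_mult[symmetric])
  also have "\<dots> = ennreal (\<rho> ^ DIM('a)) * (ennreal (1 / (\<rho> ^ DIM('a) * bump_mass TYPE('a))) * ennreal (bump_mass TYPE('a)))"
    by (simp add: nn_integral_cmult bump_mass_def nn_integral_eq_integral[OF integrable_bump] flat_nonneg)
  also have "\<dots> = 1"
    using assms bump_mass_pos[where 'a = 'a] by (simp add: ennreal_mult'[symmetric] mult.assoc[symmetric])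
  finally show ?thesis .
qed

lemma integrable_mollifier:
  assumes "0 < \<rho>"
  shows "integrable lborel (mollifier \<rho> :: 'a::euclidean_space \<Rightarrow> real)"
  using assms by (intro integrableI_nonneg) (auto simp: nn_integral_mollifier)

lemma integral_mollifier:
  assumes "0 < \<rho>"
  shows "(\<integral>z. mollifier \<rho> (z::'a::euclidean_space) \<partial>lborel) = 1"
  using assms by (simp add: integral_eq_nn_integral nn_integral_mollifier)

text \<open>Inside the support \<open>kern s \<rho>\<close> equals \<rho>^-(n+2s), and \<rho>^(2s)
  times this is \<rho>^-n, the height of the mollifier up to a constant. Mollifications of
  nonnegative functions are thus controlled by the dilation-invariant averages.\<close>

lemma mollifier_le_kern:
  fixes z :: "'a::euclidean_space"
  assumes "0 < \<rho>"
  shows "mollifier \<rho> z \<le> 1 / bump_mass TYPE('a) * \<rho> powr (2 * s) * kern s \<rho> z"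
proof (cases "\<rho> \<le> norm z")
  case True
  then show ?thesis using assms mollifier_eq_0_iff[OF assms, of z] bump_mass_pos[where 'a = 'a] by simp
next
  case False
  then have "\<rho> powr (2 * s) * kern s \<rho> z = \<rho> powr (2 * s) * \<rho> powr (- (real DIM('a) + 2 * s))"
    by (simp add: kern_def max_def)
  also have "\<dots> = \<rho> powr (- real DIM('a))"
    by (simp add: powr_add[symmetric])
  also have "\<dots> = 1 / \<rho> ^ DIM('a)" using assms by (simp add: powr_minus powr_realpow divide_inverse)
  finally have "1 / bump_mass TYPE('a) * \<rho> powr (2 * s) * kern s \<rho> z = 1 / (\<rho> ^ DIM('a) * bump_mass TYPE('a))"
    by simp
  then show ?thesis
    using flat_0_le_1 assms bump_mass_pos[where 'a = 'a] unfolding mollifier_def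
    by (simp only:) (intro divide_right_mono; simp)
qed

text \<open>The derivative of \<open>flat 0\<close> is \<open>flat 2\<close>, and
  \<open>flat_le_square\<close> bounds it by 4! = 24 for arguments up to 1.\<close>

lemma flat_0_lipschitz:
  assumes "a \<le> 1" "b \<le> 1"
  shows "\<bar>flat 0 a - flat 0 b\<bar> \<le> 24 * \<bar>a - b\<bar>"
proof -
  have "norm (flat 0 a - flat 0 b) \<le> 24 * norm (a - b)"
  proof (rule field_differentiable_bound[of "{..1}" "flat 0" "flat 2"])
    show "(flat 0 has_field_derivative flat 2 z) (at z within {..1})" for z
      using has_field_derivative_at_within[OF DERIV_flat[of 0 z]] by (simp add: numeral_2_eq_2)
    show "norm (flat 2 z) \<le> 24" if "z \<in> {..1}" for z
    proof (cases "0 < z")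
      case True
      then have "z\<^sup>2 \<le> 1" using that by (simp add: power_le_one)
      then show ?thesis using flat_le_square[of 2 z] by (simp add: fact_numeral)
    qed (simp add: flat_def)
  qed (use assms in auto)
  then show ?thesis by simp
qed

text \<open>On norms up to 2 \<rho> the squared norm is Lipschitz with constant 4 \<rho>, which
  gives 96 = 24 * 4. This range covers the ball on which the local energy will be used.\<close>

lemma mollifier_lipschitz:
  assumes "0 < \<rho>"
  shows "\<exists>L\<ge>0. \<forall>y z::'a::euclidean_space. norm y \<le> 2 * \<rho> \<longrightarrow> norm z \<le> 2 * \<rho> \<longrightarrow>
    \<bar>mollifier \<rho> y - mollifier \<rho> z\<bar> \<le> L * norm (y - z)"
proof -
  define c where "c = \<rho> ^ DIM('a) * bump_mass TYPE('a)"
  have c: "0 < c" using assms bump_mass_pos[where 'a = 'a] by (simp add: c_def)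
  have "\<bar>mollifier \<rho> y - mollifier \<rho> z\<bar> \<le> 96 / (\<rho> * c) * norm (y - z)"
    if "norm y \<le> 2 * \<rho>" "norm z \<le> 2 * \<rho>" for y z :: 'a
  proof -
    have "\<bar>(norm z)\<^sup>2 - (norm y)\<^sup>2\<bar> = (norm z + norm y) * \<bar>norm z - norm y\<bar>"
      by (simp add: power2_eq_square square_diff_square_factored abs_mult)
    also have "\<dots> \<le> (4 * \<rho>) * norm (y - z)"
      using that norm_triangle_ineq3[of z y] assms by (intro mult_mono) (auto simp: norm_minus_commute)
    finally have *: "\<bar>(norm z)\<^sup>2 - (norm y)\<^sup>2\<bar> \<le> 4 * \<rho> * norm (y - z)" .
    have "\<bar>flat 0 (1 - (1 / \<rho>\<^sup>2) * (norm y)\<^sup>2) - flat 0 (1 - (1 / \<rho>\<^sup>2) * (norm z)\<^sup>2)\<bar>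
      \<le> 24 * \<bar>(1 - (1 / \<rho>\<^sup>2) * (norm y)\<^sup>2) - (1 - (1 / \<rho>\<^sup>2) * (norm z)\<^sup>2)\<bar>"
      by (rule flat_0_lipschitz) auto
    also have "(1 - (1 / \<rho>\<^sup>2) * (norm y)\<^sup>2) - (1 - (1 / \<rho>\<^sup>2) * (norm z)\<^sup>2) = (1 / \<rho>\<^sup>2) * ((norm z)\<^sup>2 - (norm y)\<^sup>2)"
      by (simp add: algebra_simps diff_divide_distrib)
    also have "24 * \<bar>(1 / \<rho>\<^sup>2) * ((norm z)\<^sup>2 - (norm y)\<^sup>2)\<bar> = 24 / \<rho>\<^sup>2 * \<bar>(norm z)\<^sup>2 - (norm y)\<^sup>2\<bar>"
      by (simp add: abs_mult)
    also have "\<dots> \<le> 24 / \<rho>\<^sup>2 * (4 * \<rho> * norm (y - z))" using * by (intro mult_left_mono) auto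
    also have "\<dots> = 96 / \<rho> * norm (y - z)" using assms by (simp add: power2_eq_square)
    finally have "\<bar>flat 0 (1 - (1 / \<rho>\<^sup>2) * (norm y)\<^sup>2) - flat 0 (1 - (1 / \<rho>\<^sup>2) * (norm z)\<^sup>2)\<bar> / c \<le> 96 / \<rho> * norm (y - z) / c"
      using c by (intro divide_right_mono) auto
    then show ?thesis
      using c by (simp add: mollifier_def c_def[symmetric] diff_divide_distrib[symmetric])
  qed
  then show ?thesis using assms c by (intro exI[of _ "96 / (\<rho> * c)"]) auto
qed

lemma mollifier_test_function:
  fixes x :: "'a::euclidean_space"
  assumes "0 < \<rho>" "cball x \<rho> \<subseteq> \<Omega>"
  shows "(\<lambda>y. mollifier \<rho> (y - x)) \<in> test_functions \<Omega>"
proof -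
  have "(\<lambda>y. mollifier \<rho> (y - x)) \<in> bump_algebra (1 / \<rho>\<^sup>2) x"
    unfolding mollifier_def divide_inverse[of "flat _ _"] by (intro bump_algebra.intros)
  moreover have "{y. mollifier \<rho> (y - x) \<noteq> 0} = ball x \<rho>"
  proof (intro set_eqI)
    fix y
    show "y \<in> {y. mollifier \<rho> (y - x) \<noteq> 0} \<longleftrightarrow> y \<in> ball x \<rho>"
      using mollifier_eq_0_iff[OF assms(1), of "y - x"] by (simp add: dist_norm norm_minus_commute[of x y] not_le)
  qed
  ultimately show ?thesis
    using assms by (simp add: test_functions_def bump_algebra_C_k)
qed

definition mollify :: "real \<Rightarrow> ('a::euclidean_space \<Rightarrow> real) \<Rightarrow> 'a \<Rightarrow> real" where
  "mollify \<rho> u x = (\<integral>y. u y * mollifier \<rho> (y - x) \<partial>lborel)"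

lemma integrable_mollify:
  fixes u :: "'a::euclidean_space \<Rightarrow> real"
  assumes "0 < s" "0 < \<rho>" and [measurable]: "u \<in> borel_measurable borel"
    and int: "integrable lborel (\<lambda>y. u y * kern s 1 y)"
  shows "integrable lborel (\<lambda>y. u y * mollifier \<rho> (y - x))"
proof (rule Bochner_Integration.integrable_bound)
  let ?c = "1 / bump_mass TYPE('a) * \<rho> powr (2 * s)"
  show "integrable lborel (\<lambda>y. ?c * (u y * kern s \<rho> (y - x)))"
    using integrable_weighted[OF assms] by simp
  have "norm (u y * mollifier \<rho> (y - x)) \<le> norm (?c * (u y * kern s \<rho> (y - x)))" for y
    using mult_left_mono[OF mollifier_le_kern[OF assms(2), of "y - x" s], of "\<bar>u y\<bar>"] assms(2)
      bump_mass_pos[where 'a = 'a] by (simp add: abs_mult mult_ac)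
  then show "AE y in lborel. norm (u y * mollifier \<rho> (y - x)) \<le> norm (?c * (u y * kern s \<rho> (y - x)))" by simp
qed measurable

lemma mollify_minus_const:
  fixes u :: "'a::euclidean_space \<Rightarrow> real"
  assumes "0 < s" "0 < \<rho>" "u \<in> borel_measurable borel"
    and int: "integrable lborel (\<lambda>y. u y * kern s 1 y)"
  shows "mollify \<rho> (\<lambda>y. u y - c) x = mollify \<rho> u x - c"
proof -
  have "(\<integral>y. (u y - c) * mollifier \<rho> (y - x) \<partial>lborel)
    = (\<integral>y. u y * mollifier \<rho> (y - x) \<partial>lborel) - c * (\<integral>y. mollifier \<rho> (y - x) \<partial>lborel)"
    unfolding left_diff_distrib
    using integrable_mollify[OF assms, of x] integrable_shift(3)[OF integrable_mollifier[OF assms(2)], of x] by simp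
  also have "(\<integral>y. mollifier \<rho> (y - x) \<partial>lborel) = 1"
    using integral_shift(3)[of "mollifier \<rho>" x] integral_mollifier[OF assms(2), where 'a = 'a] by simp
  finally show ?thesis by (simp add: mollify_def)
qed

lemma continuous_on_mollify:
  fixes u :: "'a::euclidean_space \<Rightarrow> real"
  assumes s: "0 < s" and \<rho>: "0 < \<rho>" and u [measurable]: "u \<in> borel_measurable borel"
    and int: "integrable lborel (\<lambda>y. u y * kern s 1 y)"
  shows "continuous_on UNIV (mollify \<rho> u)"
  unfolding continuous_on_sequentially comp_def
proof (intro allI ballI impI, elim conjE)
  fix X :: "nat \<Rightarrow> 'a" and x assume X: "X \<longlonglongrightarrow> x"
  have "Bseq X" using convergent_imp_Bseq[OF convergentI[OF X]] .
  then obtain B where B: "\<And>n. norm (X n) \<le> B" unfolding Bseq_def by blast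
  let ?p = "real DIM('a) + 2 * s"
  \<comment> \<open>A convergent sequence of centres is bounded by some \<open>B\<close>, so a
    single multiple of the integrable weight dominates all the translated mollifiers.\<close>
  define c where "c = 1 / bump_mass TYPE('a) * \<rho> powr (2 * s) * ((1 + B) / \<rho> + 1) powr ?p"
  show "(\<lambda>n. mollify \<rho> u (X n)) \<longlonglongrightarrow> mollify \<rho> u x"
    unfolding mollify_def
  proof (rule integral_dominated_convergence)
    show "integrable lborel (\<lambda>y. c * \<bar>u y * kern s 1 y\<bar>)" using int by simp
    show "AE y in lborel. (\<lambda>n. u y * mollifier \<rho> (y - X n)) \<longlonglongrightarrow> u y * mollifier \<rho> (y - x)"
    proof (intro AE_I2 tendsto_mult tendsto_const)
      fix y :: 'a
      have "continuous_on UNIV (\<lambda>z. mollifier \<rho> (y - z))" by (intro continuous_on_mollifier continuous_intros)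
      then have "isCont (\<lambda>z. mollifier \<rho> (y - z)) x" by (simp add: continuous_on_eq_continuous_at)
      then show "(\<lambda>n. mollifier \<rho> (y - X n)) \<longlonglongrightarrow> mollifier \<rho> (y - x)" using X by (rule isCont_tendsto_compose)
    qed
    fix n
    show "AE y in lborel. norm (u y * mollifier \<rho> (y - X n)) \<le> c * \<bar>u y * kern s 1 y\<bar>"
    proof (intro AE_I2)
      fix y
      have "kern s \<rho> (y - X n) \<le> ((1 + norm (X n)) / \<rho> + 1) powr ?p * kern s 1 y"
        by (rule kern_shift_compare[OF s \<rho>])
      also have "\<dots> \<le> ((1 + B) / \<rho> + 1) powr ?p * kern s 1 y"
        using B \<rho> s by (intro mult_right_mono powr_mono2) (auto intro!: divide_right_mono add_nonneg_nonneg)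
      finally have "1 / bump_mass TYPE('a) * \<rho> powr (2 * s) * kern s \<rho> (y - X n) \<le> c * kern s 1 y"
        using bump_mass_pos[where 'a = 'a] mult_left_mono unfolding c_def mult.assoc
        by (intro mult_left_mono) auto
      with mollifier_le_kern[OF \<rho>, of "y - X n" s] have "mollifier \<rho> (y - X n) \<le> c * kern s 1 y" by linarith
      from mult_left_mono[OF this, of "\<bar>u y\<bar>"] \<rho>
      show "norm (u y * mollifier \<rho> (y - X n)) \<le> c * \<bar>u y * kern s 1 y\<bar>"
        by (simp add: abs_mult mult_ac)
    qed
  qed measurable
qed

section \<open>Weighted integrals of mollified functions\<close>

lemma kern_shift_small:
  fixes y z :: "'a::euclidean_space"
  assumes "0 < s" "0 < R" "norm z \<le> R"
  shows "kern s R (y + z) \<le> 2 powr (real DIM('a) + 2 * s) * kern s R y"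
proof (rule kern_compare)
  have "norm y \<le> norm (y + z) + norm z" using norm_triangle_ineq4[of "y + z" z] by simp
  also have "\<dots> \<le> max R (norm (y + z)) + max R (norm (y + z))" using assms by (intro add_mono) auto
  finally show "max R (norm y) \<le> 2 * max R (norm (y + z))" using assms by auto
qed (use assms in auto)

text \<open>The substitution z = y - x lets the mollification act on the kernel instead of on
  \<open>f\<close>. Working in \<open>ennreal\<close>, both exchanges of integrals require
  measurability only.\<close>

lemma nn_integral_convolution_swap:
  fixes f :: "'a::euclidean_space \<Rightarrow> ennreal"
  assumes [measurable]: "f \<in> borel_measurable borel"
  shows "(\<integral>\<^sup>+x. (\<integral>\<^sup>+y. f y * mollifier \<rho> (y - x) \<partial>lborel) * kern s R (x - x0) \<partial>lborel)
    = (\<integral>\<^sup>+z. mollifier \<rho> z * (\<integral>\<^sup>+y. f y * kern s R (y - x0 + - z) \<partial>lborel) \<partial>lborel)"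
proof -
  have "(\<integral>\<^sup>+x. (\<integral>\<^sup>+y. f y * mollifier \<rho> (y - x) \<partial>lborel) * kern s R (x - x0) \<partial>lborel)
    = (\<integral>\<^sup>+x. (\<integral>\<^sup>+y. f y * mollifier \<rho> (y - x) * kern s R (x - x0) \<partial>lborel) \<partial>lborel)"
    by (simp add: nn_integral_multc)
  also have "\<dots> = (\<integral>\<^sup>+y. (\<integral>\<^sup>+x. f y * mollifier \<rho> (y - x) * kern s R (x - x0) \<partial>lborel) \<partial>lborel)"
    by (rule lborel_pair.Fubini') measurable
  also have "\<dots> = (\<integral>\<^sup>+y. (\<integral>\<^sup>+z. f y * mollifier \<rho> z * kern s R (y - z - x0) \<partial>lborel) \<partial>lborel)"
  proof (rule nn_integral_cong)
    fix y
    show "(\<integral>\<^sup>+x. f y * mollifier \<rho> (y - x) * kern s R (x - x0) \<partial>lborel)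
      = (\<integral>\<^sup>+z. f y * mollifier \<rho> z * kern s R (y - z - x0) \<partial>lborel)"
      by (subst nn_integral_shift(4)[of _ y, symmetric]) simp_all
  qed
  also have "\<dots> = (\<integral>\<^sup>+z. (\<integral>\<^sup>+y. f y * mollifier \<rho> z * kern s R (y - z - x0) \<partial>lborel) \<partial>lborel)"
    by (rule lborel_pair.Fubini') measurable
  also have "\<dots> = (\<integral>\<^sup>+z. mollifier \<rho> z * (\<integral>\<^sup>+y. f y * kern s R (y - x0 + - z) \<partial>lborel) \<partial>lborel)"
    by (subst nn_integral_cmult[symmetric]) (auto simp: mult_ac algebra_simps)
  finally show ?thesis .
qed

text \<open>The mollifier is a probability density on shifts shorter than \<open>R\<close>, and such
  a shift changes \<open>kern s R\<close> by a factor of at most 2^(n+2s). The constant does not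
  involve \<rho>, as is necessary for removing the mollification; the reverse estimate below has the
  same reason.\<close>

lemma nn_integral_mollify_kern_le:
  fixes f :: "'a::euclidean_space \<Rightarrow> ennreal"
  assumes s: "0 < s" and \<rho>: "0 < \<rho>" "\<rho> \<le> R" and f [measurable]: "f \<in> borel_measurable borel"
  shows "(\<integral>\<^sup>+x. (\<integral>\<^sup>+y. f y * mollifier \<rho> (y - x) \<partial>lborel) * kern s R (x - x0) \<partial>lborel)
    \<le> ennreal (2 powr (real DIM('a) + 2 * s)) * (\<integral>\<^sup>+y. f y * kern s R (y - x0) \<partial>lborel)"
    (is "_ \<le> ennreal ?c * ?X")
proof -
  have "(\<integral>\<^sup>+x. (\<integral>\<^sup>+y. f y * mollifier \<rho> (y - x) \<partial>lborel) * kern s R (x - x0) \<partial>lborel)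
    \<le> (\<integral>\<^sup>+z. mollifier \<rho> (z::'a) * (ennreal ?c * ?X) \<partial>lborel)"
    unfolding nn_integral_convolution_swap[OF f]
  proof (rule nn_integral_mono)
    fix z :: 'a
    show "ennreal (mollifier \<rho> z) * (\<integral>\<^sup>+y. f y * kern s R (y - x0 + - z) \<partial>lborel) \<le> mollifier \<rho> z * (ennreal ?c * ?X)"
    proof (cases "norm z < \<rho>")
      case True
      have "(\<integral>\<^sup>+y. f y * kern s R (y - x0 + - z) \<partial>lborel) \<le> (\<integral>\<^sup>+y. ennreal ?c * (f y * kern s R (y - x0)) \<partial>lborel)"
      proof (rule nn_integral_mono)
        fix y
        have "ennreal (kern s R (y - x0 + - z)) \<le> ennreal ?c * ennreal (kern s R (y - x0))"
          using kern_shift_small[OF s, of R "- z" "y - x0"] True \<rho> by (simp add: ennreal_mult[symmetric] ennreal_leI)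
        then show "f y * ennreal (kern s R (y - x0 + - z)) \<le> ennreal ?c * (f y * ennreal (kern s R (y - x0)))"
          using mult_left_mono[of _ _ "f y"] by (simp add: mult.left_commute)
      qed
      also have "\<dots> = ennreal ?c * ?X" by (rule nn_integral_cmult) measurable
      finally show ?thesis by (rule mult_left_mono) simp
    next
      case False
      then show ?thesis using mollifier_eq_0_iff[OF \<rho>(1), of z] by simp
    qed
  qed
  also have "\<dots> = ennreal ?c * ?X"
    by (subst nn_integral_multc) (auto simp: nn_integral_mollifier[OF \<rho>(1)])
  finally show ?thesis .
qed

lemma nn_integral_mollify_kern_ge:
  fixes f :: "'a::euclidean_space \<Rightarrow> ennreal"
  assumes s: "0 < s" and \<rho>: "0 < \<rho>" "\<rho> \<le> R" and f [measurable]: "f \<in> borel_measurable borel"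
  shows "(\<integral>\<^sup>+y. f y * kern s R (y - x0) \<partial>lborel) \<le> ennreal (2 powr (real DIM('a) + 2 * s)) *
    (\<integral>\<^sup>+x. (\<integral>\<^sup>+y. f y * mollifier \<rho> (y - x) \<partial>lborel) * kern s R (x - x0) \<partial>lborel)"
    (is "?X \<le> ennreal ?c * _")
proof -
  have "?X = (\<integral>\<^sup>+z. mollifier \<rho> (z::'a) * ?X \<partial>lborel)"
    by (subst nn_integral_multc) (auto simp: nn_integral_mollifier[OF \<rho>(1)])
  also have "\<dots> \<le> (\<integral>\<^sup>+z. ennreal ?c * (mollifier \<rho> (z::'a) * (\<integral>\<^sup>+y. f y * kern s R (y - x0 + - z) \<partial>lborel)) \<partial>lborel)"
  proof (rule nn_integral_mono)
    fix z :: 'a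
    show "ennreal (mollifier \<rho> z) * ?X \<le> ennreal ?c * (mollifier \<rho> z * (\<integral>\<^sup>+y. f y * kern s R (y - x0 + - z) \<partial>lborel))"
    proof (cases "norm z < \<rho>")
      case True
      have "?X \<le> (\<integral>\<^sup>+y. ennreal ?c * (f y * kern s R (y - x0 + - z)) \<partial>lborel)"
      proof (rule nn_integral_mono)
        fix y
        have "ennreal (kern s R (y - x0)) \<le> ennreal ?c * ennreal (kern s R (y - x0 + - z))"
          using kern_shift_small[OF s, of R z "y - x0 + - z"] True \<rho> by (simp add: ennreal_mult[symmetric] ennreal_leI)
        then show "f y * ennreal (kern s R (y - x0)) \<le> ennreal ?c * (f y * ennreal (kern s R (y - x0 + - z)))"
          using mult_left_mono[of _ _ "f y"] by (simp add: mult.left_commute)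
      qed
      also have "\<dots> = ennreal ?c * (\<integral>\<^sup>+y. f y * kern s R (y - x0 + - z) \<partial>lborel)" by (rule nn_integral_cmult) measurable
      finally show ?thesis using mult_left_mono[of _ _ "ennreal (mollifier \<rho> z)"] by (simp add: mult.left_commute)
    next
      case False
      then show ?thesis using mollifier_eq_0_iff[OF \<rho>(1), of z] by simp
    qed
  qed
  also have "\<dots> = ennreal ?c * (\<integral>\<^sup>+z. mollifier \<rho> (z::'a) * (\<integral>\<^sup>+y. f y * kern s R (y - x0 + - z) \<partial>lborel) \<partial>lborel)"
    by (rule nn_integral_cmult) measurable
  finally show ?thesis unfolding nn_integral_convolution_swap[OF f] .
qed

lemma ennreal_mollify_nonneg:
  fixes f :: "'a::euclidean_space \<Rightarrow> real"
  assumes "0 < s" "0 < \<rho>" "f \<in> borel_measurable borel"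
    and "integrable lborel (\<lambda>y. f y * kern s 1 y)" and "\<And>y. 0 \<le> f y"
  shows "ennreal (mollify \<rho> f x) = (\<integral>\<^sup>+y. ennreal (f y) * mollifier \<rho> (y - x) \<partial>lborel)"
  unfolding mollify_def using assms integrable_mollify[OF assms(1-4), of x]
  by (simp add: ennreal_mult[symmetric] nn_integral_eq_integral)

lemma mollify_mono:
  fixes f :: "'a::euclidean_space \<Rightarrow> real"
  assumes "0 < s" "0 < \<rho>" "f \<in> borel_measurable borel" "integrable lborel (\<lambda>y. f y * kern s 1 y)"
    and "g \<in> borel_measurable borel" "integrable lborel (\<lambda>y. g y * kern s 1 y)"
    and "\<And>y. f y \<le> g y"
  shows "mollify \<rho> f x \<le> mollify \<rho> g x"
  unfolding mollify_def using assms integrable_mollify[OF assms(1-4), of x] integrable_mollify[OF assms(1,2,5,6), of x]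
  by (intro integral_mono mult_right_mono) auto

lemma mollify_uminus: "mollify \<rho> (\<lambda>y. - f y) x = - mollify \<rho> f x"
  by (simp add: mollify_def)

lemma integrable_mollify_weighted:
  fixes u :: "'a::euclidean_space \<Rightarrow> real"
  assumes s: "0 < s" and \<rho>: "0 < \<rho>" "\<rho> \<le> R" and u [measurable]: "u \<in> borel_measurable borel"
    and int: "integrable lborel (\<lambda>y. u y * kern s 1 y)"
  shows "integrable lborel (\<lambda>x. mollify \<rho> u x * kern s R (x - x0))"
proof -
  have au: "(\<lambda>y. \<bar>u y\<bar>) \<in> borel_measurable borel" by measurable
  have ai: "integrable lborel (\<lambda>y. \<bar>u y\<bar> * kern s 1 y)"
    using integrable_abs[OF int] by (simp add: abs_mult)
  have "(\<integral>\<^sup>+x. ennreal (mollify \<rho> (\<lambda>y. \<bar>u y\<bar>) x * kern s R (x - x0)) \<partial>lborel)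
    = (\<integral>\<^sup>+x. (\<integral>\<^sup>+y. ennreal \<bar>u y\<bar> * mollifier \<rho> (y - x) \<partial>lborel) * kern s R (x - x0) \<partial>lborel)"
    by (simp add: ennreal_mult'' ennreal_mollify_nonneg[OF s \<rho>(1) au ai])
  also have "\<dots> \<le> ennreal (2 powr (real DIM('a) + 2 * s)) * (\<integral>\<^sup>+y. ennreal \<bar>u y\<bar> * kern s R (y - x0) \<partial>lborel)"
    by (rule nn_integral_mollify_kern_le[OF s \<rho>]) measurable
  also have "\<dots> < \<infinity>"
    using integrable_weighted[OF s _ au ai, of R x0] \<rho>
    by (simp add: ennreal_mult[symmetric] nn_integral_eq_integral)
  finally have fin: "(\<integral>\<^sup>+x. ennreal (mollify \<rho> (\<lambda>y. \<bar>u y\<bar>) x * kern s R (x - x0)) \<partial>lborel) < \<infinity>" .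
  have [measurable]: "mollify \<rho> u \<in> borel_measurable borel" "mollify \<rho> (\<lambda>y. \<bar>u y\<bar>) \<in> borel_measurable borel"
    using continuous_on_mollify[OF s \<rho>(1) u int] continuous_on_mollify[OF s \<rho>(1) au ai]
    by (simp_all add: borel_measurable_continuous_onI)
  have ab: "\<bar>mollify \<rho> u x\<bar> \<le> mollify \<rho> (\<lambda>y. \<bar>u y\<bar>) x" for x
  proof -
    have "mollify \<rho> u x \<le> mollify \<rho> (\<lambda>y. \<bar>u y\<bar>) x"
      by (rule mollify_mono[OF s \<rho>(1) u int au ai]) simp
    moreover have "mollify \<rho> (\<lambda>y. - u y) x \<le> mollify \<rho> (\<lambda>y. \<bar>u y\<bar>) x"
      using int by (intro mollify_mono[OF s \<rho>(1) _ _ au ai]) auto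
    ultimately show ?thesis by (simp add: mollify_uminus)
  qed
  then have nn: "0 \<le> mollify \<rho> (\<lambda>y. \<bar>u y\<bar>) x" for x by (smt (verit))
  show ?thesis
  proof (rule Bochner_Integration.integrable_bound)
    show "integrable lborel (\<lambda>x. mollify \<rho> (\<lambda>y. \<bar>u y\<bar>) x * kern s R (x - x0))"
      using fin nn by (intro integrableI_nonneg) auto
    show "AE x in lborel. norm (mollify \<rho> u x * kern s R (x - x0)) \<le> norm (mollify \<rho> (\<lambda>y. \<bar>u y\<bar>) x * kern s R (x - x0))"
      using ab nn by (auto simp: abs_mult intro!: mult_right_mono)
  qed measurable
qed

subsection \<open>From the distributional to the pointwise inequality\<close>

abbreviation energy_kernel :: "real \<Rightarrow> ('a::euclidean_space \<Rightarrow> real) \<Rightarrow> ('a \<Rightarrow> real) \<Rightarrow> 'a \<times> 'a \<Rightarrow> real" where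
  "energy_kernel s u \<phi> \<equiv> \<lambda>(x, y). (u x - u y) * (\<phi> x - \<phi> y) / norm (x - y) powr (real DIM('a) + 2 * s)"

lemma integrable_pair_mult_shift:
  fixes f g :: "'a::euclidean_space \<Rightarrow> real"
  assumes f: "integrable lborel f" and g: "integrable lborel g"
  shows "integrable (lborel \<Otimes>\<^sub>M lborel) (\<lambda>(x, y). f x * g (y - x))"
    and "integrable (lborel \<Otimes>\<^sub>M lborel) (\<lambda>(x, y). f y * g (x - y))"
    and "integrable (lborel \<Otimes>\<^sub>M lborel) (\<lambda>(x, y). f x * g y)"
proof -
  have [measurable]: "f \<in> borel_measurable borel" "g \<in> borel_measurable borel"
    using f g by auto
  show 1: "integrable (lborel \<Otimes>\<^sub>M lborel) (\<lambda>(x, y). f x * g (y - x))"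
  proof (rule lborel_pair.Fubini_integrable)
    have "(\<integral>y. norm (case (x, y) of (x, y) \<Rightarrow> f x * g (y - x)) \<partial>lborel) = \<bar>f x\<bar> * (\<integral>y. \<bar>g y\<bar> \<partial>lborel)" for x
      using integral_shift(3)[of "\<lambda>y. \<bar>g y\<bar>" x] by (simp add: abs_mult)
    then show "integrable lborel (\<lambda>x. \<integral>y. norm (case (x, y) of (x, y) \<Rightarrow> f x * g (y - x)) \<partial>lborel)"
      using f by simp
    show "AE x in lborel. integrable lborel (\<lambda>y. case (x, y) of (x, y) \<Rightarrow> f x * g (y - x))"
      using integrable_shift(3)[OF g] by simp
  qed measurable
  show "integrable (lborel \<Otimes>\<^sub>M lborel) (\<lambda>(x, y). f y * g (x - y))"
    using lborel_pair.integrable_product_swap[OF 1] by (simp add: case_prod_unfold)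
  show "integrable (lborel \<Otimes>\<^sub>M lborel) (\<lambda>(x, y). f x * g y)"
  proof (rule lborel_pair.Fubini_integrable)
    show "integrable lborel (\<lambda>x. \<integral>y. norm (case (x, y) of (x, y) \<Rightarrow> f x * g y) \<partial>lborel)"
      using f by (simp add: abs_mult)
    show "AE x in lborel. integrable lborel (\<lambda>y. case (x, y) of (x, y) \<Rightarrow> f x * g y)"
      using g by simp
  qed measurable
qed

text \<open>Here the local energy of \<open>u\<close> enters. At distance less than \<rho> the
  product of the two differences is split, by the inequality of arithmetic and geometric means, into
  this energy and a Lipschitz term. At larger distance the singular kernel agrees with
  \<open>kern s \<rho>\<close>, and the four products are integrable separately.\<close>

lemma integrable_energy_kernel:
  fixes u :: "'a::euclidean_space \<Rightarrow> real"
  assumes s: "0 < s" "s < 1" and \<rho>: "0 < \<rho>" and u [measurable]: "u \<in> borel_measurable borel"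
    and int: "integrable lborel (\<lambda>y. u y * kern s 1 y)"
    and energy: "integrable (lborel \<Otimes>\<^sub>M lborel) (\<lambda>(y, y'). indicator (ball x (2 * \<rho>) \<times> ball x (2 * \<rho>)) (y, y') *
      ((u y - u y')\<^sup>2 / norm (y - y') powr (real DIM('a) + 2 * s)))"
  shows "integrable (lborel \<Otimes>\<^sub>M lborel) (energy_kernel s u (\<lambda>y. mollifier \<rho> (y - x)))"
proof -
  let ?p = "real DIM('a) + 2 * s"
  let ?B = "ball x (2 * \<rho>)"
  define \<phi> where "\<phi> y = mollifier \<rho> (y - x)" for y
  have [measurable]: "\<phi> \<in> borel_measurable borel" unfolding \<phi>_def[abs_def] by measurable
  have [measurable]: "?B \<in> sets borel" by simp
  define E where "E y y' = indicator (?B \<times> ?B) (y, y') * ((u y - u y')\<^sup>2 / norm (y - y') powr ?p)" for y y'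
  define k where "k = (kern s \<rho> :: 'a \<Rightarrow> real)"
  define c where "c = ((1 + (norm x + \<rho>)) / \<rho> + 1) powr ?p"
  obtain L where L: "0 \<le> L" "\<And>y z::'a. norm y \<le> 2 * \<rho> \<Longrightarrow> norm z \<le> 2 * \<rho> \<Longrightarrow>
      \<bar>mollifier \<rho> y - mollifier \<rho> z\<bar> \<le> L * norm (y - z)"
    using mollifier_lipschitz[OF \<rho>] by blast
  have \<phi>_nonneg: "0 \<le> \<phi> y" for y using \<rho> by (simp add: \<phi>_def)
  have \<phi>_0: "\<phi> y = 0 \<longleftrightarrow> \<rho> \<le> dist x y" for y
    using mollifier_eq_0_iff[OF \<rho>, of "y - x"] by (simp add: \<phi>_def dist_norm norm_minus_commute)
  \<comment> \<open>The first two terms dominate the part near the diagonal, the other four the part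
    away from it; in the last two the kernel is already replaced by the weight about the
    origin.\<close>
  define G where "G = (\<lambda>(y, y'). E y y' + L\<^sup>2 * (indicator ?B y * near_kern s \<rho> (y' - y))
      + (\<bar>u y * \<phi> y\<bar> * k (y' - y) + \<bar>u y' * \<phi> y'\<bar> * k (y - y')
      + c * (\<bar>u y * kern s 1 y\<bar> * \<phi> y') + c * (\<phi> y * \<bar>u y' * kern s 1 y'\<bar>)))"
  have "integrable (lborel \<Otimes>\<^sub>M lborel) G"
  proof -
    have i\<phi>: "integrable lborel \<phi>"
      unfolding \<phi>_def by (rule integrable_shift(3)[OF integrable_mollifier[OF \<rho>]])
    have iu\<phi>: "integrable lborel (\<lambda>y. \<bar>u y * \<phi> y\<bar>)"
      unfolding \<phi>_def by (rule integrable_abs[OF integrable_mollify[OF s(1) \<rho> u int]])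
    have ik: "integrable lborel k" unfolding k_def by (rule integrable_kern[OF \<rho> s(1)])
    have iB: "integrable lborel (indicator ?B :: 'a \<Rightarrow> real)"
      by (intro integrable_real_indicator) (use \<rho> in \<open>auto simp: emeasure_ball\<close>)
    note iu = integrable_abs[OF int]
    have "integrable (lborel \<Otimes>\<^sub>M lborel) (\<lambda>(y, y'). E y y')"
      using energy unfolding E_def .
    moreover have "integrable (lborel \<Otimes>\<^sub>M lborel) (\<lambda>(y, y'). L\<^sup>2 * (indicator ?B y * near_kern s \<rho> (y' - y)))"
      using integrable_pair_mult_shift(1)[OF iB integrable_near_kern[OF \<rho> s]] by (simp add: case_prod_unfold)
    moreover have "integrable (lborel \<Otimes>\<^sub>M lborel) (\<lambda>(y, y'). \<bar>u y * \<phi> y\<bar> * k (y' - y))"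
      by (rule integrable_pair_mult_shift(1)[OF iu\<phi> ik])
    moreover have "integrable (lborel \<Otimes>\<^sub>M lborel) (\<lambda>(y, y'). \<bar>u y' * \<phi> y'\<bar> * k (y - y'))"
      by (rule integrable_pair_mult_shift(2)[OF iu\<phi> ik])
    moreover have "integrable (lborel \<Otimes>\<^sub>M lborel) (\<lambda>(y, y'). c * (\<bar>u y * kern s 1 y\<bar> * \<phi> y'))"
      using integrable_pair_mult_shift(3)[OF iu i\<phi>] by (simp add: case_prod_unfold)
    moreover have "integrable (lborel \<Otimes>\<^sub>M lborel) (\<lambda>(y, y'). c * (\<phi> y * \<bar>u y' * kern s 1 y'\<bar>))"
      using integrable_pair_mult_shift(3)[OF i\<phi> iu] by (simp add: case_prod_unfold)
    ultimately show ?thesis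
      unfolding G_def case_prod_unfold by (intro Bochner_Integration.integrable_add)
  qed
  then show ?thesis
  proof (rule Bochner_Integration.integrable_bound)
    show "energy_kernel s u (\<lambda>y. mollifier \<rho> (y - x)) \<in> borel_measurable (lborel \<Otimes>\<^sub>M lborel)" by measurable
    \<comment> \<open>If \<open>\<phi> y'\<close> is nonzero, y' lies within \<rho> of x, so one
      constant \<open>c\<close> serves for moving the centre of the kernel from y' to the
      origin.\<close>
    have kc: "\<phi> y' * k (y - y') \<le> c * (kern s 1 y * \<phi> y')" for y y'
    proof (cases "\<phi> y' = 0")
      case False
      then have "norm (x - y') < \<rho>" using \<phi>_0[of y'] by (simp add: dist_norm)
      then have "norm y' \<le> norm x + \<rho>" using norm_triangle_sub[of y' x] by (simp add: norm_minus_commute)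
      then have "((1 + norm y') / \<rho> + 1) powr ?p \<le> c"
        unfolding c_def using \<rho> s by (intro powr_mono2) (auto intro!: divide_right_mono add_nonneg_nonneg)
      then have "((1 + norm y') / \<rho> + 1) powr ?p * kern s 1 y \<le> c * kern s 1 y" by (rule mult_right_mono) simp
      then have "k (y - y') \<le> c * kern s 1 y"
        using kern_shift_compare[OF s(1) \<rho>, of y y'] unfolding k_def by linarith
      from mult_left_mono[OF this \<phi>_nonneg[of y']] show ?thesis by (simp add: mult_ac)
    qed simp
    have k_sym: "k (y' - y) = k (y - y')" for y y' unfolding k_def by (metis kern_minus minus_diff_eq)
    have k_nonneg: "0 \<le> k z" for z by (simp add: k_def)
    have "\<bar>(u y - u y') * (\<phi> y - \<phi> y') / norm (y - y') powr ?p\<bar> \<le> G (y, y')" for y y'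
    proof -
      let ?N = "norm (y - y') powr ?p"
      let ?far = "\<bar>u y * \<phi> y\<bar> * k (y' - y) + \<bar>u y' * \<phi> y'\<bar> * k (y - y')
        + c * (\<bar>u y * kern s 1 y\<bar> * \<phi> y') + c * (\<phi> y * \<bar>u y' * kern s 1 y'\<bar>)"
      let ?near = "E y y' + L\<^sup>2 * (indicator ?B y * near_kern s \<rho> (y' - y))"
      have G: "G (y, y') = ?near + ?far" by (simp add: G_def)
      have far_nonneg: "0 \<le> ?far" by (intro add_nonneg_nonneg mult_nonneg_nonneg) (auto simp: \<phi>_nonneg k_nonneg c_def)
      have near_nonneg: "0 \<le> ?near" by (intro add_nonneg_nonneg mult_nonneg_nonneg) (auto simp: E_def)
      show ?thesis
      proof (cases "norm (y - y') < \<rho>")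
        case True
        show ?thesis
        proof (cases "\<phi> y = 0 \<and> \<phi> y' = 0")
          case True
          then show ?thesis using G far_nonneg near_nonneg by simp
        next
          case False
          \<comment> \<open>One point is in the open ball of radius \<rho> where
            \<open>\<phi>\<close> is nonzero, the other closer than \<rho> to it: this is why the
            energy is taken on the ball of radius 2 \<rho>.\<close>
          then have "dist x y < \<rho> \<or> dist x y' < \<rho>" using \<phi>_0[of y] \<phi>_0[of y'] by auto
          then have B: "y \<in> ?B" "y' \<in> ?B"
            using dist_triangle[of x y y'] dist_triangle[of x y' y] True \<rho>
            by (auto simp: dist_norm[of y y'] dist_norm[of y' y] norm_minus_commute[of y' y])
          have "\<bar>\<phi> y - \<phi> y'\<bar> \<le> L * norm (y - y')"
            using L(2)[of "y - x" "y' - x"] B by (simp add: \<phi>_def dist_norm norm_minus_commute)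
          then have "(\<phi> y - \<phi> y')\<^sup>2 \<le> (L * norm (y - y'))\<^sup>2" using abs_le_square_iff[of "\<phi> y - \<phi> y'" "L * norm (y - y')"] L(1) by simp
          moreover have "2 * \<bar>(u y - u y') * (\<phi> y - \<phi> y')\<bar> \<le> (u y - u y')\<^sup>2 + (\<phi> y - \<phi> y')\<^sup>2"
            using sum_squares_bound[of "\<bar>u y - u y'\<bar>" "\<bar>\<phi> y - \<phi> y'\<bar>"] by (simp add: abs_mult)
          moreover have "0 \<le> \<bar>(u y - u y') * (\<phi> y - \<phi> y')\<bar>" by simp
          ultimately have "\<bar>(u y - u y') * (\<phi> y - \<phi> y')\<bar> \<le> (u y - u y')\<^sup>2 + L\<^sup>2 * (norm (y - y'))\<^sup>2"
            unfolding power_mult_distrib by linarith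
          then have "\<bar>(u y - u y') * (\<phi> y - \<phi> y')\<bar> / ?N \<le> ((u y - u y')\<^sup>2 + L\<^sup>2 * (norm (y - y'))\<^sup>2) / ?N"
            by (rule divide_right_mono) simp
          also have "\<dots> = ?near"
            using B True by (simp add: E_def near_kern_def norm_minus_commute[of y' y] add_divide_distrib)
          finally show ?thesis using G far_nonneg by simp
        qed
      next
        case False
        then have "max \<rho> (norm (y - y')) = norm (y - y')" by simp
        then have k: "1 / ?N = k (y - y')" unfolding k_def kern_def powr_minus by (simp add: divide_inverse)
        have "\<bar>(u y - u y') * (\<phi> y - \<phi> y') / ?N\<bar> = \<bar>u y - u y'\<bar> * \<bar>\<phi> y - \<phi> y'\<bar> * k (y - y')"
          unfolding k[symmetric] by (simp add: abs_mult)
        also have "\<dots> \<le> (\<bar>u y\<bar> + \<bar>u y'\<bar>) * (\<phi> y + \<phi> y') * k (y - y')"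
          using \<phi>_nonneg[of y] \<phi>_nonneg[of y'] k_nonneg by (intro mult_right_mono mult_mono) auto
        also have "\<dots> = \<bar>u y * \<phi> y\<bar> * k (y' - y) + \<bar>u y' * \<phi> y'\<bar> * k (y - y')
            + \<bar>u y\<bar> * (\<phi> y' * k (y - y')) + \<bar>u y'\<bar> * (\<phi> y * k (y' - y))"
          using \<phi>_nonneg[of y] \<phi>_nonneg[of y'] by (simp add: k_sym[of y' y] abs_mult algebra_simps)
        also have "\<dots> \<le> \<bar>u y * \<phi> y\<bar> * k (y' - y) + \<bar>u y' * \<phi> y'\<bar> * k (y - y')
            + \<bar>u y\<bar> * (c * (kern s 1 y * \<phi> y')) + \<bar>u y'\<bar> * (c * (kern s 1 y' * \<phi> y))"
          using kc[of y' y] kc[of y y'] by (intro add_mono mult_left_mono) auto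
        also have "\<dots> = ?far" by (simp add: abs_mult mult_ac)
        finally show ?thesis using G near_nonneg by linarith
      qed
    qed
    moreover have "0 \<le> G (y, y')" for y y' using calculation[of y y'] by linarith
    ultimately show "AE z in lborel \<Otimes>\<^sub>M lborel. norm (energy_kernel s u (\<lambda>y. mollifier \<rho> (y - x)) z) \<le> norm (G z)"
      by (intro AE_I2) (auto simp: \<phi>_def split: prod.split)
  qed
qed

text \<open>In the variables y and z = y' - y the denominator of the tested integral depends on z
  alone. Integrating over y first, the four products yield 2 w x - w (x - z) - w (x + z), so the
  double integral is the negative of the one in \<open>superharmonic_at\<close>; Fubini supplies the
  integrability as well.\<close>

lemma superharmonic_at_mollify:
  fixes u :: "'a::euclidean_space \<Rightarrow> real"
  assumes s: "0 < s" "s < 1" and \<rho>: "0 < \<rho>" and u [measurable]: "u \<in> borel_measurable borel"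
    and int: "integrable lborel (\<lambda>y. u y * kern s 1 y)"
    and F: "integrable (lborel \<Otimes>\<^sub>M lborel) (energy_kernel s u (\<lambda>y. mollifier \<rho> (y - x)))"
    and nonneg: "0 \<le> (\<integral>z. energy_kernel s u (\<lambda>y. mollifier \<rho> (y - x)) z \<partial>(lborel \<Otimes>\<^sub>M lborel))"
  shows "superharmonic_at s (mollify \<rho> u) x"
proof -
  let ?p = "real DIM('a) + 2 * s"
  let ?w = "mollify \<rho> u"
  define \<phi> where "\<phi> y = mollifier \<rho> (y - x)" for y
  have [measurable]: "\<phi> \<in> borel_measurable borel" unfolding \<phi>_def[abs_def] by measurable
  define F where "F y y' = (u y - u y') * (\<phi> y - \<phi> y') / norm (y - y') powr ?p" for y y'
  have F_eq: "energy_kernel s u (\<lambda>y. mollifier \<rho> (y - x)) = (\<lambda>(y, y'). F y y')"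
    by (simp add: F_def \<phi>_def)
  have iF: "integrable (lborel \<Otimes>\<^sub>M lborel) (\<lambda>(y, y'). F y y')" using F by (simp only: F_eq)
  have [measurable]: "(\<lambda>(y, y'). F y y') \<in> borel_measurable (lborel \<Otimes>\<^sub>M lborel)" using iF by simp
  have Fm: "F y \<in> borel_measurable borel" for y unfolding F_def by measurable
  have shift: "(\<integral>z. F y (y + z) \<partial>lborel) = (\<integral>y'. F y y' \<partial>lborel)" for y
    by (rule integral_shift(1)[OF Fm])
  have "integrable (lborel \<Otimes>\<^sub>M lborel) (\<lambda>(y, z). F y (y + z))"
  proof (rule lborel_pair.Fubini_integrable)
    show "(\<lambda>(y, z). F y (y + z)) \<in> borel_measurable (lborel \<Otimes>\<^sub>M lborel)" unfolding F_def by measurable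
    have "integrable lborel (\<lambda>y. \<integral>y'. norm (F y y') \<partial>lborel)"
      using lborel_pair.integrable_fst[of "\<lambda>y y'. norm (F y y')"] integrable_norm[OF iF] by (simp add: case_prod_unfold)
    moreover have "(\<integral>z. norm (F y (y + z)) \<partial>lborel) = (\<integral>y'. norm (F y y') \<partial>lborel)" for y
      using Fm[of y] by (intro integral_shift(1)[of "\<lambda>y'. norm (F y y')"]) simp
    ultimately show "integrable lborel (\<lambda>y. \<integral>z. norm (case (y, z) of (y, z) \<Rightarrow> F y (y + z)) \<partial>lborel)" by simp
    show "AE y in lborel. integrable lborel (\<lambda>z. case (y, z) of (y, z) \<Rightarrow> F y (y + z))"
      using lborel_pair.AE_integrable_fst[OF iF] by eventually_elim (auto intro: integrable_shift(1))
  qed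
  note iFs = this
  have "second_diff ?w x z / norm z powr ?p = - (\<integral>y. F y (y + z) \<partial>lborel)" for z
  proof -
    have e1: "(\<integral>y. u y * \<phi> y \<partial>lborel) = ?w x" by (simp add: mollify_def \<phi>_def)
    have e2: "(\<integral>y. u (y + z) * \<phi> (y + z) \<partial>lborel) = ?w x"
      using integral_shift(2)[of "\<lambda>y. u y * \<phi> y" z] e1 by simp
    have e3: "(\<integral>y. u y * \<phi> (y + z) \<partial>lborel) = ?w (x - z)" by (simp add: mollify_def \<phi>_def algebra_simps)
    have e4: "(\<integral>y. u (y + z) * \<phi> y \<partial>lborel) = ?w (x + z)"
      using integral_shift(2)[of "\<lambda>y. u y * \<phi> (y - z)" z] by (simp add: mollify_def \<phi>_def algebra_simps)
    note im = integrable_mollify[OF s(1) \<rho> u int]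
    have i1: "integrable lborel (\<lambda>y. u y * \<phi> y)" unfolding \<phi>_def by (rule im)
    have i2: "integrable lborel (\<lambda>y. u (y + z) * \<phi> (y + z))" by (rule integrable_shift(2)[OF i1])
    have i3: "integrable lborel (\<lambda>y. u y * \<phi> (y + z))" using im[of "x - z"] by (simp add: \<phi>_def algebra_simps)
    have i4: "integrable lborel (\<lambda>y. u (y + z) * \<phi> y)"
      using integrable_shift(2)[OF im[of "x + z"], of z] by (simp add: \<phi>_def algebra_simps)
    have "(\<integral>y. F y (y + z) \<partial>lborel) = (\<integral>y. u y * \<phi> y - u y * \<phi> (y + z) - u (y + z) * \<phi> y + u (y + z) * \<phi> (y + z) \<partial>lborel) / norm z powr ?p"
      unfolding integral_divide_zero[symmetric] by (intro Bochner_Integration.integral_cong) (auto simp: F_def algebra_simps)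
    also have "\<dots> = (2 * ?w x - ?w (x - z) - ?w (x + z)) / norm z powr ?p"
      using i1 i2 i3 i4 by (simp add: e1 e2 e3 e4)
    also have "\<dots> = - (second_diff ?w x z / norm z powr ?p)"
      unfolding second_diff_def minus_divide_left by simp
    finally show ?thesis by simp
  qed
  moreover have "integrable lborel (\<lambda>z. \<integral>y. F y (y + z) \<partial>lborel)"
    using lborel_pair.integrable_snd[OF iFs] by simp
  moreover have "(\<integral>z. (\<integral>y. F y (y + z) \<partial>lborel) \<partial>lborel) = (\<integral>y. (\<integral>z. F y (y + z) \<partial>lborel) \<partial>lborel)"
    by (rule lborel_pair.Fubini_integral[OF iFs])
  moreover have "\<dots> = (\<integral>z. energy_kernel s u (\<lambda>y. mollifier \<rho> (y - x)) z \<partial>(lborel \<Otimes>\<^sub>M lborel))"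
    unfolding shift F_eq by (rule lborel_pair.integral_fst[OF iF])
  ultimately show ?thesis
    using nonneg unfolding superharmonic_at_def by simp
qed

subsection \<open>Averages over small scales\<close>

text \<open>Compactness is needed later for two reasons: points off the set keep a positive distance
  from it, and balls of a common radius about its points fit into an open superset.\<close>

lemma compact_subset_pos_measure:
  fixes A :: "'a::euclidean_space set"
  assumes A: "A \<in> sets borel" and pos: "emeasure lborel A \<noteq> 0"
  shows "\<exists>K. compact K \<and> K \<subseteq> A \<and> emeasure lborel K \<noteq> 0"
proof -
  obtain n :: nat where n: "emeasure lborel (A \<inter> cball 0 n) \<noteq> 0"
  proof (rule ccontr)
    assume "\<not> thesis"
    then have "\<And>n::nat. A \<inter> cball 0 n \<in> null_sets lborel" using that A by (auto simp: null_sets_def)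
    then have "(\<Union>n::nat. A \<inter> cball 0 n) \<in> null_sets lborel" by (rule null_sets_UN)
    moreover have "(\<Union>n::nat. A \<inter> cball 0 n) = A"
      using real_arch_simple by (auto simp: dist_norm)
    ultimately show False using pos by (simp add: null_sets_def)
  qed
  define B where "B = A \<inter> cball 0 (real n)"
  have B: "B \<in> sets borel" using A by (simp add: B_def)
  have "emeasure lborel B \<le> emeasure lborel (cball (0::'a) n)" using B by (intro emeasure_mono) (auto simp: B_def)
  then have fin: "emeasure lborel B < \<infinity>" by (simp add: emeasure_cball le_less_trans)
  define e where "e = measure lborel B"
  have e: "0 < e" "emeasure lborel B = ennreal e"
    using n fin by (auto simp: e_def B_def[symmetric] emeasure_eq_ennreal_measure zero_less_measure_iff)
  have "B \<in> sets lebesgue" using B by simp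
  then obtain T where T: "closed T" "T \<subseteq> B" "B - T \<in> lmeasurable" "emeasure lebesgue (B - T) < ennreal e"
    using e(1) by (rule sets_lebesgue_inner_closed)
  have Tb: "T \<in> sets borel" using T by simp
  have "emeasure lborel T \<noteq> 0"
  proof
    assume "emeasure lborel T = 0"
    then have "emeasure lborel (B - T) = emeasure lborel B" using Tb B T(2) by (subst emeasure_Diff) auto
    then show False using T(4) e(2) B Tb by (simp add: emeasure_completion)
  qed
  moreover have "compact T" using T(1,2) unfolding compact_eq_bounded_closed B_def
    by (auto intro: bounded_subset[OF bounded_cball[of 0 "real n"]])
  ultimately show ?thesis using T(2) by (auto simp: B_def)
qed

text \<open>
  Integrating the averages over \<open>K\<close> and exchanging the integrals tests \<open>f\<close> against kernels that are bounded
  on \<open>K\<close>, where \<open>f\<close> vanishes, and tend to zero off \<open>K\<close>. This replaces the Lebesgue density theorem.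
\<close>

lemma eventually_exists_small_average:
  fixes K :: "'a::euclidean_space set" and R :: "nat \<Rightarrow> real"
  assumes s: "0 < s" and K: "compact K" "emeasure lborel K \<noteq> 0"
    and f [measurable]: "f \<in> borel_measurable borel" and int: "integrable lborel (\<lambda>y. f y * kern s 1 y)"
    and f_nonneg: "\<And>y. 0 \<le> f y" and f_0: "\<And>y. y \<in> K \<Longrightarrow> f y = 0"
    and R: "\<And>n. 0 < R n" "\<And>n. R n \<le> 1" "R \<longlonglongrightarrow> 0" and e: "0 < e"
  shows "\<forall>\<^sub>F n in sequentially. \<exists>x\<in>K. R n powr (2 * s) * (\<integral>y. f y * kern s (R n) (y - x) \<partial>lborel) < e"
proof -
  let ?p = "real DIM('a) + 2 * s"
  have Kb [measurable]: "K \<in> sets borel" using K(1) by (simp add: borel_compact)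
  obtain r0 where r0: "\<And>x. x \<in> K \<Longrightarrow> norm x \<le> r0" using compact_imp_bounded[OF K(1)] by (auto simp: bounded_iff)
  define r where "r = max 1 r0"
  have r: "1 \<le> r" "\<And>x. x \<in> K \<Longrightarrow> norm x \<le> r" using r0 by (auto simp: r_def intro: le_max_iff_disj[THEN iffD2])
  have fin: "emeasure lborel K < \<infinity>" using emeasure_bounded_finite[OF compact_imp_bounded[OF K(1)]] .
  have iK: "integrable lborel (indicator K :: 'a \<Rightarrow> real)" using Kb fin by (intro integrable_real_indicator) auto
  define m where "m = measure lborel K"
  have m: "0 < m" using K(2) fin by (simp add: m_def measure_def enn2real_positive_iff zero_less_iff_neq_zero less_top)
  define \<psi> where "\<psi> n y = R n powr (2 * s) * (\<integral>x. indicator K x * kern s (R n) (y - x) \<partial>lborel)" for n y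
  have ik: "integrable lborel (\<lambda>x. indicator K x * kern s (R n) (y - x))" for n y
  proof (rule Bochner_Integration.integrable_bound)
    show "integrable lborel (\<lambda>x. kern s (R n) (y - x))" by (rule integrable_shift(4)[OF integrable_kern[OF R(1) s]])
  qed (auto simp: indicator_def)
  have \<psi>_nonneg: "0 \<le> \<psi> n y" for n y by (simp add: \<psi>_def)
  have [measurable]: "\<psi> n \<in> borel_measurable borel" for n unfolding \<psi>_def[abs_def] by measurable
  have Rs: "R n powr (2 * s) \<le> 1" for n using R s by (intro powr_le1) (auto simp: less_imp_le)
  define \<kappa> where "\<kappa> = (\<integral>z. kern s 1 (z::'a) \<partial>lborel)"
  \<comment> \<open>The two summands belong to two ranges of y. For |y| at most 2 r,
    \<open>\<psi> n y\<close> is at most the full normalised mass \<kappa>, while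
    \<open>kern s 1 y\<close> is at least (2 r)^-(n+2s). Beyond, |y - x| is at least |y| / 2 for
    every x in \<open>K\<close>.\<close>
  define C where "C = \<kappa> * (2 * r) powr ?p + 2 powr ?p * m"
  have \<kappa>: "0 \<le> \<kappa>" by (simp add: \<kappa>_def)
  have bound: "\<psi> n y \<le> R n powr (2 * s) * (b * m)" if "\<And>x. x \<in> K \<Longrightarrow> kern s (R n) (y - x) \<le> b" for n y b
  proof -
    have "(\<integral>x. indicator K x * kern s (R n) (y - x) \<partial>lborel) \<le> (\<integral>x. b * indicator K x \<partial>lborel)"
    proof (intro integral_mono ik)
      show "integrable lborel (\<lambda>x. b * indicator K x)" using iK by simp
    qed (use that in \<open>auto simp: indicator_def\<close>)
    also have "\<dots> = b * m" by (simp add: m_def)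
    finally show ?thesis unfolding \<psi>_def by (rule mult_left_mono) simp
  qed
  have dom: "\<psi> n y \<le> C * kern s 1 y" for n y
  proof (cases "norm y \<le> 2 * r")
    case True
    have "(\<integral>x. indicator K x * kern s (R n) (y - x) \<partial>lborel) \<le> (\<integral>x. kern s (R n) (y - x) \<partial>lborel)"
      by (intro integral_mono ik integrable_shift(4)[OF integrable_kern[OF R(1) s]]) (auto simp: indicator_def)
    also have "\<dots> = (\<integral>x. kern s (R n) (x::'a) \<partial>lborel)" by (rule integral_shift(4)) simp
    also have "\<dots> = R n powr (- 2 * s) * \<kappa>" unfolding \<kappa>_def by (rule integral_kern[OF R(1) s])
    finally have "\<psi> n y \<le> R n powr (2 * s) * (R n powr (- 2 * s) * \<kappa>)" unfolding \<psi>_def by (rule mult_left_mono) simp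
    also have "\<dots> = \<kappa>" using R(1)[of n] by (simp add: mult.assoc[symmetric] powr_add[symmetric])
    also have "\<dots> \<le> \<kappa> * ((2 * r) powr ?p * kern s 1 y)"
    proof -
      have "1 = (2 * r) powr ?p * (2 * r) powr - ?p" unfolding powr_add[symmetric] using r by simp
      also have "\<dots> \<le> (2 * r) powr ?p * kern s 1 y"
        unfolding kern_def using True r s by (intro mult_left_mono powr_mono2') auto
      finally show ?thesis using \<kappa> mult_left_mono by fastforce
    qed
    also have "\<dots> \<le> C * kern s 1 y" using m by (simp add: C_def distrib_right)
    finally show ?thesis .
  next
    case False
    have "kern s (R n) (y - x) \<le> 2 powr ?p * kern s 1 y" if "x \<in> K" for x
    proof (rule kern_compare)
      have "norm y \<le> norm (y - x) + norm x" using norm_triangle_sub[of y x] by linarith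
      then have "norm y \<le> 2 * norm (y - x)" using r(2)[OF that] False by linarith
      then show "max 1 (norm y) \<le> 2 * max (R n) (norm (y - x))" using False r(1) by auto
    qed (use s R in auto)
    then have "\<psi> n y \<le> R n powr (2 * s) * ((2 powr ?p * kern s 1 y) * m)" by (rule bound)
    also have "\<dots> \<le> 1 * ((2 powr ?p * kern s 1 y) * m)" using m Rs by (intro mult_right_mono) auto
    also have "\<dots> \<le> C * kern s 1 y" using \<kappa> by (simp add: C_def algebra_simps)
    finally show ?thesis .
  qed
  \<comment> \<open>At a point off the closed set \<open>K\<close> the kernels stay bounded on
    \<open>K\<close>, while the normalising factor R^(2s) tends to 0.\<close>
  have lim: "(\<lambda>n. \<psi> n y) \<longlonglongrightarrow> 0" if "y \<notin> K" for y
  proof -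
    have "open (- K)" using compact_imp_closed[OF K(1)] by (simp add: open_Compl)
    from openE[OF this, of y] that obtain d where d: "0 < d" "ball y d \<subseteq> - K" by auto
    have "kern s (R n) (y - x) \<le> d powr - ?p" if "x \<in> K" for n x
    proof -
      have "x \<notin> ball y d" using d(2) that by blast
      then have "d \<le> max (R n) (norm (y - x))" by (auto simp: dist_norm)
      then show ?thesis unfolding kern_def using d s by (intro powr_mono2') auto
    qed
    then have up: "\<psi> n y \<le> R n powr (2 * s) * (d powr - ?p * m)" for n by (rule bound)
    have "(\<lambda>n. R n powr (2 * s)) \<longlonglongrightarrow> 0 powr (2 * s)"
      using R s by (intro tendsto_powr' tendsto_const) (auto simp: less_imp_le)
    then have "(\<lambda>n. R n powr (2 * s) * (d powr - ?p * m)) \<longlonglongrightarrow> 0 * (d powr - ?p * m)"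
      by (intro tendsto_mult tendsto_const) simp
    then have "(\<lambda>n. R n powr (2 * s) * (d powr - ?p * m)) \<longlonglongrightarrow> 0" by simp
    then show ?thesis
      using \<psi>_nonneg up by (intro tendsto_sandwich[OF _ _ tendsto_const, of 0 "\<lambda>n. \<psi> n y"]) auto
  qed
  have "(\<lambda>n. \<integral>y. f y * \<psi> n y \<partial>lborel) \<longlonglongrightarrow> (\<integral>y. 0 \<partial>(lborel :: 'a measure))"
  proof (rule integral_dominated_convergence)
    show "integrable lborel (\<lambda>y. C * (f y * kern s 1 y))" using int by simp
    show "AE y in lborel. (\<lambda>n. f y * \<psi> n y) \<longlonglongrightarrow> 0"
    proof (intro AE_I2)
      fix y show "(\<lambda>n. f y * \<psi> n y) \<longlonglongrightarrow> 0"
        using tendsto_mult_right_zero[OF lim[of y], of "f y"] f_0[of y] by (cases "y \<in> K") auto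
    qed
    show "AE y in lborel. norm (f y * \<psi> n y) \<le> C * (f y * kern s 1 y)" for n
    proof (intro AE_I2)
      fix y show "norm (f y * \<psi> n y) \<le> C * (f y * kern s 1 y)"
        using mult_left_mono[OF dom[of n y] f_nonneg[of y]] \<psi>_nonneg[of n y] f_nonneg[of y]
        by (simp add: mult_ac abs_mult)
    qed
  qed measurable
  then have "(\<lambda>n. \<integral>y. f y * \<psi> n y \<partial>lborel) \<longlonglongrightarrow> 0" by simp
  then have "\<forall>\<^sub>F n in sequentially. (\<integral>y. f y * \<psi> n y \<partial>lborel) < e * m"
    using e m by (intro order_tendstoD(2)) auto
  then show ?thesis
  proof eventually_elim
    case (elim n)
    show ?case
    proof (rule ccontr)
      assume "\<not> ?case"
      then have ge: "e \<le> R n powr (2 * s) * (\<integral>y. f y * kern s (R n) (y - x) \<partial>lborel)" if "x \<in> K" for x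
        using that by (simp add: not_less)
      define H where "H x y = indicator K x * (f y * kern s (R n) (y - x))" for x y
      have iH: "integrable (lborel \<Otimes>\<^sub>M lborel) (\<lambda>(x, y). H x y)"
      proof (rule Bochner_Integration.integrable_bound)
        let ?c = "((1 + r) / R n + 1) powr ?p"
        show "integrable (lborel \<Otimes>\<^sub>M lborel) (\<lambda>z. ?c * (case z of (x, y) \<Rightarrow> indicator K x * (f y * kern s 1 y)))"
          using integrable_pair_mult_shift(3)[OF iK int] by simp
        have "\<bar>H x y\<bar> \<le> ?c * (indicator K x * (f y * kern s 1 y))" for x y
        proof (cases "x \<in> K")
          case True
          have "kern s (R n) (y - x) \<le> ((1 + norm x) / R n + 1) powr ?p * kern s 1 y"
            by (rule kern_shift_compare[OF s R(1)])
          also have "\<dots> \<le> ?c * kern s 1 y"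
            using r(2)[OF True] R(1)[of n] s by (intro mult_right_mono powr_mono2) (auto intro!: divide_right_mono add_nonneg_nonneg)
          finally show ?thesis using True mult_left_mono[of _ _ "f y"] f_nonneg[of y] by (simp add: H_def abs_mult mult.left_commute)
        qed (simp add: H_def)
        then show "AE z in lborel \<Otimes>\<^sub>M lborel. norm (case z of (x, y) \<Rightarrow> H x y)
          \<le> norm (?c * (case z of (x, y) \<Rightarrow> indicator K x * (f y * kern s 1 y)))"
          by (intro AE_I2) (simp add: case_prod_unfold abs_mult f_nonneg)
      qed (unfold H_def, measurable)
      have "e * m = (\<integral>x. e * indicator K x \<partial>lborel)" by (simp add: m_def)
      also have "\<dots> \<le> (\<integral>x. R n powr (2 * s) * (\<integral>y. H x y \<partial>lborel) \<partial>lborel)"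
      proof (rule integral_mono)
        show "integrable lborel (\<lambda>x. e * indicator K x)" using iK by simp
        show "integrable lborel (\<lambda>x. R n powr (2 * s) * (\<integral>y. H x y \<partial>lborel))"
          using lborel_pair.integrable_fst[OF iH] by simp
      qed (use ge in \<open>auto simp: H_def indicator_def\<close>)
      also have "\<dots> = R n powr (2 * s) * (\<integral>y. \<integral>x. H x y \<partial>lborel \<partial>lborel)"
        using lborel_pair.Fubini_integral[OF iH] by simp
      also have "\<dots> = (\<integral>y. R n powr (2 * s) * (\<integral>x. H x y \<partial>lborel) \<partial>lborel)" by simp
      also have "\<dots> = (\<integral>y. f y * \<psi> n y \<partial>lborel)"
      proof (intro Bochner_Integration.integral_cong refl)
        fix y
        have "(\<integral>x. H x y \<partial>lborel) = f y * (\<integral>x. indicator K x * kern s (R n) (y - x) \<partial>lborel)"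
          unfolding integral_mult_right_zero[symmetric] by (intro Bochner_Integration.integral_cong) (auto simp: H_def)
        then show "R n powr (2 * s) * (\<integral>x. H x y \<partial>lborel) = f y * \<psi> n y" by (simp add: \<psi>_def)
      qed
      finally show False using elim by simp
    qed
  qed
qed

text \<open>This replaces almost everywhere convergence of mollifications. If \<open>u\<close> is at
  most m - d on a compact set of positive measure, a nonnegative function that dominates u - m + d
  and vanishes on this set has a small average at one of its points, and there the mollification of
  \<open>u\<close> would fall below \<open>m\<close>.\<close>

lemma AE_ge_of_mollify_ge:
  fixes u :: "'a::euclidean_space \<Rightarrow> real"
  assumes s: "0 < s" and u [measurable]: "u \<in> borel_measurable borel" and int: "integrable lborel (\<lambda>y. u y * kern s 1 y)"
    and U: "open U" and \<rho>: "\<And>n. 0 < \<rho> n" "\<And>n. \<rho> n \<le> 1" "\<rho> \<longlonglongrightarrow> 0"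
    and ge: "\<And>n x. x \<in> U \<Longrightarrow> m \<le> mollify (\<rho> n) u x"
  shows "AE y in lborel. y \<in> U \<longrightarrow> m \<le> u y"
proof -
  have Ub [measurable]: "U \<in> sets borel" using U by simp
  define A where "A j = {y \<in> U. u y \<le> m - 1 / real (Suc j)}" for j
  have A [measurable]: "A j \<in> sets borel" for j unfolding A_def by measurable
  have "emeasure lborel (A j) = 0" for j
  proof (rule ccontr)
    assume "emeasure lborel (A j) \<noteq> 0"
    then obtain K where K: "compact K" "K \<subseteq> A j" "emeasure lborel K \<noteq> 0"
      using compact_subset_pos_measure[OF A] by blast
    define d where "d = 1 / real (Suc j)"
    have d: "0 < d" by (simp add: d_def)
    have [measurable]: "K \<in> sets borel" using K(1) by (simp add: borel_compact)
    \<comment> \<open>Off \<open>K\<close> the second summand supplies the missing \<open>d\<close>;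
      on \<open>K\<close> both summands vanish, and u - m + d is at most 0 there.\<close>
    define f where "f y = max 0 (u y - m) + d * indicator (- K) y" for y
    have f [measurable]: "f \<in> borel_measurable borel" unfolding f_def[abs_def] by measurable
    have f_nonneg: "0 \<le> f y" for y using d by (simp add: f_def)
    have uK: "u y \<le> m - d" if "y \<in> K" for y using that K(2) by (auto simp: A_def d_def)
    have f_0: "f y = 0" if "y \<in> K" for y using that uK[OF that] d by (simp add: f_def)
    have f_ge: "u y - m \<le> f y - d" for y
      using uK[of y] f_0[of y] by (cases "y \<in> K") (auto simp: f_def)
    have ik: "integrable lborel (kern s 1 :: 'a \<Rightarrow> real)" by (rule integrable_kern[OF _ s]) simp
    have iu: "integrable lborel (\<lambda>y. (u y - m) * kern s 1 y)" using int ik by (simp add: left_diff_distrib)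
    have "integrable lborel (\<lambda>y. \<bar>(u y - m) * kern s 1 y\<bar> + d * kern s 1 y)"
      using iu ik by simp
    then have fi: "integrable lborel (\<lambda>y. f y * kern s 1 y)"
    proof (rule Bochner_Integration.integrable_bound)
      have "f y \<le> \<bar>u y - m\<bar> + d" for y using d by (auto simp: f_def indicator_def)
      then have "f y * kern s 1 y \<le> (\<bar>u y - m\<bar> + d) * kern s 1 y" for y by (rule mult_right_mono) simp
      then show "AE y in lborel. norm (f y * kern s 1 y) \<le> norm (\<bar>(u y - m) * kern s 1 y\<bar> + d * kern s 1 y)"
        using f_nonneg d by (simp add: abs_mult distrib_right)
    qed measurable
    define M where "M = 1 / bump_mass TYPE('a)"
    have M: "0 < M" using bump_mass_pos[where 'a = 'a] by (simp add: M_def)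
    \<comment> \<open>The threshold d / M keeps the mollification of \<open>f\<close> below
      \<open>d\<close>, since the mollifier is at most \<open>M\<close> times the normalised
      kernel.\<close>
    have "\<forall>\<^sub>F n in sequentially. \<exists>x\<in>K. \<rho> n powr (2 * s) * (\<integral>y. f y * kern s (\<rho> n) (y - x) \<partial>lborel) < d / M"
      by (rule eventually_exists_small_average[OF s K(1,3) f fi f_nonneg f_0 \<rho>]) (use d M in auto)
    then obtain n x where x: "x \<in> K" and small: "\<rho> n powr (2 * s) * (\<integral>y. f y * kern s (\<rho> n) (y - x) \<partial>lborel) < d / M"
      by (auto simp: eventually_sequentially)
    note im = integrable_mollify[OF s \<rho>(1)]
    have "0 \<le> mollify (\<rho> n) u x - m" using ge[of x n] x K(2) by (auto simp: A_def)
    also have "\<dots> = (\<integral>y. (u y - m) * mollifier (\<rho> n) (y - x) \<partial>lborel)"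
      using mollify_minus_const[OF s \<rho>(1)[of n] u int, of m x] by (simp add: mollify_def)
    also have "\<dots> \<le> (\<integral>y. f y * mollifier (\<rho> n) (y - x) - d * mollifier (\<rho> n) (y - x) \<partial>lborel)"
    proof (rule integral_mono)
      show "integrable lborel (\<lambda>y. (u y - m) * mollifier (\<rho> n) (y - x))" by (rule im[OF _ iu]) measurable
      show "integrable lborel (\<lambda>y. f y * mollifier (\<rho> n) (y - x) - d * mollifier (\<rho> n) (y - x))"
        using im[OF f fi, of n x] integrable_shift(3)[OF integrable_mollifier[OF \<rho>(1)[of n]], of x] by simp
      show "(u y - m) * mollifier (\<rho> n) (y - x) \<le> f y * mollifier (\<rho> n) (y - x) - d * mollifier (\<rho> n) (y - x)" for y
        unfolding left_diff_distrib[of "f y", symmetric] using f_ge \<rho>(1)[of n] by (intro mult_right_mono) auto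
    qed
    also have "\<dots> = (\<integral>y. f y * mollifier (\<rho> n) (y - x) \<partial>lborel) - d"
      using im[OF f fi, of n x] integrable_shift(3)[OF integrable_mollifier[OF \<rho>(1)[of n]], of x]
        integral_shift(3)[of "mollifier (\<rho> n)" x] integral_mollifier[OF \<rho>(1)[of n], where 'a = 'a] by simp
    also have "\<dots> \<le> (\<integral>y. M * \<rho> n powr (2 * s) * (f y * kern s (\<rho> n) (y - x)) \<partial>lborel) - d"
    proof (intro diff_right_mono integral_mono)
      show "integrable lborel (\<lambda>y. M * \<rho> n powr (2 * s) * (f y * kern s (\<rho> n) (y - x)))"
        using integrable_weighted[OF s \<rho>(1) f fi] by simp
      show "integrable lborel (\<lambda>y. f y * mollifier (\<rho> n) (y - x))" by (rule im[OF f fi])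
      show "f y * mollifier (\<rho> n) (y - x) \<le> M * \<rho> n powr (2 * s) * (f y * kern s (\<rho> n) (y - x))" for y
        using mult_left_mono[OF mollifier_le_kern[OF \<rho>(1)[of n], of "y - x" s] f_nonneg[of y]] by (simp add: M_def mult_ac)
    qed
    also have "\<dots> = M * (\<rho> n powr (2 * s) * (\<integral>y. f y * kern s (\<rho> n) (y - x) \<partial>lborel)) - d" by simp
    also have "\<dots> < 0" using small M by (simp add: field_simps)
    finally show False by simp
  qed
  then have "AE y in lborel. \<forall>j. y \<notin> A j"
    unfolding AE_all_countable using A by (auto intro!: AE_not_in simp: null_sets_def)
  then show ?thesis
  proof eventually_elim
    case (elim y)
    show ?case
    proof (intro impI, rule ccontr)
      assume "y \<in> U" "\<not> m \<le> u y"
      moreover obtain j where "inverse (real (Suc j)) < m - u y" using reals_Archimedean[of "m - u y"] \<open>\<not> m \<le> u y\<close> by auto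
      ultimately have "y \<in> A j" by (simp add: A_def inverse_eq_divide)
      then show False using elim by simp
    qed
  qed
qed

text \<open>The mollifier has radius \<rho>, but the ball of radius 2 \<rho> has to fit into
  \<open>\<Omega>\<close>, since the energy near the diagonal is controlled on that larger
  ball.\<close>

definition weakly_superharmonic :: "real \<Rightarrow> 'a::euclidean_space set \<Rightarrow> ('a \<Rightarrow> real) \<Rightarrow> bool" where
  "weakly_superharmonic s \<Omega> u \<longleftrightarrow>
    (\<forall>\<rho> x. 0 < \<rho> \<longrightarrow> cball x (2 * \<rho>) \<subseteq> \<Omega> \<longrightarrow> superharmonic_at s (mollify \<rho> u) x)"

lemma superharmonic_at_diff_const: "superharmonic_at s (\<lambda>x. w x - c) x \<longleftrightarrow> superharmonic_at s w x"
proof -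
  have "second_diff (\<lambda>x. w x - c) x = second_diff w x" by (auto simp: second_diff_def)
  then show ?thesis by (simp add: superharmonic_at_def)
qed

lemma
  fixes f :: "'a::euclidean_space \<Rightarrow> real"
  assumes s: "0 < s" and \<rho>: "0 < \<rho>" "\<rho> \<le> R" and f: "f \<in> borel_measurable borel"
    and int: "integrable lborel (\<lambda>y. f y * kern s 1 y)" and f_nonneg: "\<And>y. 0 \<le> f y"
  shows integral_mollify_kern_le:
      "(\<integral>x. mollify \<rho> f x * kern s R (x - x0) \<partial>lborel)
        \<le> 2 powr (real DIM('a) + 2 * s) * (\<integral>y. f y * kern s R (y - x0) \<partial>lborel)"
    and integral_mollify_kern_ge:
      "(\<integral>y. f y * kern s R (y - x0) \<partial>lborel)
        \<le> 2 powr (real DIM('a) + 2 * s) * (\<integral>x. mollify \<rho> f x * kern s R (x - x0) \<partial>lborel)"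
proof -
  have R: "0 < R" using \<rho> by simp
  have nn: "0 \<le> mollify \<rho> f x" for x
    unfolding mollify_def using f_nonneg \<rho> by simp
  have e1: "(\<integral>\<^sup>+y. ennreal (f y) * kern s R (y - x0) \<partial>lborel) = ennreal (\<integral>y. f y * kern s R (y - x0) \<partial>lborel)"
    using integrable_weighted[OF s R f int, of x0] f_nonneg
    by (simp add: ennreal_mult[symmetric] nn_integral_eq_integral)
  have "(\<integral>\<^sup>+x. (\<integral>\<^sup>+y. ennreal (f y) * mollifier \<rho> (y - x) \<partial>lborel) * kern s R (x - x0) \<partial>lborel)
    = (\<integral>\<^sup>+x. ennreal (mollify \<rho> f x * kern s R (x - x0)) \<partial>lborel)"
    using ennreal_mollify_nonneg[OF s \<rho>(1) f int f_nonneg] nn by (simp add: ennreal_mult)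
  also have "\<dots> = ennreal (\<integral>x. mollify \<rho> f x * kern s R (x - x0) \<partial>lborel)"
    using integrable_mollify_weighted[OF s \<rho> f int, of x0] nn by (simp add: nn_integral_eq_integral)
  finally have e2: "(\<integral>\<^sup>+x. (\<integral>\<^sup>+y. ennreal (f y) * mollifier \<rho> (y - x) \<partial>lborel) * kern s R (x - x0) \<partial>lborel)
    = ennreal (\<integral>x. mollify \<rho> f x * kern s R (x - x0) \<partial>lborel)" .
  have fe: "(\<lambda>y. ennreal (f y)) \<in> borel_measurable borel" using f by simp
  show "(\<integral>x. mollify \<rho> f x * kern s R (x - x0) \<partial>lborel)
        \<le> 2 powr (real DIM('a) + 2 * s) * (\<integral>y. f y * kern s R (y - x0) \<partial>lborel)"
    using nn_integral_mollify_kern_le[OF s \<rho> fe, of x0] f_nonneg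
    unfolding e1 e2 by (simp add: ennreal_mult[symmetric] ennreal_le_iff)
  show "(\<integral>y. f y * kern s R (y - x0) \<partial>lborel)
        \<le> 2 powr (real DIM('a) + 2 * s) * (\<integral>x. mollify \<rho> f x * kern s R (x - x0) \<partial>lborel)"
    using nn_integral_mollify_kern_ge[OF s \<rho> fe, of x0] nn
    unfolding e1 e2 by (simp add: ennreal_mult[symmetric] ennreal_le_iff)
qed

section \<open>Lower bounds almost everywhere for the function itself\<close>

lemma vanishing_scales:
  fixes r :: real
  assumes "0 < r"
  obtains \<rho> :: "nat \<Rightarrow> real" where "\<And>n. 0 < \<rho> n" "\<And>n. \<rho> n \<le> 1" "\<And>n. \<rho> n \<le> r" "\<rho> \<longlonglongrightarrow> 0"
proof
  let ?\<rho> = "\<lambda>n. min 1 r * inverse (real (Suc n))"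
  have i: "inverse (real (Suc n)) \<le> 1" for n by (simp add: inverse_eq_divide)
  show "0 < ?\<rho> n" for n using assms by simp
  have "?\<rho> n \<le> min 1 r" for n using mult_left_mono[OF i, of "min 1 r"] assms by simp
  then show "?\<rho> n \<le> 1" "?\<rho> n \<le> r" for n by (meson min.boundedE)+
  show "?\<rho> \<longlonglongrightarrow> 0" using tendsto_mult_right_zero[OF LIMSEQ_inverse_real_of_nat] by simp
qed

text \<open>The negative part of a mollification is at most the mollification of the negative part,
  whose weighted integral is at most a fixed multiple of the original one; so the bound for
  mollifications of u - l passes to u. \<open>C\<close> depends on neither \<open>R\<close> nor
  \<open>l\<close>: later \<open>R\<close> tends to 0 at a fixed level.\<close>

lemma weakly_superharmonic_lower_bound:
  assumes s: "0 < s" "s < 1"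
  shows "\<exists>C>0. \<forall>(u :: 'a::euclidean_space \<Rightarrow> real) \<Omega> x0 R l.
    0 < R \<longrightarrow> u \<in> borel_measurable borel \<longrightarrow> integrable lborel (\<lambda>y. u y * kern s 1 y) \<longrightarrow>
    weakly_superharmonic s \<Omega> u \<longrightarrow> cball x0 (2 * R) \<subseteq> \<Omega> \<longrightarrow>
    (AE y in lborel. y \<in> ball x0 (R / 2) \<longrightarrow>
      l - C * (R powr (2 * s) * (\<integral>y. max 0 (l - u y) * kern s R (y - x0) \<partial>lborel)) \<le> u y)"
proof -
  let ?p = "real DIM('a) + 2 * s"
  obtain C where C: "0 < C" and bound: "\<And>(w :: 'a \<Rightarrow> real) x0 R x.
    0 < R \<Longrightarrow> continuous_on UNIV w \<Longrightarrow> integrable lborel (\<lambda>y. w y * kern s 1 y) \<Longrightarrow>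
    (\<forall>x\<in>ball x0 R. superharmonic_at s w x) \<Longrightarrow> x \<in> ball x0 (R / 2) \<Longrightarrow>
    - w x \<le> C * R powr (2 * s) * (\<integral>y. max 0 (- w y) * kern s R (y - x0) \<partial>lborel)"
    using superharmonic_lower_bound[OF s, where 'a = 'a] by blast
  show ?thesis
  proof (rule exI[of _ "C * 2 powr ?p"], intro conjI allI impI)
    show "0 < C * 2 powr ?p" using C by simp
    fix u :: "'a \<Rightarrow> real" and \<Omega> x0 l and R :: real
    assume R: "0 < R" and u [measurable]: "u \<in> borel_measurable borel"
      and int: "integrable lborel (\<lambda>y. u y * kern s 1 y)"
      and super: "weakly_superharmonic s \<Omega> u" and sub: "cball x0 (2 * R) \<subseteq> \<Omega>"
    have ik: "integrable lborel (kern s 1 :: 'a \<Rightarrow> real)" by (rule integrable_kern[OF _ s(1)]) simp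
    define v where "v y = u y - l" for y
    have v [measurable]: "v \<in> borel_measurable borel" unfolding v_def[abs_def] by measurable
    have iv: "integrable lborel (\<lambda>y. v y * kern s 1 y)" using int ik by (simp add: v_def left_diff_distrib)
    define f where "f y = max 0 (l - u y)" for y
    have f [measurable]: "f \<in> borel_measurable borel" unfolding f_def[abs_def] by measurable
    have f_nonneg: "0 \<le> f y" for y by (simp add: f_def)
    have fi: "integrable lborel (\<lambda>y. f y * kern s 1 y)"
      by (rule Bochner_Integration.integrable_bound[OF iv]) (auto simp: f_def v_def abs_mult intro!: mult_right_mono AE_I2)
    define T where "T = (\<integral>y. f y * kern s R (y - x0) \<partial>lborel)"
    \<comment> \<open>With \<rho> at most R/2, balls of radius 2 \<rho> about points of the ball of
      radius R stay inside the ball of radius 2 R.\<close>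
    obtain \<rho> where \<rho>: "\<And>n. 0 < \<rho> n" "\<And>n. \<rho> n \<le> 1" "\<And>n. \<rho> n \<le> R / 2" "\<rho> \<longlonglongrightarrow> 0"
      using vanishing_scales[of "R / 2"] R by auto
    have ge: "- (C * 2 powr ?p * (R powr (2 * s) * T)) \<le> mollify (\<rho> n) v x" if x: "x \<in> ball x0 (R / 2)" for n x
    proof -
      let ?w = "mollify (\<rho> n) v"
      have \<rho>R: "\<rho> n \<le> R" using \<rho>(3)[of n] R by simp
      have w: "continuous_on UNIV ?w" by (rule continuous_on_mollify[OF s(1) \<rho>(1) v iv])
      then have [measurable]: "?w \<in> borel_measurable borel" by (rule borel_measurable_continuous_onI)
      have iw: "integrable lborel (\<lambda>y. ?w y * kern s R (y - x0))" for x0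
        by (rule integrable_mollify_weighted[OF s(1) \<rho>(1) \<rho>R v iv])
      have iw1: "integrable lborel (\<lambda>y. ?w y * kern s 1 y)"
        using integrable_mollify_weighted[OF s(1) \<rho>(1) \<rho>(2) v iv, of n 0] by simp
      have eq: "?w = (\<lambda>x. mollify (\<rho> n) u x - l)"
        unfolding v_def by (rule ext, rule mollify_minus_const[OF s(1) \<rho>(1) u int])
      have "superharmonic_at s ?w z" if "z \<in> ball x0 R" for z
      proof -
        have "cball z (2 * \<rho> n) \<subseteq> cball x0 (2 * R)"
        proof
          fix y assume "y \<in> cball z (2 * \<rho> n)"
          then show "y \<in> cball x0 (2 * R)" using that \<rho>(3)[of n] dist_triangle[of x0 y z] by simp
        qed
        then show ?thesis
          using super sub \<rho>(1)[of n] unfolding eq superharmonic_at_diff_const weakly_superharmonic_def by blast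
      qed
      then have "- ?w x \<le> C * R powr (2 * s) * (\<integral>y. max 0 (- ?w y) * kern s R (y - x0) \<partial>lborel)"
        using bound[OF R w iw1 _ x] by blast
      also have "\<dots> \<le> C * R powr (2 * s) * (\<integral>y. mollify (\<rho> n) f y * kern s R (y - x0) \<partial>lborel)"
      proof (intro mult_left_mono integral_mono)
        show "integrable lborel (\<lambda>y. max 0 (- ?w y) * kern s R (y - x0))"
          by (rule Bochner_Integration.integrable_bound[OF iw[of x0]]) (auto simp: abs_mult intro!: mult_right_mono AE_I2)
        show "integrable lborel (\<lambda>y. mollify (\<rho> n) f y * kern s R (y - x0))"
          by (rule integrable_mollify_weighted[OF s(1) \<rho>(1) \<rho>R f fi])
        fix y
        have "integrable lborel (\<lambda>y. - v y * kern s 1 y)" using iv by simp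
        then have "mollify (\<rho> n) (\<lambda>y. - v y) y \<le> mollify (\<rho> n) f y"
          by (rule mollify_mono[OF s(1) \<rho>(1) _ _ f fi, rotated]) (auto simp: f_def v_def)
        moreover have "0 \<le> mollify (\<rho> n) f y" unfolding mollify_def using f_nonneg \<rho>(1)[of n] by simp
        ultimately have "max 0 (- ?w y) \<le> mollify (\<rho> n) f y" by (simp add: mollify_uminus)
        then show "max 0 (- ?w y) * kern s R (y - x0) \<le> mollify (\<rho> n) f y * kern s R (y - x0)"
          by (rule mult_right_mono) simp
      qed (use C in auto)
      also have "\<dots> \<le> C * R powr (2 * s) * (2 powr ?p * T)"
        unfolding T_def using C
        by (intro mult_left_mono integral_mollify_kern_le[OF s(1) \<rho>(1) \<rho>R f fi f_nonneg]) auto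
      finally show ?thesis by (simp add: mult_ac)
    qed
    have "AE y in lborel. y \<in> ball x0 (R / 2) \<longrightarrow> - (C * 2 powr ?p * (R powr (2 * s) * T)) \<le> v y"
      by (rule AE_ge_of_mollify_ge[OF s(1) v iv open_ball \<rho>(1,2,4) ge])
    then show "AE y in lborel. y \<in> ball x0 (R / 2) \<longrightarrow>
      l - C * 2 powr ?p * (R powr (2 * s) * (\<integral>y. max 0 (l - u y) * kern s R (y - x0) \<partial>lborel)) \<le> u y"
      by eventually_elim (auto simp: T_def f_def v_def)
  qed
qed

text \<open>The weighted integral of u - m is positive, because the kernel vanishes nowhere and u is
  not almost everywhere equal to m. The gain m' - m is a multiple of this integral, with a factor
  independent of the mollification.\<close>

lemma weakly_superharmonic_strict_lower_bound:
  fixes u :: "'a::euclidean_space \<Rightarrow> real"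
  assumes s: "0 < s" "s < 1" and R: "0 < R" and u [measurable]: "u \<in> borel_measurable borel"
    and int: "integrable lborel (\<lambda>y. u y * kern s 1 y)"
    and super: "weakly_superharmonic s \<Omega> u" and sub: "cball x0 (2 * R) \<subseteq> \<Omega>"
    and m: "AE y in lborel. m \<le> u y" and nonconst: "\<not> (AE y in lborel. u y = m)"
  shows "\<exists>m'>m. AE y in lborel. y \<in> ball x0 (R / 2) \<longrightarrow> m' \<le> u y"
proof -
  let ?p = "real DIM('a) + 2 * s"
  obtain c where c: "0 < c" and bound: "\<And>(w :: 'a \<Rightarrow> real) x0 x.
    continuous_on UNIV w \<Longrightarrow> (\<forall>x. 0 \<le> w x) \<Longrightarrow> integrable lborel (\<lambda>y. w y * kern s 1 y) \<Longrightarrow>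
    (\<forall>x\<in>ball x0 R. superharmonic_at s w x) \<Longrightarrow> x \<in> ball x0 (R / 2) \<Longrightarrow>
    c * (\<integral>y. w y * kern s R (y - x0) \<partial>lborel) \<le> w x"
    using nonneg_superharmonic_lower_bound[OF s R, where 'a = 'a] by blast
  have ik: "integrable lborel (kern s 1 :: 'a \<Rightarrow> real)" by (rule integrable_kern[OF _ s(1)]) simp
  have iv: "integrable lborel (\<lambda>y. (u y - m) * kern s 1 y)" using int ik by (simp add: left_diff_distrib)
  \<comment> \<open>The positive part differs from u - m only on a null set and has the same
    mollifications, but it is nonnegative at every point, as the kernel comparison for
    mollifications demands.\<close>
  define f where "f y = max 0 (u y - m)" for y
  have f [measurable]: "f \<in> borel_measurable borel" unfolding f_def[abs_def] by measurable
  have f_nonneg: "0 \<le> f y" for y by (simp add: f_def)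
  have fi: "integrable lborel (\<lambda>y. f y * kern s 1 y)"
    by (rule Bochner_Integration.integrable_bound[OF iv]) (auto simp: f_def abs_mult intro!: mult_right_mono AE_I2)
  have f_eq: "AE y in lborel. f y = u y - m" using m by eventually_elim (simp add: f_def)
  define T where "T = (\<integral>y. f y * kern s R (y - x0) \<partial>lborel)"
  have fiR: "integrable lborel (\<lambda>y. f y * kern s R (y - x0))" by (rule integrable_weighted[OF s(1) R f fi])
  have "T \<noteq> 0"
  proof
    assume "T = 0"
    then have "AE y in lborel. f y * kern s R (y - x0) = 0"
      unfolding T_def using fiR f_nonneg by (subst (asm) integral_nonneg_eq_0_iff_AE) auto
    with m have "AE y in lborel. u y = m"
    proof eventually_elim
      case (elim y)
      then show ?case using kern_pos[OF R, of s "y - x0"] by (simp add: f_def)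
    qed
    then show False using nonconst by contradiction
  qed
  moreover have "0 \<le> T" unfolding T_def using f_nonneg by simp
  ultimately have T: "0 < T" by simp
  obtain \<rho> where \<rho>: "\<And>n. 0 < \<rho> n" "\<And>n. \<rho> n \<le> 1" "\<And>n. \<rho> n \<le> R / 2" "\<rho> \<longlonglongrightarrow> 0"
    using vanishing_scales[of "R / 2"] R by auto
  have ge: "c * (2 powr - ?p * T) \<le> mollify (\<rho> n) f x" if x: "x \<in> ball x0 (R / 2)" for n x
  proof -
    let ?w = "mollify (\<rho> n) f"
    have \<rho>R: "\<rho> n \<le> R" using \<rho>(3)[of n] R by simp
    have w: "continuous_on UNIV ?w" by (rule continuous_on_mollify[OF s(1) \<rho>(1) f fi])
    have wpos: "\<forall>x. 0 \<le> ?w x" unfolding mollify_def using f_nonneg \<rho>(1)[of n] by simp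
    have iw1: "integrable lborel (\<lambda>y. ?w y * kern s 1 y)"
      using integrable_mollify_weighted[OF s(1) \<rho>(1) \<rho>(2) f fi, of n 0] by simp
    have eq: "?w = (\<lambda>x. mollify (\<rho> n) u x - m)"
    proof
      fix x
      have "?w x = mollify (\<rho> n) (\<lambda>y. u y - m) x"
        unfolding mollify_def using f_eq by (intro integral_cong_AE) auto
      then show "?w x = mollify (\<rho> n) u x - m" using mollify_minus_const[OF s(1) \<rho>(1) u int, of n m x] by simp
    qed
    have "superharmonic_at s ?w z" if "z \<in> ball x0 R" for z
    proof -
      have "cball z (2 * \<rho> n) \<subseteq> cball x0 (2 * R)"
      proof
        fix y assume "y \<in> cball z (2 * \<rho> n)"
        then show "y \<in> cball x0 (2 * R)" using that \<rho>(3)[of n] dist_triangle[of x0 y z] by simp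
      qed
      then show ?thesis
        using super sub \<rho>(1)[of n] unfolding eq superharmonic_at_diff_const weakly_superharmonic_def by blast
    qed
    then have "c * (\<integral>y. ?w y * kern s R (y - x0) \<partial>lborel) \<le> ?w x"
      using bound[OF w wpos iw1 _ x] by blast
    moreover have "2 powr - ?p * T \<le> 2 powr - ?p * (2 powr ?p * (\<integral>y. ?w y * kern s R (y - x0) \<partial>lborel))"
      unfolding T_def by (intro mult_left_mono integral_mollify_kern_ge[OF s(1) \<rho>(1) \<rho>R f fi f_nonneg]) simp
    moreover have "\<dots> = (\<integral>y. ?w y * kern s R (y - x0) \<partial>lborel)"
      unfolding mult.assoc[symmetric] powr_add[symmetric] by simp
    ultimately have "2 powr - ?p * T \<le> (\<integral>y. ?w y * kern s R (y - x0) \<partial>lborel)" by linarith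
    then have "c * (2 powr - ?p * T) \<le> c * (\<integral>y. ?w y * kern s R (y - x0) \<partial>lborel)"
      using c by (intro mult_left_mono) auto
    also have "\<dots> \<le> ?w x" by fact
    finally show ?thesis .
  qed
  have "AE y in lborel. y \<in> ball x0 (R / 2) \<longrightarrow> c * (2 powr - ?p * T) \<le> f y"
    by (rule AE_ge_of_mollify_ge[OF s(1) f fi open_ball \<rho>(1,2,4) ge])
  with f_eq have "AE y in lborel. y \<in> ball x0 (R / 2) \<longrightarrow> m + c * (2 powr - ?p * T) \<le> u y"
    by eventually_elim auto
  moreover have "m < m + c * (2 powr - ?p * T)" using c T by simp
  ultimately show ?thesis by blast
qed

subsection \<open>The lower semicontinuous representative\<close>

text \<open>The essential lower limit of \<open>u\<close> at \<open>x\<close>, written as the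
  supremum of all essential lower bounds on neighbourhoods. It is insensitive to null sets, equals
  +\<infinity> where these bounds are unlimited, and -\<infinity> where there are none.\<close>

definition lower_rep :: "('a::euclidean_space \<Rightarrow> real) \<Rightarrow> 'a \<Rightarrow> ereal" where
  "lower_rep u x = Sup {ereal m | m U. open U \<and> x \<in> U \<and> (AE y in lborel. y \<in> U \<longrightarrow> m \<le> u y)}"

lemma lower_rep_ge:
  assumes "open U" "x \<in> U" "AE y in lborel. y \<in> U \<longrightarrow> m \<le> u y"
  shows "ereal m \<le> lower_rep u x"
  unfolding lower_rep_def using assms by (intro Sup_upper) blast

lemma less_lower_repE:
  assumes "c < lower_rep u x"
  obtains m U where "c < ereal m" "open U" "x \<in> U" "AE y in lborel. y \<in> U \<longrightarrow> m \<le> u y"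
  using assms unfolding lower_rep_def less_Sup_iff by blast

text \<open>A bound m > c valid on \<open>U\<close> is a witness at every point of \<open>U\<close>.
  Lower semicontinuity is thus automatic; the work lies in showing that \<open>lower_rep u\<close>
  is a representative.\<close>

lemma open_lower_rep_gt: "open {x. c < lower_rep u x}"
proof (rule openI)
  fix x assume "x \<in> {x. c < lower_rep u x}"
  then obtain m U where U: "c < ereal m" "open U" "x \<in> U" "AE y in lborel. y \<in> U \<longrightarrow> m \<le> u y"
    using less_lower_repE[of c u x] by auto
  then obtain e where "0 < e" "ball x e \<subseteq> U" by (auto elim: openE)
  moreover have "c < lower_rep u y" if "y \<in> U" for y
    using U(1) lower_rep_ge[OF U(2) that U(4)] by (rule less_le_trans)
  ultimately show "\<exists>e>0. ball x e \<subseteq> {x. c < lower_rep u x}" by blast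
qed

lemma lsc_on_lower_rep: "lsc_on S (lower_rep u)"
  unfolding lsc_on_def le_Liminf_iff
proof (intro ballI allI impI)
  fix x c assume "c < lower_rep u x"
  then have "\<forall>\<^sub>F y in nhds x. y \<in> {y. c < lower_rep u y}"
    using eventually_nhds_in_open[OF open_lower_rep_gt] by blast
  then show "\<forall>\<^sub>F y in at x within S. c < lower_rep u y"
    unfolding eventually_at_filter by eventually_elim simp
qed

text \<open>Rational levels and a countable basis of open sets leave only countably many exceptional
  null sets.\<close>

lemma AE_lower_rep_le: "AE x in lborel. lower_rep (u :: 'a::euclidean_space \<Rightarrow> real) x \<le> ereal (u x)"
proof -
  obtain B :: "'a set set" where B: "countable B" "topological_basis B"
    using ex_countable_basis by blast
  have "AE x in lborel. \<forall>q\<in>\<rat>. \<forall>U\<in>B. (AE y in lborel. y \<in> U \<longrightarrow> q \<le> u y) \<longrightarrow> x \<in> U \<longrightarrow> q \<le> u x"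
    using B(1) by (intro AE_ball_countable[THEN iffD2] ballI countable_rat) auto
  then show ?thesis
  proof eventually_elim
    case (elim x)
    show ?case
    proof (rule ccontr)
      assume "\<not> ?case"
      then have "ereal (u x) < lower_rep u x" by simp
      then obtain m U where U: "ereal (u x) < ereal m" "open U" "x \<in> U" "AE y in lborel. y \<in> U \<longrightarrow> m \<le> u y"
        by (rule less_lower_repE)
      obtain V where V: "V \<in> B" "x \<in> V" "V \<subseteq> U" using topological_basisE[OF B(2) U(2,3)] .
      obtain q where q: "q \<in> \<rat>" "u x < q" "q < m" using Rats_dense_in_real[of "u x" m] U(1) by auto
      have "AE y in lborel. y \<in> V \<longrightarrow> q \<le> u y" using U(4) by eventually_elim (use V q in auto)
      then have "q \<le> u x" using elim q(1) V by blast
      then show False using q by simp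
    qed
  qed
qed

text \<open>If \<open>lower_rep u\<close> were at most a < b on a set of positive measure where u is
  at least b, then max 0 (b - u) would vanish on that set and have small averages at one of its
  points; the lower bound at level b would exceed a on a whole ball about this point. Rational pairs
  a < b suffice.\<close>

lemma AE_lower_rep_ge:
  fixes u :: "'a::euclidean_space \<Rightarrow> real"
  assumes s: "0 < s" "s < 1" and \<Omega>: "open \<Omega>" and u [measurable]: "u \<in> borel_measurable borel"
    and int: "integrable lborel (\<lambda>y. u y * kern s 1 y)" and super: "weakly_superharmonic s \<Omega> u"
  shows "AE x in lborel. x \<in> \<Omega> \<longrightarrow> ereal (u x) \<le> lower_rep u x"
proof -
  obtain C where C: "0 < C" and bound: "\<And>x0 R l.
    0 < R \<Longrightarrow> cball x0 (2 * R) \<subseteq> \<Omega> \<Longrightarrow>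
    (AE y in lborel. y \<in> ball x0 (R / 2) \<longrightarrow>
      l - C * (R powr (2 * s) * (\<integral>y. max 0 (l - u y) * kern s R (y - x0) \<partial>lborel)) \<le> u y)"
    using weakly_superharmonic_lower_bound[OF s, where 'a = 'a] u int super by blast
  have null: "emeasure lborel {x \<in> \<Omega>. b \<le> u x \<and> lower_rep u x \<le> ereal a} = 0"
    (is "emeasure lborel ?A = 0") if ab: "a < b" for a b
  proof (rule ccontr)
    assume pos: "emeasure lborel ?A \<noteq> 0"
    have "?A = \<Omega> \<inter> {x. b \<le> u x} - {x. ereal a < lower_rep u x}" by auto
    moreover have "{x. b \<le> u x} \<in> sets borel" by measurable
    ultimately have "?A \<in> sets borel" using \<Omega> open_lower_rep_gt[of "ereal a" u] by auto
    then obtain K where K: "compact K" "K \<subseteq> ?A" "emeasure lborel K \<noteq> 0"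
      using compact_subset_pos_measure pos by blast
    have "K \<subseteq> \<Omega>" using K(2) by auto
    then obtain e where e: "0 < e" "(\<Union>x\<in>K. ball x e) \<subseteq> \<Omega>"
      using compact_subset_open_imp_ball_epsilon_subset[OF K(1) \<Omega>] by blast
    obtain R where R: "\<And>n. 0 < R n" "\<And>n. R n \<le> 1" "\<And>n. R n \<le> e / 3" "R \<longlonglongrightarrow> 0"
      using vanishing_scales[of "e / 3"] e(1) by auto
    define f where "f y = max 0 (b - u y)" for y
    have f: "f \<in> borel_measurable borel" unfolding f_def[abs_def] by measurable
    have ik: "integrable lborel (kern s 1 :: 'a \<Rightarrow> real)" by (rule integrable_kern[OF _ s(1)]) simp
    have "integrable lborel (\<lambda>y. (b - u y) * kern s 1 y)" using int ik by (simp add: left_diff_distrib)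
    then have fi: "integrable lborel (\<lambda>y. f y * kern s 1 y)"
      by (rule Bochner_Integration.integrable_bound) (use f in \<open>auto simp: f_def abs_mult intro!: mult_right_mono\<close>)
    \<comment> \<open>Averages below (b - a) / C are exactly what keeps the lower bound
      \<open>m\<close> above a.\<close>
    have "\<forall>\<^sub>F n in sequentially. \<exists>x\<in>K. R n powr (2 * s) * (\<integral>y. f y * kern s (R n) (y - x) \<partial>lborel) < (b - a) / C"
      by (rule eventually_exists_small_average[OF s(1) K(1,3) f fi _ _ R(1,2,4)])
        (use K(2) ab C in \<open>auto simp: f_def\<close>)
    then obtain n x where x: "x \<in> K" and small: "R n powr (2 * s) * (\<integral>y. f y * kern s (R n) (y - x) \<partial>lborel) < (b - a) / C"
      by (auto simp: eventually_sequentially)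
    define m where "m = b - C * (R n powr (2 * s) * (\<integral>y. f y * kern s (R n) (y - x) \<partial>lborel))"
    have "a < m" using small C by (simp add: m_def field_simps)
    have "cball x (2 * R n) \<subseteq> ball x e" using R(3)[of n] e(1) by auto
    then have "cball x (2 * R n) \<subseteq> \<Omega>" using x e(2) by blast
    from bound[OF R(1) this, of b] have "AE y in lborel. y \<in> ball x (R n / 2) \<longrightarrow> m \<le> u y"
      by (simp add: m_def f_def)
    then have "ereal m \<le> lower_rep u x" using R(1)[of n] by (intro lower_rep_ge[of "ball x (R n / 2)"]) auto
    moreover have "lower_rep u x \<le> ereal a" using x K(2) by blast
    ultimately have "ereal m \<le> ereal a" by (rule order_trans)
    then show False using \<open>a < m\<close> by simp
  qed
  have "AE x in lborel. \<forall>a\<in>\<rat>. \<forall>b\<in>\<rat>. a < b \<longrightarrow> x \<notin> {x \<in> \<Omega>. b \<le> u x \<and> lower_rep u x \<le> ereal a}"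
  proof (intro AE_ball_countable[THEN iffD2] ballI countable_rat)
    fix a b :: real
    have "{x. b \<le> u x} \<in> sets borel" by measurable
    moreover have "{x \<in> \<Omega>. b \<le> u x \<and> lower_rep u x \<le> ereal a} = \<Omega> \<inter> {x. b \<le> u x} - {x. ereal a < lower_rep u x}" by auto
    ultimately have meas: "{x \<in> \<Omega>. b \<le> u x \<and> lower_rep u x \<le> ereal a} \<in> sets borel"
      using \<Omega> open_lower_rep_gt[of "ereal a" u] by auto
    show "AE x in lborel. a < b \<longrightarrow> x \<notin> {x \<in> \<Omega>. b \<le> u x \<and> lower_rep u x \<le> ereal a}"
    proof (cases "a < b")
      case True
      then have "{x \<in> \<Omega>. b \<le> u x \<and> lower_rep u x \<le> ereal a} \<in> null_sets lborel"
        using null[OF True] meas by (simp only: null_sets_def mem_Collect_eq sets_lborel)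
      from AE_not_in[OF this] show ?thesis by eventually_elim blast
    qed simp
  qed
  then show ?thesis
  proof eventually_elim
    case (elim x)
    show ?case
    proof (intro impI, rule ccontr)
      assume x: "x \<in> \<Omega>" "\<not> ereal (u x) \<le> lower_rep u x"
      then have "lower_rep u x < ereal (u x)" by simp
      then obtain c where c: "lower_rep u x < ereal c" "ereal c < ereal (u x)"
        using ereal_dense2 by blast
      obtain a where a: "a \<in> \<rat>" "c < a" "a < u x" using Rats_dense_in_real[of c "u x"] c(2) by auto
      obtain b where b: "b \<in> \<rat>" "a < b" "b < u x" using Rats_dense_in_real[of a "u x"] a(3) by auto
      note less_imp_le[OF c(1)]
      also have "ereal c \<le> ereal a" using a(2) by simp
      finally have "lower_rep u x \<le> ereal a" .
      then show False using elim a(1) b x(1) by auto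
    qed
  qed
qed

lemma lower_rep_locally_bounded_below:
  fixes u :: "'a::euclidean_space \<Rightarrow> real"
  assumes s: "0 < s" "s < 1" and \<Omega>: "open \<Omega>" and u [measurable]: "u \<in> borel_measurable borel"
    and int: "integrable lborel (\<lambda>y. u y * kern s 1 y)" and super: "weakly_superharmonic s \<Omega> u"
    and x: "x \<in> \<Omega>"
  shows "\<exists>r>0. \<exists>m. \<forall>y\<in>ball x r. ereal m \<le> lower_rep u y"
proof -
  obtain e where e: "0 < e" "cball x e \<subseteq> \<Omega>" using open_contains_cball \<Omega> x by blast
  define R where "R = e / 2"
  have R: "0 < R" "cball x (2 * R) \<subseteq> \<Omega>" using e by (auto simp: R_def)
  obtain m where "AE y in lborel. y \<in> ball x (R / 2) \<longrightarrow> m \<le> u y"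
    using weakly_superharmonic_lower_bound[OF s, where 'a = 'a] u int super R by blast
  then have "\<forall>y\<in>ball x (R / 2). ereal m \<le> lower_rep u y" using lower_rep_ge[OF open_ball] by blast
  then show ?thesis using R(1) by (intro exI[of _ "R / 2"]) auto
qed

lemma locally_bdd_below_on_lower_rep:
  fixes u :: "'a::euclidean_space \<Rightarrow> real"
  assumes "0 < s" "s < 1" "open \<Omega>" "u \<in> borel_measurable borel"
    "integrable lborel (\<lambda>y. u y * kern s 1 y)" "weakly_superharmonic s \<Omega> u"
  shows "locally_bdd_below_on \<Omega> (lower_rep u)"
  unfolding locally_bdd_below_on_def
proof (intro allI impI, elim conjE)
  fix K assume K: "compact K" "K \<subseteq> \<Omega>"
  then have "\<forall>x\<in>K. \<exists>r m. 0 < r \<and> (\<forall>y\<in>ball x r. ereal m \<le> lower_rep u y)"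
    using lower_rep_locally_bounded_below[OF assms] by blast
  then obtain r m where rm: "\<And>x. x \<in> K \<Longrightarrow> 0 < r x" "\<And>x y. x \<in> K \<Longrightarrow> y \<in> ball x (r x) \<Longrightarrow> ereal (m x) \<le> lower_rep u y"
    by metis
  obtain D where D: "D \<subseteq> K" "finite D" "K \<subseteq> (\<Union>x\<in>D. ball x (r x))"
    by (rule compactE_image[OF K(1), of K "\<lambda>x. ball x (r x)"]) (use rm(1) in force)+
  show "\<exists>c::real. \<forall>x\<in>K. ereal c \<le> lower_rep u x"
  proof (intro exI[of _ "Min (m ` D)"] ballI)
    fix y assume "y \<in> K"
    then obtain x where x: "x \<in> D" "y \<in> ball x (r x)" using D(3) by blast
    then have "ereal (Min (m ` D)) \<le> ereal (m x)" using D(2) by simp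
    also have "\<dots> \<le> lower_rep u y" using rm(2) x D(1) by blast
    finally show "ereal (Min (m ` D)) \<le> lower_rep u y" .
  qed
qed

text \<open>Only a finite essential infimum calls for the strict bound. The value +\<infinity> is
  impossible for a real-valued function on a space of positive measure, and -\<infinity> lies below
  \<open>lower_rep u x\<close> by local boundedness.\<close>

lemma ess_inf_less_lower_rep:
  fixes u :: "'a::euclidean_space \<Rightarrow> real"
  assumes s: "0 < s" "s < 1" and \<Omega>: "open \<Omega>" and u [measurable]: "u \<in> borel_measurable borel"
    and int: "integrable lborel (\<lambda>y. u y * kern s 1 y)" and super: "weakly_superharmonic s \<Omega> u"
    and nonconst: "\<not> (\<exists>c. AE y in lborel. u y = c)" and x: "x \<in> \<Omega>"
  shows "ess_inf lborel u < lower_rep u x"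
proof -
  have lower: "AE y in lborel. c \<le> ereal (u y)" if that: "c < ess_inf lborel u" for c
  proof -
    have "\<exists>d\<in>{c. AE y in lborel. c \<le> ereal (u y)}. c < d"
      using that unfolding ess_inf_def less_Sup_iff .
    then obtain d where d: "d \<in> {c. AE y in lborel. c \<le> ereal (u y)}" "c < d" ..
    from d(1) have "AE y in lborel. d \<le> ereal (u y)" by simp
    then show ?thesis by eventually_elim (use d(2) in auto)
  qed
  show ?thesis
  proof (cases "ess_inf lborel u")
    case (real m)
    \<comment> \<open>The supremum defining \<open>ess_inf\<close> is itself an essential lower
      bound, as the limit of the countably many bounds m - 1/(n+1).\<close>
    have "AE y in lborel. \<forall>n. ereal (m - inverse (real (Suc n))) \<le> ereal (u y)"
      unfolding AE_all_countable using real by (intro allI lower) auto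
    then have m: "AE y in lborel. m \<le> u y"
    proof eventually_elim
      case (elim y)
      show ?case
      proof (rule ccontr)
        assume "\<not> ?case"
        then obtain n where "inverse (real (Suc n)) < m - u y" using reals_Archimedean[of "m - u y"] by auto
        then show False using elim[rule_format, of n] by simp
      qed
    qed
    obtain e where e: "0 < e" "cball x e \<subseteq> \<Omega>" using open_contains_cball \<Omega> x by blast
    define R where "R = e / 2"
    have R: "0 < R" "cball x (2 * R) \<subseteq> \<Omega>" using e by (auto simp: R_def)
    obtain m' where m': "m < m'" "AE y in lborel. y \<in> ball x (R / 2) \<longrightarrow> m' \<le> u y"
      using weakly_superharmonic_strict_lower_bound[OF s R(1) u int super R(2) m] nonconst by blast
    have "ereal m < ereal m'" using m' by simp
    also have "\<dots> \<le> lower_rep u x" using R(1) m'(2) by (intro lower_rep_ge[of "ball x (R / 2)"]) auto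
    finally show ?thesis using real by simp
  next
    case PInf
    have "AE y in lborel. \<forall>n. ereal (real n) \<le> ereal (u y)"
      unfolding AE_all_countable using PInf by (intro allI lower) auto
    then have "AE y::'a in lborel. False"
    proof eventually_elim
      case (elim y)
      obtain n :: nat where "u y < real n" using reals_Archimedean2 by blast
      with elim[rule_format, of n] show ?case by simp
    qed
    then have "emeasure lborel (UNIV :: 'a set) = 0"
      by (subst (asm) AE_iff_measurable[of UNIV]) auto
    then show ?thesis by simp
  next
    case MInf
    obtain r m where "0 < r" "\<forall>y\<in>ball x r. ereal m \<le> lower_rep u y"
      using lower_rep_locally_bounded_below[OF s \<Omega> u int super x] by blast
    then have "ereal m \<le> lower_rep u x" by simp
    with MInf show ?thesis by auto
  qed
qed

section \<open>From Lebesgue measurable data to Borel functions\<close>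

lemma AE_lborel_fst_snd:
  assumes "AE x in (lborel :: 'a::euclidean_space measure). P x"
  shows "AE z in (lborel :: ('a \<times> 'a) measure). P (fst z) \<and> P (snd z)"
proof -
  obtain N where N: "{x. \<not> P x} \<subseteq> N" "emeasure lborel N = 0" "N \<in> sets (lborel :: 'a measure)"
    using AE_E[OF assms] by auto
  have "emeasure lborel (N \<times> (UNIV :: 'a set)) = 0" "emeasure lborel ((UNIV :: 'a set) \<times> N) = 0"
    using N(2,3) lborel.emeasure_pair_measure_Times[of N lborel UNIV] lborel.emeasure_pair_measure_Times[of UNIV lborel N]
    by (simp_all add: lborel_prod)
  moreover have "N \<times> (UNIV :: 'a set) \<in> sets lborel" "(UNIV :: 'a set) \<times> N \<in> sets lborel"
    using N(3) by (auto simp: borel_prod[symmetric])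
  ultimately have "N \<times> UNIV \<union> UNIV \<times> N \<in> null_sets (lborel :: ('a \<times> 'a) measure)"
    by (intro null_sets.Un) (auto simp: null_sets_def)
  then show ?thesis
    by (rule AE_I') (use N(1) in auto)
qed

lemma frac_const_pos:
  assumes "0 < s" "s < 1"
  shows "0 < frac_const n s"
  unfolding frac_const_def using assms by (intro divide_pos_pos mult_pos_pos Gamma_real_pos) (auto intro: add_nonneg_pos)

text \<open>Only values on \<open>B\<close> enter, where \<open>u\<close> and \<open>v\<close> agree
  almost everywhere, so the energy of \<open>v\<close> dominates. As \<open>v\<close> is merely
  Lebesgue measurable, the comparison takes place in the completion; Borel measurability of
  \<open>u\<close> allows returning to \<open>lborel\<close>.\<close>

lemma energy_integrable_of_frac_sobolev:
  fixes v :: "'a::euclidean_space \<Rightarrow> real"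
  assumes v: "v \<in> frac_sobolev s" and u [measurable]: "u \<in> borel_measurable borel"
    and eq: "AE y in lborel. y \<in> B \<longrightarrow> u y = v y" and B [measurable]: "B \<in> sets borel"
  shows "integrable (lborel \<Otimes>\<^sub>M lborel) (\<lambda>(y, y'). indicator (B \<times> B) (y, y') *
      ((u y - u y')\<^sup>2 / norm (y - y') powr (real DIM('a) + 2 * s)))"
    (is "integrable _ ?E")
proof -
  let ?V = "\<lambda>(x :: 'a, y :: 'a). (v x - v y)\<^sup>2 / norm (x - y) powr (real DIM('a) + 2 * s)"
  have V: "integrable lebesgue ?V" using v by (simp add: frac_sobolev_def)
  have E [measurable]: "?E \<in> borel_measurable borel"
  proof -
    have "?E \<in> borel_measurable (lborel \<Otimes>\<^sub>M lborel)" by measurable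
    then show ?thesis by (simp add: lborel_prod)
  qed
  have "integrable lebesgue ?E"
  proof (rule Bochner_Integration.integrable_bound[OF V])
    show "?E \<in> borel_measurable lebesgue" using E by (intro measurable_completion) simp
    show "AE z in lebesgue. norm (?E z) \<le> norm (?V z)"
    proof (rule AE_completion)
      show "AE z in lborel. norm (?E z) \<le> norm (?V z)"
        using AE_lborel_fst_snd[OF eq] by eventually_elim (auto simp: indicator_def split: prod.split)
    qed
  qed
  then show ?thesis using E by (simp add: integrable_completion lborel_prod)
qed

text \<open>The hypotheses speak of \<open>u\<close> and the completed measure, the conclusion of
  the Borel version \<open>u0\<close>. Changing \<open>u\<close> on a null set affects only a null
  set of pairs, so the tested double integral is the same for both.\<close>

lemma weakly_superharmonic_of_sr_laplacian_nonneg: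
  fixes u u0 :: "'a::euclidean_space \<Rightarrow> real"
  assumes s: "0 < s" "s < 1" and u0 [measurable]: "u0 \<in> borel_measurable borel"
    and eq: "AE x in lborel. u x = u0 x"
    and int: "integrable lborel (\<lambda>y. u0 y * kern s 1 y)"
    and loc: "u \<in> frac_sobolev_loc s \<Omega>" and nonneg: "sr_laplacian_nonneg s \<Omega> u"
  shows "weakly_superharmonic s \<Omega> u0"
  unfolding weakly_superharmonic_def
proof (intro allI impI)
  fix \<rho> and x :: 'a assume \<rho>: "0 < \<rho>" and sub: "cball x (2 * \<rho>) \<subseteq> \<Omega>"
  let ?B = "ball x (2 * \<rho>)"
  define \<phi> where "\<phi> y = mollifier \<rho> (y - x)" for y
  have "closure ?B = cball x (2 * \<rho>)" using \<rho> by simp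
  then obtain v where v: "v \<in> frac_sobolev s" "AE y in lebesgue. y \<in> ?B \<longrightarrow> u y = v y"
    using loc sub unfolding frac_sobolev_loc_def by (auto dest!: spec[of _ ?B])
  have "AE y in lborel. y \<in> ?B \<longrightarrow> u0 y = v y"
    using v(2)[unfolded AE_completion_iff] eq by eventually_elim auto
  then have F: "integrable (lborel \<Otimes>\<^sub>M lborel) (energy_kernel s u0 \<phi>)"
    unfolding \<phi>_def
    by (intro integrable_energy_kernel[OF s \<rho> u0 int] energy_integrable_of_frac_sobolev[OF v(1) u0]) auto
  have "cball x \<rho> \<subseteq> \<Omega>" using sub \<rho> by (auto simp: subset_iff)
  then have "\<phi> \<in> test_functions \<Omega>" unfolding \<phi>_def by (rule mollifier_test_function[OF \<rho>])
  then have 0: "0 \<le> sr_laplacian s \<Omega> u \<phi>"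
    using nonneg \<rho> by (auto simp: sr_laplacian_nonneg_def \<phi>_def)
  have \<phi>_out: "\<phi> y = 0" if "y \<notin> \<Omega>" for y
  proof -
    have "y \<notin> cball x (2 * \<rho>)" using that sub by blast
    then show ?thesis
      using mollifier_eq_0_iff[OF \<rho>, of "y - x"] \<rho> by (simp add: \<phi>_def dist_norm norm_minus_commute[of x y])
  qed
  have Fm: "energy_kernel s u0 \<phi> \<in> borel_measurable lborel"
    using F by (auto simp: lborel_prod dest: borel_measurable_integrable)
  have ae: "AE z in lebesgue. energy_kernel s u0 \<phi> z = energy_kernel s u \<phi> z"
  proof (rule AE_completion)
    show "AE z in lborel. energy_kernel s u0 \<phi> z = energy_kernel s u \<phi> z"
      using AE_lborel_fst_snd[OF eq] by eventually_elim (auto split: prod.split)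
  qed
  have Fl: "energy_kernel s u0 \<phi> \<in> borel_measurable lebesgue" by (rule measurable_completion[OF Fm])
  \<comment> \<open>When both points lie outside \<open>\<Omega>\<close>, the difference of
    \<open>\<phi>\<close> is 0, so the integrand already vanishes on the excluded set.\<close>
  have "indicator (UNIV - (- \<Omega>) \<times> (- \<Omega>)) z *\<^sub>R energy_kernel s u \<phi> z = energy_kernel s u \<phi> z" for z
    using \<phi>_out by (cases z) (auto simp: indicator_def)
  then have "set_lebesgue_integral lebesgue (UNIV - (- \<Omega>) \<times> (- \<Omega>)) (energy_kernel s u \<phi>)
      = integral\<^sup>L lebesgue (energy_kernel s u \<phi>)"
    unfolding set_lebesgue_integral_def by (simp only:)
  also have "\<dots> = integral\<^sup>L lebesgue (energy_kernel s u0 \<phi>)"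
    using ae by (intro integral_cong_AE borel_measurable_AE[OF Fl ae] Fl) auto
  also have "\<dots> = integral\<^sup>L lborel (energy_kernel s u0 \<phi>)" by (rule integral_completion[OF Fm])
  finally have "sr_laplacian s \<Omega> u \<phi> = frac_const DIM('a) s / 2 * integral\<^sup>L lborel (energy_kernel s u0 \<phi>)"
    by (simp add: sr_laplacian_def)
  with 0 frac_const_pos[OF s, of "DIM('a)"] have "0 \<le> integral\<^sup>L (lborel \<Otimes>\<^sub>M lborel) (energy_kernel s u0 \<phi>)"
    by (simp add: lborel_prod zero_le_mult_iff)
  then show "superharmonic_at s (mollify \<rho> u0) x"
    using superharmonic_at_mollify[OF s \<rho> u0 int] F by (simp add: \<phi>_def)
qed

text \<open>Both 1 and |x|^(n+2s) are at most the power n + 2s of max 1 |x|; hence the factor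
  2.\<close>

lemma kern_1_le:
  fixes x :: "'a::euclidean_space"
  assumes "0 < s"
  shows "kern s 1 x \<le> 2 / (1 + norm x powr (real DIM('a) + 2 * s))"
proof -
  let ?p = "real DIM('a) + 2 * s"
  have "norm x powr ?p \<le> max 1 (norm x) powr ?p" using assms by (intro powr_mono2) auto
  moreover have "1 \<le> max 1 (norm x) powr ?p" using assms by (intro ge_one_powr_ge_zero) auto
  ultimately have "1 + norm x powr ?p \<le> 2 * max 1 (norm x) powr ?p" by simp
  moreover have "0 < 1 + norm x powr ?p" by (intro add_pos_nonneg) auto
  ultimately have "2 / (2 * max 1 (norm x) powr ?p) \<le> 2 / (1 + norm x powr ?p)" by (intro divide_left_mono) auto
  moreover have "2 / (2 * t) = 1 / t" for t :: real by simp
  ultimately show ?thesis unfolding kern_def powr_minus_divide by metis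
qed

theorem corollary4p4:
  fixes \<Omega> :: "'a::euclidean_space set" and u :: "'a \<Rightarrow> real" and s :: real
  assumes "0 < s" and "s < 1"
    and "open \<Omega>" and "connected \<Omega>" and "\<Omega> \<noteq> {}"
    and "u \<in> borel_measurable lebesgue"
    and "\<not> (\<exists>c. AE x in lebesgue. u x = c)"
    and "u \<in> frac_sobolev_loc s \<Omega>"
    and "integrable lebesgue (\<lambda>x. \<bar>u x\<bar> / (1 + norm x powr (real DIM('a) + 2 * s)))"
    and "sr_laplacian_nonneg s \<Omega> u"
  shows "\<exists>u' :: 'a \<Rightarrow> ereal.
           {x. u' x \<noteq> ereal (u x)} \<subseteq> \<Omega> \<and>
           {x. u' x \<noteq> ereal (u x)} \<in> null_sets lebesgue \<and>
           (\<forall>x. u' x \<noteq> -\<infinity>) \<and>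
           lsc_on \<Omega> u' \<and>
           locally_bdd_below_on \<Omega> u' \<and>
           (\<forall>x\<in>\<Omega>. ess_inf lebesgue u < u' x)"
proof -
  let ?p = "real DIM('a) + 2 * s"
  obtain u0 where u0 [measurable]: "u0 \<in> borel_measurable borel" and eq: "AE x in lborel. u x = u0 x"
    using completion_ex_borel_measurable_real[OF assms(6)] by auto
  have int: "integrable lborel (\<lambda>y. u0 y * kern s 1 y)"
  proof -
    have "integrable lebesgue (\<lambda>y. u0 y * kern s 1 y)"
    proof (rule Bochner_Integration.integrable_bound)
      show "integrable lebesgue (\<lambda>x. 2 * (\<bar>u x\<bar> / (1 + norm x powr ?p)))"
        using assms(9) by (rule integrable_mult_right)
      show "(\<lambda>y. u0 y * kern s 1 y) \<in> borel_measurable lebesgue" by (intro measurable_completion) simp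
      show "AE y in lebesgue. norm (u0 y * kern s 1 y) \<le> norm (2 * (\<bar>u y\<bar> / (1 + norm y powr ?p)))"
      proof (rule AE_completion)
        show "AE y in lborel. norm (u0 y * kern s 1 y) \<le> norm (2 * (\<bar>u y\<bar> / (1 + norm y powr ?p)))"
          using eq
        proof eventually_elim
          case (elim y)
          have "0 < 1 + norm y powr ?p" by (intro add_pos_nonneg) auto
          then show ?case
            using mult_left_mono[OF kern_1_le[OF assms(1), of y], of "\<bar>u y\<bar>"] elim by (simp add: abs_mult mult_ac)
        qed
      qed
    qed
    then show ?thesis by (simp add: integrable_completion)
  qed
  have super: "weakly_superharmonic s \<Omega> u0"
    by (rule weakly_superharmonic_of_sr_laplacian_nonneg[OF assms(1,2) u0 eq int assms(8,10)])
  have nonconst: "\<not> (\<exists>c. AE x in lborel. u0 x = c)"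
  proof
    assume "\<exists>c. AE x in lborel. u0 x = c"
    then obtain c where "AE x in lborel. u0 x = c" ..
    with eq have "AE x in lborel. u x = c" by eventually_elim simp
    then show False using assms(7) AE_completion by blast
  qed
  note hyps = assms(1-3) u0 int super
  \<comment> \<open>Outside \<open>\<Omega>\<close> the function \<open>u\<close> itself is kept,
    not its Borel version, because the modification has to be confined to
    \<open>\<Omega>\<close>.\<close>
  define u' where "u' x = (if x \<in> \<Omega> then lower_rep u0 x else ereal (u x))" for x
  have "AE x in lborel. u' x = ereal (u x)"
    using AE_lower_rep_le[of u0] AE_lower_rep_ge[OF hyps] eq by eventually_elim (auto simp: u'_def)
  then have "AE x in lebesgue. u' x = ereal (u x)" by (rule AE_completion)
  then have null: "{x. u' x \<noteq> ereal (u x)} \<in> null_sets lebesgue"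
    by (simp add: completion.AE_iff_null_sets Compl_eq)
  have inf: "ess_inf lebesgue u = ess_inf lborel u0"
  proof -
    have "(AE x in lebesgue. c \<le> ereal (u x)) \<longleftrightarrow> (AE x in lborel. c \<le> ereal (u0 x))" for c
      unfolding AE_completion_iff
    proof
      assume "AE x in lborel. c \<le> ereal (u x)"
      with eq show "AE x in lborel. c \<le> ereal (u0 x)" by eventually_elim simp
    next
      assume "AE x in lborel. c \<le> ereal (u0 x)"
      with eq show "AE x in lborel. c \<le> ereal (u x)" by eventually_elim simp
    qed
    then show ?thesis by (simp add: ess_inf_def)
  qed
  have strict: "ess_inf lebesgue u < u' x" if "x \<in> \<Omega>" for x
    using ess_inf_less_lower_rep[OF hyps nonconst that] that by (simp add: inf u'_def)
  have lsc: "lsc_on \<Omega> u'"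
    unfolding lsc_on_def
  proof
    fix x assume x: "x \<in> \<Omega>"
    have "\<forall>\<^sub>F y in at x within \<Omega>. u' y = lower_rep u0 y"
      unfolding eventually_at_filter by (simp add: u'_def)
    then have "Liminf (at x within \<Omega>) u' = Liminf (at x within \<Omega>) (lower_rep u0)" by (rule Liminf_eq)
    then show "u' x \<le> Liminf (at x within \<Omega>) u'"
      using lsc_on_lower_rep[of \<Omega> u0] x by (simp add: lsc_on_def u'_def)
  qed
  have bdd: "locally_bdd_below_on \<Omega> u'"
    unfolding locally_bdd_below_on_def
  proof (intro allI impI, elim conjE)
    fix K assume K: "compact K" "K \<subseteq> \<Omega>"
    then obtain m :: real where "\<forall>x\<in>K. ereal m \<le> lower_rep u0 x"
      using locally_bdd_below_on_lower_rep[OF hyps] unfolding locally_bdd_below_on_def by blast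
    then show "\<exists>m::real. \<forall>x\<in>K. ereal m \<le> u' x"
      using K(2) by (intro exI[of _ m]) (auto simp: u'_def)
  qed
  \<comment> \<open>In \<open>\<Omega>\<close> the strict inequality excludes -\<infinity>, even
    when the essential infimum is -\<infinity>; elsewhere the value is real.\<close>
  have "u' x \<noteq> -\<infinity>" for x
    using strict[of x] by (cases "x \<in> \<Omega>") (auto simp: u'_def)
  moreover have "{x. u' x \<noteq> ereal (u x)} \<subseteq> \<Omega>" by (auto simp: u'_def)
  ultimately show ?thesis using null lsc bdd strict by blast
qed

end
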